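(* Let $\delta_1,\delta_2,\delta_3$ be real numbers with $$\delta_2-\delta_1=\delta_3-\delta_2=\lambda/2>0,$$ let $\boldsymbol\pi$ be the unique invariant probability measure of the gap process $(G(\cdot),H(\cdot))$ described in the context, and let $$\widehat{\boldsymbol\pi}(\alpha_1,\alpha_2)=\int_{(0,\infty)^2}e^{-\alpha_1g-\alpha_2h}\,\boldsymbol\pi(dg,dh),\qquad\alpha_1,\alpha_2\ge0.$$ Then for every $(\alpha_1,\alpha_2)\in[0,\infty)^2\setminus\{(0,0)\}$, $$\widehat{\boldsymbol\pi}(\alpha_1,\alpha_2)=\frac{\lambda}{(\alpha_1-\alpha_2)^2+\lambda(\alpha_1+\alpha_2)}\Big[(2\alpha_1-\alpha_2)\,\widehat{\boldsymbol\pi}(\alpha_2,\alpha_2)+(2\alpha_2-\alpha_1)\,\widehat{\boldsymbol\pi}(\alpha_1,\alpha_1)\Big].$$ In particular, the joint distribution $\boldsymbol\pi$ of the gaps in steady state is determined by the distribution of their sum.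
   Context: Let $W(\cdot)$ be a standard scalar Brownian motion and $x_1>x_2>x_3$ real numbers. The process $(G(\cdot),H(\cdot))$ is the continuous $[0,\infty)^2$-valued process $$G(t)=x_1-x_2-(\delta_2-\delta_1)t-W(t)-\tfrac12\Gamma(t)+A(t),$$ $$H(t)=x_2-x_3-(\delta_3-\delta_2)t+W(t)-\tfrac12A(t)+\Gamma(t),$$ where $(A,\Gamma)$ is the unique pair of continuous, nondecreasing, $W$-adapted processes with $A(0)=\Gamma(0)=0$ and $$A(t)=\max_{0\le s\le t}\big(-(x_1-x_2)+(\delta_2-\delta_1)s+W(s)+\tfrac12\Gamma(s)\big)^+,$$ $$\Gamma(t)=\max_{0\le s\le t}\big(-(x_2-x_3)+(\delta_3-\delta_2)s-W(s)+\tfrac12A(s)\big)^+.$$ Under the stated condition on the $\delta_i$ this Markov process is positive recurrent and has a unique invariant probability measure $\boldsymbol\pi$, with $\boldsymbol\pi((0,\infty)^2)=1$. Note that $\alpha\mapsto\widehat{\boldsymbol\pi}(\alpha,\alpha)$ is the Laplace transform of the distribution of the sum $g+h$ under $\boldsymbol\pi$. *)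

theory Defs
  imports "HOL-Probability.Probability"
begin

definition standard_brownian_motion :: "'a measure \<Rightarrow> (real \<Rightarrow> 'a \<Rightarrow> real) \<Rightarrow> bool" where
  "standard_brownian_motion M W \<longleftrightarrow>
     prob_space M \<and>
     (\<forall>t\<ge>0. W t \<in> borel_measurable M) \<and>
     (\<forall>\<omega>\<in>space M. W 0 \<omega> = 0 \<and> continuous_on {0..} (\<lambda>t. W t \<omega>)) \<and>
     (\<forall>s t. 0 \<le> s \<and> s < t \<longrightarrow>
        distributed M lborel (\<lambda>\<omega>. W t \<omega> - W s \<omega>) (normal_density 0 (sqrt (t - s)))) \<and>
     (\<forall>(n::nat) \<tau> :: nat \<Rightarrow> real. 0 \<le> \<tau> 0 \<and> (\<forall>i<n. \<tau> i < \<tau> (Suc i)) \<longrightarrow>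
        prob_space.indep_vars M (\<lambda>_. borel) (\<lambda>i \<omega>. W (\<tau> (Suc i)) \<omega> - W (\<tau> i) \<omega>) {..<n})"

definition natural_filtration :: "'a measure \<Rightarrow> (real \<Rightarrow> 'a \<Rightarrow> real) \<Rightarrow> real \<Rightarrow> 'a measure" where
  "natural_filtration M W t =
     sigma (space M) {W s -` B \<inter> space M | s B. 0 \<le> s \<and> s \<le> t \<and> B \<in> sets borel}"

definition regulator :: "'a measure \<Rightarrow> (real \<Rightarrow> 'a \<Rightarrow> real) \<Rightarrow> (real \<Rightarrow> 'a \<Rightarrow> real) \<Rightarrow> bool" where
  "regulator M W A \<longleftrightarrow>
     (\<forall>\<omega>\<in>space M. A 0 \<omega> = 0 \<and> continuous_on {0..} (\<lambda>t. A t \<omega>) \<and> mono_on {0..} (\<lambda>t. A t \<omega>)) \<and>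
     (\<forall>t\<ge>0. A t \<in> borel_measurable (natural_filtration M W t))"

text \<open>
  The starting state is the pair of initial gaps, \<open>g0 = x1 - x2\<close> and \<open>h0 = x2 - x3\<close>.
  The suprema below are maxima of continuous functions over a compact interval.
\<close>

definition gap_regulators ::
  "'a measure \<Rightarrow> (real \<Rightarrow> 'a \<Rightarrow> real) \<Rightarrow> real \<Rightarrow> real \<Rightarrow> real \<Rightarrow> real \<times> real \<Rightarrow>
   (real \<Rightarrow> 'a \<Rightarrow> real) \<Rightarrow> (real \<Rightarrow> 'a \<Rightarrow> real) \<Rightarrow> bool" where
  "gap_regulators M W \<delta>1 \<delta>2 \<delta>3 = (\<lambda>(g0, h0) A \<Gamma>.
     regulator M W A \<and> regulator M W \<Gamma> \<and>
     (\<forall>\<omega>\<in>space M. \<forall>t\<ge>0.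
        A t \<omega> = (SUP s\<in>{0..t}. max 0 (- g0 + (\<delta>2 - \<delta>1) * s + W s \<omega> + \<Gamma> s \<omega> / 2)) \<and>
        \<Gamma> t \<omega> = (SUP s\<in>{0..t}. max 0 (- h0 + (\<delta>3 - \<delta>2) * s - W s \<omega> + A s \<omega> / 2))))"

definition gap_process ::
  "'a measure \<Rightarrow> (real \<Rightarrow> 'a \<Rightarrow> real) \<Rightarrow> real \<Rightarrow> real \<Rightarrow> real \<Rightarrow> real \<times> real \<Rightarrow>
   (real \<Rightarrow> 'a \<Rightarrow> real \<times> real) \<Rightarrow> bool" where
  "gap_process M W \<delta>1 \<delta>2 \<delta>3 = (\<lambda>(g0, h0) GH.
     \<exists>A \<Gamma>. gap_regulators M W \<delta>1 \<delta>2 \<delta>3 (g0, h0) A \<Gamma> \<and>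
       (\<forall>\<omega>\<in>space M. \<forall>t\<ge>0. GH t \<omega> =
          (g0 - (\<delta>2 - \<delta>1) * t - W t \<omega> - \<Gamma> t \<omega> / 2 + A t \<omega>,
           h0 - (\<delta>3 - \<delta>2) * t + W t \<omega> - A t \<omega> / 2 + \<Gamma> t \<omega>)))"

text \<open>
  A Markov process with state space \<open>[0, \<infinity>)\<^sup>2\<close> is given by the processes \<open>X x\<close> started
  at the states \<open>x\<close>; its transition kernel is \<open>P t x B = \<P>(X x t \<in> B)\<close>.
  Invariance is \<open>\<integral> P t x B \<pi>(dx) = \<pi> B\<close> for all times \<open>t\<close> and Borel sets \<open>B\<close>.
\<close>

definition transition_kernel ::
  "'a measure \<Rightarrow> (real \<times> real \<Rightarrow> real \<Rightarrow> 'a \<Rightarrow> real \<times> real) \<Rightarrow> real \<Rightarrow> real \<times> real \<Rightarrow>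
   (real \<times> real) measure" where
  "transition_kernel M X t x = distr M borel (X x t)"

definition invariant_probability ::
  "(real \<Rightarrow> real \<times> real \<Rightarrow> (real \<times> real) measure) \<Rightarrow> (real \<times> real) measure \<Rightarrow> bool" where
  "invariant_probability P \<pi> \<longleftrightarrow>
     prob_space \<pi> \<and> sets \<pi> = sets borel \<and> emeasure \<pi> ({0..} \<times> {0..}) = 1 \<and>
     (\<forall>t\<ge>0. \<forall>B\<in>sets borel.
        (\<integral>\<^sup>+x\<in>{0..} \<times> {0..}. emeasure (P t x) B \<partial>\<pi>) = emeasure \<pi> B)"

definition unique_invariant_probability ::
  "(real \<Rightarrow> real \<times> real \<Rightarrow> (real \<times> real) measure) \<Rightarrow> (real \<times> real) measure \<Rightarrow> bool" where
  "unique_invariant_probability P \<pi> \<longleftrightarrow>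
     invariant_probability P \<pi> \<and> (\<forall>\<nu>. invariant_probability P \<nu> \<longrightarrow> \<nu> = \<pi>)"

definition gap_steady_state ::
  "'a measure \<Rightarrow> (real \<Rightarrow> 'a \<Rightarrow> real) \<Rightarrow> real \<Rightarrow> real \<Rightarrow> real \<Rightarrow> (real \<times> real) measure \<Rightarrow> bool" where
  "gap_steady_state M W \<delta>1 \<delta>2 \<delta>3 \<pi> \<longleftrightarrow>
     (\<exists>X. (\<forall>x\<in>{0..} \<times> {0..}. gap_process M W \<delta>1 \<delta>2 \<delta>3 x (X x)) \<and>
          unique_invariant_probability (transition_kernel M X) \<pi>)"

definition laplace2 :: "(real \<times> real) measure \<Rightarrow> real \<Rightarrow> real \<Rightarrow> real" where
  "laplace2 \<pi> \<alpha>1 \<alpha>2 =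
     (LINT x:{0<..} \<times> {0<..}|\<pi>. exp (- \<alpha>1 * fst x - \<alpha>2 * snd x))"

definition sum_distribution :: "(real \<times> real) measure \<Rightarrow> real measure" where
  "sum_distribution \<pi> = distr \<pi> borel (\<lambda>x. fst x + snd x)"

end

theory Submission
  imports Defs
begin

text \<open>Write \<open>d = lam / 2\<close>, \<open>\<theta> = \<alpha>1 - \<alpha>2\<close> and \<open>Y = \<alpha>1 G + \<alpha>2 H\<close>. The gap process is driven by
\<open>dY = - (\<alpha>1 + \<alpha>2) d dt - \<theta> dW + (\<alpha>1 - \<alpha>2/2) dA + (\<alpha>2 - \<alpha>1/2) d\<Gamma>\<close>, where \<open>A\<close> grows only while \<open>G = 0\<close> and
\<open>\<Gamma>\<close> only while \<open>H = 0\<close>. Taking expectations of \<open>exp (- Y)\<close> in the stationary regime therefore gives the basic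
adjoint relation
\<open>((\<alpha>1 + \<alpha>2) d + \<theta>\<^sup>2/2) \<pi>hat (\<alpha>1, \<alpha>2) = (\<alpha>1 - \<alpha>2/2) \<nu>1 (\<alpha>2) + (\<alpha>2 - \<alpha>1/2) \<nu>2 (\<alpha>1)\<close>,
where \<open>\<nu>1 (b)\<close> is the stationary rate of \<open>\<integral> exp (- b H) dA\<close> and \<open>\<nu>2 (b)\<close> that of \<open>\<integral> exp (- b G) d\<Gamma>\<close>.
Because the two drifts are equal, replacing \<open>W\<close> by \<open>- W\<close> exchanges the two gaps, so uniqueness makes \<open>\<pi>\<close>
symmetric and \<open>\<nu>1 = \<nu>2\<close>. On the diagonal \<open>\<alpha>1 = \<alpha>2 = b > 0\<close> the relation then reads
\<open>\<nu>1 (b) = lam * \<pi>hat (b, b)\<close>; this extends to \<open>b = 0\<close> by continuity, and inserting it back gives the formula.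

The relation is obtained here without stochastic integration, from a single time step of length
\<open>r\<^sup>2 \<longrightarrow> 0\<close>: by stationarity \<open>exp (- Y)\<close> has the same mean at times \<open>0\<close> and \<open>r\<^sup>2\<close>, and a second order Taylor
expansion of the difference (lemma \<open>adjoint_relation_pointwise\<close>) leaves an error that, divided by
\<open>r\<^sup>2\<close>, vanishes as \<open>r \<longrightarrow> 0\<close> (lemma \<open>adjoint_defect_le\<close>). Two inputs control the error. The fourth moment of the
running maximum of Brownian motion over \<open>[0, t]\<close> is of order \<open>t\<^sup>2\<close> (lemma \<open>running_maximum\<close>). And \<open>\<pi>\<close> does not
charge the axes (lemma \<open>boundary_null\<close>), so that the cross terms between \<open>W\<close> and the regulators, which are of
order \<open>r\<^sup>2\<close> but live on paths that reach the boundary, are negligible.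

The law of the process as a function of \<open>W\<close> enters through an explicit time discretisation of the reflection
equations (lemma \<open>reflection_scheme_converges\<close>). It shows that the gaps depend measurably on the starting
state and the path, and it transports the symmetry of the increments of \<open>W\<close> to the gaps (lemma
\<open>reflection_symmetry\<close>).

Finally, the Laplace transform on the quadrant determines a measure (lemma \<open>laplace_determines_measure\<close>), and the
formula expresses it through its diagonal, which is the transform of the sum of the gaps. The parameter \<open>lam\<close> is
itself a function of the law of the sum: expanding the formula at the origin shows that the sum has mean
\<open>2 / (3 lam)\<close> (lemma \<open>mean_of_sum\<close>).\<close>

section \<open>Measures on the quadrant and their Laplace transforms\<close>

lemma borel_measurable_coordinates [measurable]:
  "(fst :: real \<times> real \<Rightarrow> real) \<in> borel_measurable borel"
  "(snd :: real \<times> real \<Rightarrow> real) \<in> borel_measurable borel"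
  by (auto intro!: borel_measurable_continuous_onI continuous_intros)

lemma swap_measurable: "(prod.swap :: real \<times> real \<Rightarrow> _) \<in> borel \<rightarrow>\<^sub>M borel"
  unfolding prod.swap_def by (intro borel_measurable_Pair) measurable

lemma quadrant_sets:
  "{0..} \<times> {0..} \<in> sets (borel :: (real \<times> real) measure)"
  "{0<..} \<times> {0<..} \<in> sets (borel :: (real \<times> real) measure)"
  by (intro borel_closed closed_Times closed_atLeast) (intro borel_open open_Times open_greaterThan)

lemma abs_le_one_plus_fourth_power: "\<bar>x\<bar> \<le> 1 + x ^ 4" for x :: real
proof (cases "\<bar>x\<bar> \<le> 1")
  case False
  then have "\<bar>x\<bar> ^ 1 \<le> \<bar>x\<bar> ^ 4" by (intro power_increasing) auto
  then show ?thesis by simp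
qed (simp add: add_increasing2)

text \<open>The induction over polynomials does not go through for equality of expectations, since products of two such
polynomials are not covered. The invariant used instead is that multiplication by \<open>p\<close> preserves the class of
functions whose expectations agree against every monomial; it is stable under products.\<close>

lemma expectation_polynomial_eq:
  fixes \<mu> \<nu> :: "(real \<times> real) measure"
  assumes p: "real_polynomial_function p"
    and mon: "\<And>m n::nat. integrable \<mu> (\<lambda>x. fst x ^ m * snd x ^ n) \<and> integrable \<nu> (\<lambda>x. fst x ^ m * snd x ^ n) \<and>
       (LINT x|\<mu>. fst x ^ m * snd x ^ n) = (LINT x|\<nu>. fst x ^ m * snd x ^ n)"
  shows "(LINT x|\<mu>. p x) = (LINT x|\<nu>. p x)"
proof -
  \<comment> \<open>Multiplying by all monomials builds closure under the two coordinate functions into the class.\<close>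
  define good where "good f \<longleftrightarrow> (\<forall>m n::nat. integrable \<mu> (\<lambda>x. fst x ^ m * snd x ^ n * f x) \<and>
       integrable \<nu> (\<lambda>x. fst x ^ m * snd x ^ n * f x) \<and>
       (LINT x|\<mu>. fst x ^ m * snd x ^ n * f x) = (LINT x|\<nu>. fst x ^ m * snd x ^ n * f x))"
    for f :: "real \<times> real \<Rightarrow> real"
  have good1: "good (\<lambda>x. 1)" using mon by (simp add: good_def)
  have good_cmult: "good (\<lambda>x. c * f x)" if "good f" for c f
    using that by (auto simp: good_def mult.left_commute[of _ c])
  have good_add: "good (\<lambda>x. f x + g x)" if "good f" "good g" for f g
    using that by (auto simp: good_def distrib_left)
  have good_fst: "good (\<lambda>x. fst x * f x)" if "good f" for f
    unfolding good_def
  proof (intro allI)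
    fix m n
    have "(\<lambda>x. fst x ^ m * snd x ^ n * (fst x * f x)) = (\<lambda>x. fst x ^ Suc m * snd x ^ n * f x)"
      by (auto simp: ac_simps)
    then show "integrable \<mu> (\<lambda>x. fst x ^ m * snd x ^ n * (fst x * f x)) \<and>
       integrable \<nu> (\<lambda>x. fst x ^ m * snd x ^ n * (fst x * f x)) \<and>
       (LINT x|\<mu>. fst x ^ m * snd x ^ n * (fst x * f x)) = (LINT x|\<nu>. fst x ^ m * snd x ^ n * (fst x * f x))"
      using that unfolding good_def by metis
  qed
  have good_snd: "good (\<lambda>x. snd x * f x)" if "good f" for f
    unfolding good_def
  proof (intro allI)
    fix m n
    have "(\<lambda>x. fst x ^ m * snd x ^ n * (snd x * f x)) = (\<lambda>x. fst x ^ m * snd x ^ Suc n * f x)"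
      by (auto simp: ac_simps)
    then show "integrable \<mu> (\<lambda>x. fst x ^ m * snd x ^ n * (snd x * f x)) \<and>
       integrable \<nu> (\<lambda>x. fst x ^ m * snd x ^ n * (snd x * f x)) \<and>
       (LINT x|\<mu>. fst x ^ m * snd x ^ n * (snd x * f x)) = (LINT x|\<nu>. fst x ^ m * snd x ^ n * (snd x * f x))"
      using that unfolding good_def by metis
  qed
  have "\<forall>f. good f \<longrightarrow> good (\<lambda>x. p x * f x)"
    using p
  proof induction
    case (linear l)
    show ?case
    proof (intro allI impI)
      fix f assume f: "good f"
      interpret bounded_linear l by fact
      have l: "l x = l (1, 0) * fst x + l (0, 1) * snd x" for x
      proof -
        have "l x = l (fst x *\<^sub>R (1, 0) + snd x *\<^sub>R (0, 1))" by simp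
        then show ?thesis by (simp only: add scaleR) (simp add: mult.commute)
      qed
      have "good (\<lambda>x. l (1, 0) * (fst x * f x) + l (0, 1) * (snd x * f x))"
        by (intro good_add good_cmult good_fst good_snd f)
      also have "(\<lambda>x. l (1, 0) * (fst x * f x) + l (0, 1) * (snd x * f x)) = (\<lambda>x. l x * f x)"
      proof
        fix x show "l (1, 0) * (fst x * f x) + l (0, 1) * (snd x * f x) = l x * f x"
          unfolding l[of x] by (simp add: algebra_simps)
      qed
      finally show "good (\<lambda>x. l x * f x)" .
    qed
  next
    case (const c) then show ?case using good_cmult by blast
  next
    case (add p q) then show ?case using good_add by (auto simp: distrib_right)
  next
    case (mult p q) then show ?case by (auto simp: mult.assoc)
  qed
  then have "good (\<lambda>x. p x * 1)" using good1 by blast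
  then show ?thesis
    by (auto simp: good_def dest: spec[of _ 0] dest!: spec2[of _ 0 0])
qed

text \<open>Monomials are dense in the continuous functions on the unit square, which in turn approximate the
  indicators of closed sets.\<close>

lemma moments_determine_measure_unit_square:
  fixes \<mu> \<nu> :: "(real \<times> real) measure"
  assumes \<mu>: "prob_space \<mu>" "sets \<mu> = sets borel" "AE x in \<mu>. x \<in> {0..1} \<times> {0..1}"
    and \<nu>: "prob_space \<nu>" "sets \<nu> = sets borel" "AE x in \<nu>. x \<in> {0..1} \<times> {0..1}"
    and eq: "\<And>m n::nat. (LINT x|\<mu>. fst x ^ m * snd x ^ n) = (LINT x|\<nu>. fst x ^ m * snd x ^ n)"
  shows "\<mu> = \<nu>"
proof -
  interpret \<mu>: prob_space \<mu> by fact
  interpret \<nu>: prob_space \<nu> by fact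
  have meas[measurable_cong]: "sets \<mu> = sets borel" "sets \<nu> = sets borel" by fact+
  have mon: "integrable \<mu> (\<lambda>x. fst x ^ m * snd x ^ n) \<and> integrable \<nu> (\<lambda>x. fst x ^ m * snd x ^ n) \<and>
       (LINT x|\<mu>. fst x ^ m * snd x ^ n) = (LINT x|\<nu>. fst x ^ m * snd x ^ n)" for m n :: nat
  proof -
    have b: "\<bar>fst x ^ m * snd x ^ n\<bar> \<le> 1" if "x \<in> {0..1} \<times> {0..1}" for x :: "real \<times> real"
      using that by (auto simp: abs_mult power_abs intro!: mult_le_one power_le_one)
    have "integrable \<mu> (\<lambda>x. fst x ^ m * snd x ^ n)"
      by (rule \<mu>.integrable_const_bound[where B = 1]) (use \<mu>(3) b in \<open>auto elim!: eventually_mono\<close>)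
    moreover have "integrable \<nu> (\<lambda>x. fst x ^ m * snd x ^ n)"
      by (rule \<nu>.integrable_const_bound[where B = 1]) (use \<nu>(3) b in \<open>auto elim!: eventually_mono\<close>)
    ultimately show ?thesis using eq by simp
  qed
  have cont_eq: "(LINT x|\<mu>. f x) = (LINT x|\<nu>. f x)"
    if f: "continuous_on UNIV f" and fb: "\<And>x. \<bar>f x\<bar> \<le> 1" for f :: "real \<times> real \<Rightarrow> real"
  proof (rule ccontr)
    assume ne: "(LINT x|\<mu>. f x) \<noteq> (LINT x|\<nu>. f x)"
    define e where "e = \<bar>(LINT x|\<mu>. f x) - (LINT x|\<nu>. f x)\<bar> / 3"
    have e: "e > 0" using ne by (simp add: e_def)
    obtain p where p: "real_polynomial_function p" and pe: "\<And>x. x \<in> {0..1} \<times> {0..1} \<Longrightarrow> \<bar>f x - p x\<bar> < e"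
      using Stone_Weierstrass_real_polynomial_function[of "{0..1} \<times> {0..1}" f e] e f
      by (metis compact_Icc compact_Times continuous_on_subset subset_UNIV)
    have [measurable]: "f \<in> borel_measurable borel"
      using f by (rule borel_measurable_continuous_onI)
    have "continuous_on UNIV p" using p real_polynomial_function_eq continuous_on_polymonial_function by blast
    then have [measurable]: "p \<in> borel_measurable borel"
      by (rule borel_measurable_continuous_onI)
    have close: "\<bar>(LINT x|\<kappa>. f x) - (LINT x|\<kappa>. p x)\<bar> \<le> e"
      if "prob_space \<kappa>" and [measurable_cong]: "sets \<kappa> = sets borel" and ae: "AE x in \<kappa>. x \<in> {0..1} \<times> {0..1}" for \<kappa>
    proof -
      interpret prob_space \<kappa> by fact
      have 1: "integrable \<kappa> f" by (rule integrable_const_bound[where B = 1]) (auto simp: fb)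
      have 2: "integrable \<kappa> p"
      proof (rule integrable_const_bound[where B = "1 + e"])
        have "\<bar>p x\<bar> \<le> 1 + e" if "x \<in> {0..1} \<times> {0..1}" for x using pe[OF that] fb[of x] by linarith
        then show "AE x in \<kappa>. norm (p x) \<le> 1 + e" using ae by (auto elim!: eventually_mono)
      qed simp
      have "\<bar>LINT x|\<kappa>. f x - p x\<bar> \<le> (LINT x|\<kappa>. \<bar>f x - p x\<bar>)" by (rule integral_abs_bound)
      also have "\<dots> \<le> (LINT x|\<kappa>. e)"
        by (rule integral_mono_AE) (use ae 1 2 in \<open>auto elim!: eventually_mono dest!: pe\<close>)
      finally show ?thesis using 1 2 by (simp add: prob_space)
    qed
    have "(LINT x|\<mu>. p x) = (LINT x|\<nu>. p x)" by (rule expectation_polynomial_eq[OF p mon])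
    then have "\<bar>(LINT x|\<mu>. f x) - (LINT x|\<nu>. f x)\<bar> \<le> 2 * e"
      using close[OF \<mu>] close[OF \<nu>] by linarith
    then show False using e by (simp add: e_def)
  qed
  have closed_eq: "emeasure \<mu> C = emeasure \<nu> C" if C: "closed C" for C
  proof (cases "C = {}")
    case False
    define f where "f n x = max 0 (1 - real n * infdist x C)" for n and x :: "real \<times> real"
    have f_cont: "continuous_on UNIV (f n)" for n
      unfolding f_def by (intro continuous_intros)
    have [measurable]: "f n \<in> borel_measurable borel" for n
      using f_cont by (rule borel_measurable_continuous_onI)
    have fb: "\<bar>f n x\<bar> \<le> 1" for n x by (auto simp: f_def infdist_nonneg)
    have lim: "(\<lambda>n. f n x) \<longlonglongrightarrow> indicator C x" for x
    proof (cases "x \<in> C")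
      case True then show ?thesis by (simp add: f_def)
    next
      case ne: False
      have "infdist x C > 0" using C False ne by (simp add: infdist_pos_not_in_closed)
      then obtain N where N: "1 / infdist x C < real N" using reals_Archimedean2 by blast
      have "f n x = 0" if "n \<ge> N" for n
      proof -
        have "1 / infdist x C < real n" using N that by linarith
        then show ?thesis using \<open>infdist x C > 0\<close> by (simp add: f_def field_simps)
      qed
      then have "eventually (\<lambda>n. f n x = 0) sequentially" by (rule eventually_sequentiallyI)
      then show ?thesis using ne by (simp add: tendsto_eventually)
    qed
    have [measurable]: "C \<in> sets borel" using C by auto
    have lim_int: "(\<lambda>n. LINT x|\<kappa>. f n x) \<longlonglongrightarrow> measure \<kappa> C"
      if "prob_space \<kappa>" and [measurable_cong]: "sets \<kappa> = sets borel" for \<kappa>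
    proof -
      interpret prob_space \<kappa> by fact
      have "(\<lambda>n. LINT x|\<kappa>. f n x) \<longlonglongrightarrow> (LINT x|\<kappa>. indicator C x)"
        by (rule integral_dominated_convergence[where w = "\<lambda>_. 1"]) (use lim fb in auto)
      then show ?thesis by simp
    qed
    have "(\<lambda>n. LINT x|\<mu>. f n x) = (\<lambda>n. LINT x|\<nu>. f n x)" using cont_eq[OF f_cont fb] by simp
    then have "measure \<mu> C = measure \<nu> C"
      using lim_int[OF \<mu>(1,2)] lim_int[OF \<nu>(1,2)] LIMSEQ_unique by metis
    then show ?thesis by (simp add: \<mu>.emeasure_eq_measure \<nu>.emeasure_eq_measure)
  qed simp
  show ?thesis
    by (rule measure_eqI_generator_eq[where E = "Collect closed" and \<Omega> = UNIV and A = "\<lambda>_. UNIV"])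
       (use closed_eq meas in \<open>auto simp: Int_stable_def borel_eq_closed\<close>)
qed

text \<open>Under the change of variables \<open>x \<mapsto> (exp (- fst x), exp (- snd x))\<close> the transform at integer arguments becomes the
family of mixed moments on the unit square.\<close>

lemma laplace_determines_measure:
  fixes \<mu> \<nu> :: "(real \<times> real) measure"
  assumes \<mu>: "prob_space \<mu>" "sets \<mu> = sets borel" "AE x in \<mu>. x \<in> {0..} \<times> {0..}"
    and \<nu>: "prob_space \<nu>" "sets \<nu> = sets borel" "AE x in \<nu>. x \<in> {0..} \<times> {0..}"
    and eq: "\<And>a b. 0 \<le> a \<Longrightarrow> 0 \<le> b \<Longrightarrow>
       (LINT x|\<mu>. exp (- a * fst x - b * snd x)) = (LINT x|\<nu>. exp (- a * fst x - b * snd x))"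
  shows "\<mu> = \<nu>"
proof -
  define T :: "real \<times> real \<Rightarrow> real \<times> real" where "T x = (exp (- fst x), exp (- snd x))" for x
  define S :: "real \<times> real \<Rightarrow> real \<times> real" where "S x = (- ln (fst x), - ln (snd x))" for x
  have meas[measurable_cong]: "sets \<mu> = sets borel" "sets \<nu> = sets borel" by fact+
  have [measurable]: "T \<in> borel \<rightarrow>\<^sub>M borel" "S \<in> borel \<rightarrow>\<^sub>M borel"
    unfolding T_def S_def borel_prod[symmetric] by measurable
  have ST: "S (T x) = x" for x by (simp add: S_def T_def)
  have "distr \<mu> borel T = distr \<nu> borel T"
  proof (rule moments_determine_measure_unit_square)
    show "prob_space (distr \<mu> borel T)" "prob_space (distr \<nu> borel T)"
      using \<mu>(1) \<nu>(1) by (auto intro!: prob_space.prob_space_distr)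
    show "AE x in distr \<mu> borel T. x \<in> {0..1} \<times> {0..1}"
      using \<mu>(3) by (subst AE_distr_iff) (auto simp: T_def borel_closed closed_Times elim!: eventually_mono)
    show "AE x in distr \<nu> borel T. x \<in> {0..1} \<times> {0..1}"
      using \<nu>(3) by (subst AE_distr_iff) (auto simp: T_def borel_closed closed_Times elim!: eventually_mono)
    fix m n :: nat
    have T_pow: "fst (T x) ^ m * snd (T x) ^ n = exp (- real m * fst x - real n * snd x)" for x
      by (simp add: T_def exp_of_nat_mult[symmetric] exp_add[symmetric])
    show "(LINT x|distr \<mu> borel T. fst x ^ m * snd x ^ n) = (LINT x|distr \<nu> borel T. fst x ^ m * snd x ^ n)"
      using eq[of "real m" "real n"] by (simp add: integral_distr T_pow)
  qed auto
  then have "distr (distr \<mu> borel T) borel S = distr (distr \<nu> borel T) borel S" by simp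
  moreover have "distr (distr \<kappa> borel T) borel S = \<kappa>" if [measurable_cong]: "sets \<kappa> = sets borel" for \<kappa>
    by (subst distr_distr) (auto simp: o_def ST that intro!: distr_id2)
  ultimately show ?thesis using meas by simp
qed



section \<open>The running maximum of Brownian motion\<close>

text \<open>Any dyadic point of level \<open>n\<close> is reached from \<open>0\<close> by at most one dyadic step of each level up to \<open>n\<close>; with steps
that decay geometrically the total displacement is bounded by the geometric series.\<close>

lemma dyadic_chaining:
  fixes w :: "real \<Rightarrow> real"
  assumes w0: "w 0 = 0" and q: "0 \<le> q"
    and step: "\<And>n k. k < 2 ^ n \<Longrightarrow> \<bar>w (real (Suc k) * t / 2 ^ n) - w (real k * t / 2 ^ n)\<bar> \<le> q * (10/11) ^ n"
    and m: "m \<le> 2 ^ n"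
  shows "\<bar>w (real m * t / 2 ^ n)\<bar> \<le> 11 * q"
proof -
  have "\<bar>w (real m * t / 2 ^ n)\<bar> \<le> q * (\<Sum>j\<le>n. (10/11) ^ j)" using m
  proof (induction n arbitrary: m)
    case 0
    then have "m = 0 \<or> m = 1" by auto
    then show ?case using w0 q step[of 0 0] by auto
  next
    case (Suc n)
    have half: "real (2 * l) * t / 2 ^ Suc n = real l * t / 2 ^ n" for l by simp
    have mono: "q * (\<Sum>j\<le>n. (10/11) ^ j) \<le> q * (\<Sum>j\<le>Suc n. (10/11) ^ j)"
      using q by (intro mult_left_mono sum_mono2) auto
    show ?case
    proof (cases "even m")
      case True
      then obtain l where l: "m = 2 * l" by auto
      then show ?thesis using Suc.IH[of l] Suc.prems mono unfolding l half by simp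
    next
      case False
      then obtain l where l: "m = Suc (2 * l)" by (auto elim: oddE)
      then have le: "l \<le> 2 ^ n" "2 * l < 2 ^ Suc n" using Suc.prems by auto
      have "\<bar>w (real l * t / 2 ^ n)\<bar> \<le> q * (\<Sum>j\<le>n. (10/11) ^ j)" using Suc.IH[OF le(1)] .
      moreover have "\<bar>w (real m * t / 2 ^ Suc n) - w (real l * t / 2 ^ n)\<bar> \<le> q * (10/11) ^ Suc n"
        using step[OF le(2)] unfolding half l .
      ultimately show ?thesis unfolding sum.atMost_Suc distrib_left by linarith
    qed
  qed
  also have "\<dots> \<le> q * 11"
  proof (intro mult_left_mono q)
    have "(\<Sum>j\<le>n. (10/11::real) ^ j) \<le> (\<Sum>j. (10/11) ^ j)"
      by (intro sum_le_suminf summable_geometric) auto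
    also have "\<dots> = 11" by (simp add: suminf_geometric)
    finally show "(\<Sum>j\<le>n. (10/11::real) ^ j) \<le> 11" .
  qed
  finally show ?thesis by simp
qed

locale brownian = prob_space M for M :: "'a measure" +
  fixes W :: "real \<Rightarrow> 'a \<Rightarrow> real"
  assumes BM: "standard_brownian_motion M W"
begin

lemma W_measurable: "0 \<le> t \<Longrightarrow> W t \<in> borel_measurable M"
  using BM by (simp add: standard_brownian_motion_def)

lemma W_0: "\<omega> \<in> space M \<Longrightarrow> W 0 \<omega> = 0"
  using BM by (simp add: standard_brownian_motion_def)

lemma W_continuous: "\<omega> \<in> space M \<Longrightarrow> continuous_on {0..} (\<lambda>t. W t \<omega>)"
  using BM by (simp add: standard_brownian_motion_def)

lemma W_increment_distributed: "0 \<le> s \<Longrightarrow> s < t \<Longrightarrow>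
    distributed M lborel (\<lambda>\<omega>. W t \<omega> - W s \<omega>) (normal_density 0 (sqrt (t - s)))"
  using BM by (simp add: standard_brownian_motion_def)

lemma has_integral_increment:
  assumes st: "0 \<le> s" "s < t" and g: "has_bochner_integral lborel (\<lambda>x. normal_density 0 (sqrt (t - s)) x * g x) c"
    and [measurable]: "g \<in> borel_measurable borel"
  shows "has_bochner_integral M (\<lambda>\<omega>. g (W t \<omega> - W s \<omega>)) c"
proof -
  note D = W_increment_distributed[OF st]
  have "integrable M (\<lambda>\<omega>. g (W t \<omega> - W s \<omega>))"
    using g by (subst distributed_integrable[OF D, symmetric]) (auto simp: has_bochner_integral_iff)
  moreover have "(\<integral>\<omega>. g (W t \<omega> - W s \<omega>) \<partial>M) = c"
    using g by (subst distributed_integral[OF D, symmetric]) (auto simp: has_bochner_integral_iff)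
  ultimately show ?thesis by (simp add: has_bochner_integral_iff)
qed

lemma increment_fourth_moment:
  assumes "0 \<le> s" "s < t"
  shows "has_bochner_integral M (\<lambda>\<omega>. (W t \<omega> - W s \<omega>) ^ 4) (3 * (t - s)\<^sup>2)"
proof (rule has_integral_increment[OF assms])
  have "sqrt (t - s) > 0" using assms by simp
  from normal_moment_even[OF this, of 0 2]
  show "has_bochner_integral lborel (\<lambda>x. normal_density 0 (sqrt (t - s)) x * x ^ 4) (3 * (t - s)\<^sup>2)"
    using assms by (simp add: fact_numeral power_divide)
qed simp

lemma W_moments:
  assumes "0 < t"
  shows "has_bochner_integral M (\<lambda>\<omega>. W t \<omega>) 0"
    and "has_bochner_integral M (\<lambda>\<omega>. (W t \<omega>)\<^sup>2) t"
    and "has_bochner_integral M (\<lambda>\<omega>. \<bar>W t \<omega>\<bar>) (sqrt t * sqrt (2 / pi))"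
proof -
  have s: "sqrt t > 0" using assms by simp
  have "has_bochner_integral M (\<lambda>\<omega>. W t \<omega> - W 0 \<omega>) 0"
    using has_integral_increment[of 0 t "\<lambda>x. x"] normal_moment_odd[OF s, of 0 0] assms by simp
  then show "has_bochner_integral M (\<lambda>\<omega>. W t \<omega>) 0"
    by (subst has_bochner_integral_cong[OF refl _ refl]) (auto simp: W_0)
  have "has_bochner_integral M (\<lambda>\<omega>. (W t \<omega> - W 0 \<omega>)\<^sup>2) t"
    using has_integral_increment[of 0 t "\<lambda>x. x\<^sup>2"] normal_moment_even[OF s, of 0 1] assms by simp
  then show "has_bochner_integral M (\<lambda>\<omega>. (W t \<omega>)\<^sup>2) t"
    by (subst has_bochner_integral_cong[OF refl _ refl]) (auto simp: W_0)
  have "has_bochner_integral M (\<lambda>\<omega>. \<bar>W t \<omega> - W 0 \<omega>\<bar>) (sqrt t * sqrt (2 / pi))"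
    using has_integral_increment[of 0 t "\<lambda>x. \<bar>x\<bar>"] normal_moment_abs_odd[OF s, of 0 0] assms by simp
  then show "has_bochner_integral M (\<lambda>\<omega>. \<bar>W t \<omega>\<bar>) (sqrt t * sqrt (2 / pi))"
    by (subst has_bochner_integral_cong[OF refl _ refl]) (auto simp: W_0)
qed

text \<open>Only the fourth moments of single increments are used. The random variable \<open>Q\<close> is a weighted sum of the fourth
powers of all dyadic increments. Its weight \<open>u\<^sup>n\<close> with \<open>u = (11/10)\<^sup>4\<close> grows fast enough for
\<open>dyadic_chaining\<close> with \<open>q\<^sup>4 = Q\<close>, and since \<open>u < 2\<close> the expectation \<open>\<Sum>n. u\<^sup>n * 2\<^sup>n * 3 * (t / 2\<^sup>n)\<^sup>2\<close> is finite.\<close>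

lemma running_maximum:
  assumes t: "0 < t"
  obtains R where "R \<in> borel_measurable M"
    and "\<And>\<omega> s. \<omega> \<in> space M \<Longrightarrow> 0 \<le> s \<Longrightarrow> s \<le> t \<Longrightarrow> \<bar>W s \<omega>\<bar> \<le> R \<omega>"
    and "integrable M (\<lambda>\<omega>. R \<omega> ^ 4)" and "(\<integral>\<omega>. R \<omega> ^ 4 \<partial>M) \<le> 200000 * t\<^sup>2"
proof
  define I where "I = {(n, k). k \<le> (2::nat) ^ n}"
  define dy where "dy p = real (snd p) * t / 2 ^ fst p" for p :: "nat \<times> nat"
  define R where "R \<omega> = (SUP p\<in>I. \<bar>W (dy p) \<omega>\<bar>)" for \<omega>
  have I_ne: "(0, 0) \<in> I" by (simp add: I_def)
  have dy: "0 \<le> dy p \<and> dy p \<le> t" if "p \<in> I" for p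
  proof -
    have "real (snd p) \<le> 2 ^ fst p" using that by (auto simp: I_def)
    then have "real (snd p) * t \<le> 2 ^ fst p * t" using t by (intro mult_right_mono) auto
    then show ?thesis using t by (auto simp: dy_def divide_le_eq mult.commute)
  qed
  have bdd: "bdd_above ((\<lambda>p. \<bar>W (dy p) \<omega>\<bar>) ` I)" if "\<omega> \<in> space M" for \<omega>
  proof -
    have "continuous_on {0..t} (\<lambda>s. \<bar>W s \<omega>\<bar>)"
      by (intro continuous_intros continuous_on_subset[OF W_continuous[OF that]]) auto
    then have "compact ((\<lambda>s. \<bar>W s \<omega>\<bar>) ` {0..t})" by (rule compact_continuous_image) auto
    then have "bdd_above ((\<lambda>s. \<bar>W s \<omega>\<bar>) ` {0..t})" by (intro bounded_imp_bdd_above compact_imp_bounded)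
    then show ?thesis by (rule bdd_above_mono) (use dy in auto)
  qed
  show R_meas[measurable]: "R \<in> borel_measurable M"
    unfolding R_def
    by (rule borel_measurable_cSUP) (use dy bdd in \<open>auto intro!: borel_measurable_abs W_measurable\<close>)
  have R_dy: "\<bar>W (dy p) \<omega>\<bar> \<le> R \<omega>" if "\<omega> \<in> space M" "p \<in> I" for p \<omega>
    unfolding R_def by (rule cSUP_upper[OF that(2) bdd[OF that(1)]])
  show "\<bar>W s \<omega>\<bar> \<le> R \<omega>" if \<omega>: "\<omega> \<in> space M" and s: "0 \<le> s" "s \<le> t" for \<omega> s
  proof -
    define k where "k n = nat \<lfloor>2 ^ n * (s / t)\<rfloor>" for n :: nat
    have st: "0 \<le> s / t" "s / t \<le> 1" using s t by auto
    have k: "real (k n) \<le> 2 ^ n * (s / t)" "2 ^ n * (s / t) < real (k n) + 1" for n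
    proof -
      have "0 \<le> 2 ^ n * (s / t)" by (intro mult_nonneg_nonneg st(1)) simp
      then have "real (k n) = of_int \<lfloor>2 ^ n * (s / t)\<rfloor>" by (simp add: k_def)
      then show "real (k n) \<le> 2 ^ n * (s / t)" "2 ^ n * (s / t) < real (k n) + 1" by linarith+
    qed
    have kI: "(n, k n) \<in> I" for n
    proof -
      have "2 ^ n * (s / t) \<le> 2 ^ n * 1" using st by (intro mult_left_mono) auto
      then have "real (k n) \<le> 2 ^ n" using k(1)[of n] by linarith
      then have "k n \<le> 2 ^ n" using of_nat_le_iff[of "k n" "2 ^ n", where 'a = real] by simp
      then show ?thesis by (simp add: I_def)
    qed
    have "(\<lambda>n. dy (n, k n)) \<longlonglongrightarrow> s"
    proof (rule tendsto_sandwich)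
      show "eventually (\<lambda>n. dy (n, k n) \<le> s) sequentially"
        using k(1) t by (intro always_eventually) (auto simp: dy_def field_simps)
      show "eventually (\<lambda>n. s - t / 2 ^ n \<le> dy (n, k n)) sequentially"
      proof (intro always_eventually allI)
        fix n
        have "2 ^ n * s < (real (k n) + 1) * t" using k(2)[of n] t by (simp add: field_simps)
        then have "(2 ^ n * s) / 2 ^ n \<le> ((real (k n) + 1) * t) / 2 ^ n" by (intro divide_right_mono) auto
        then show "s - t / 2 ^ n \<le> dy (n, k n)"
          by (simp add: dy_def distrib_right add_divide_distrib)
      qed
      have "(\<lambda>n. s - t * (1/2) ^ n) \<longlonglongrightarrow> s - t * 0"
        by (intro tendsto_intros LIMSEQ_realpow_zero) auto
      then show "(\<lambda>n. s - t / 2 ^ n) \<longlonglongrightarrow> s" by (simp add: power_one_over)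
    qed simp
    then have "(\<lambda>n. W (dy (n, k n)) \<omega>) \<longlonglongrightarrow> W s \<omega>"
      by (rule continuous_on_tendsto_compose[OF W_continuous[OF \<omega>]]) (use s dy[OF kI] in auto)
    then have "(\<lambda>n. \<bar>W (dy (n, k n)) \<omega>\<bar>) \<longlonglongrightarrow> \<bar>W s \<omega>\<bar>" by (rule tendsto_rabs)
    then show ?thesis by (rule LIMSEQ_le_const2) (use R_dy[OF \<omega> kI] in auto)
  qed
  define u :: real where "u = 14641 / 10000"
  define D where "D n k \<omega> = W (real (Suc k) * t / 2 ^ n) \<omega> - W (real k * t / 2 ^ n) \<omega>" for n k :: nat and \<omega>
  define Q where "Q \<omega> = (\<Sum>n. \<Sum>k<2 ^ n. ennreal (u ^ n * D n k \<omega> ^ 4))" for \<omega>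
  have D_meas[measurable]: "D n k \<in> borel_measurable M" for n k
    unfolding D_def using t by (auto intro!: borel_measurable_diff W_measurable)
  have D4: "(\<integral>\<^sup>+\<omega>. ennreal (u ^ n * D n k \<omega> ^ 4) \<partial>M) = ennreal (u ^ n * (3 * t\<^sup>2 / 4 ^ n))" for n k
  proof -
    have lt: "real k * t / 2 ^ n < real (Suc k) * t / 2 ^ n" using t by (auto intro!: divide_strict_right_mono)
    have "(real (Suc k) * t / 2 ^ n - real k * t / 2 ^ n)\<^sup>2 = t\<^sup>2 / 4 ^ n"
      by (simp add: diff_divide_distrib[symmetric] left_diff_distrib[symmetric] power_divide power2_eq_square power_mult_distrib[symmetric])
    then have h: "has_bochner_integral M (\<lambda>\<omega>. u ^ n * D n k \<omega> ^ 4) (u ^ n * (3 * t\<^sup>2 / 4 ^ n))"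
      using increment_fourth_moment[OF _ lt] t unfolding D_def
      by (intro has_bochner_integral_mult_right) auto
    show ?thesis
      using h by (subst nn_integral_eq_integral) (auto simp: has_bochner_integral_iff u_def)
  qed
  have "(\<integral>\<^sup>+\<omega>. Q \<omega> \<partial>M) = (\<Sum>n. \<Sum>k<(2::nat) ^ n. ennreal (u ^ n * (3 * t\<^sup>2 / 4 ^ n)))"
    unfolding Q_def by (simp add: nn_integral_suminf nn_integral_sum D4)
  also have "\<dots> = (\<Sum>n. ennreal (3 * t\<^sup>2 * (u / 2) ^ n))"
  proof (intro arg_cong[where f = suminf] ext)
    fix n :: nat
    have "(\<Sum>k<(2::nat) ^ n. ennreal (u ^ n * (3 * t\<^sup>2 / 4 ^ n))) = ennreal (2 ^ n * (u ^ n * (3 * t\<^sup>2 / 4 ^ n)))"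
      by (simp add: ennreal_mult'[symmetric] ennreal_of_nat_eq_real_of_nat)
    also have "2 ^ n * (u ^ n * (3 * t\<^sup>2 / 4 ^ n)) = 3 * t\<^sup>2 * (2 * u / 4) ^ n"
      by (simp only: power_divide power_mult_distrib) simp
    finally show "(\<Sum>k<(2::nat) ^ n. ennreal (u ^ n * (3 * t\<^sup>2 / 4 ^ n))) = ennreal (3 * t\<^sup>2 * (u / 2) ^ n)"
      by simp
  qed
  also have "\<dots> = ennreal (\<Sum>n. 3 * t\<^sup>2 * (u / 2) ^ n)"
    by (intro suminf_ennreal2 summable_mult summable_geometric) (auto simp: u_def)
  also have "(\<Sum>n. 3 * t\<^sup>2 * (u / 2) ^ n) = 3 * t\<^sup>2 * (1 / (1 - u / 2))"
    by (subst suminf_mult, rule summable_geometric) (auto simp: u_def suminf_geometric)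
  finally have intQ: "(\<integral>\<^sup>+\<omega>. Q \<omega> \<partial>M) = ennreal (3 * t\<^sup>2 * (1 / (1 - u / 2)))" .
  have R_Q: "ennreal (R \<omega> ^ 4) \<le> 14641 * Q \<omega>" if \<omega>: "\<omega> \<in> space M" for \<omega>
  proof (cases "Q \<omega> = top")
    case False
    define q where "q = root 4 (enn2real (Q \<omega>))"
    have q: "0 \<le> q" "q ^ 4 = enn2real (Q \<omega>)" by (auto simp: q_def)
    have "\<bar>D n k \<omega>\<bar> \<le> q * (10/11) ^ n" if k: "k < 2 ^ n" for n k
    proof -
      have "ennreal (u ^ n * D n k \<omega> ^ 4) \<le> (\<Sum>k<2 ^ n. ennreal (u ^ n * D n k \<omega> ^ 4))"
        using k by (intro member_le_sum) auto
      also have "\<dots> = sum (\<lambda>n. \<Sum>k<2 ^ n. ennreal (u ^ n * D n k \<omega> ^ 4)) {n}" by simp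
      also have "\<dots> \<le> Q \<omega>" unfolding Q_def by (intro sum_le_suminf) auto
      finally have "u ^ n * D n k \<omega> ^ 4 \<le> q ^ 4"
        using enn2real_mono[of "ennreal (u ^ n * D n k \<omega> ^ 4)" "Q \<omega>"] False
        by (simp add: q(2) u_def less_top)
      then have "D n k \<omega> ^ 4 \<le> q ^ 4 * (10000/14641) ^ n"
        by (simp add: u_def power_divide field_simps)
      also have "\<dots> = (q * (10/11) ^ n) ^ 4"
      proof -
        have e: "(10/11::real) ^ 4 = 10000/14641" by (simp add: power_divide)
        have "((10/11::real) ^ n) ^ 4 = ((10/11) ^ 4) ^ n" by (simp only: power_mult[symmetric] mult.commute)
        then show ?thesis unfolding power_mult_distrib e by simp
      qed
      finally have "\<bar>D n k \<omega>\<bar> ^ 4 \<le> (q * (10/11) ^ n) ^ 4" by simp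
      then show ?thesis using q(1) by (subst (asm) power_mono_iff) auto
    qed
    then have "\<bar>W (real m * t / 2 ^ n) \<omega>\<bar> \<le> 11 * q" if "m \<le> 2 ^ n" for m n
      using dyadic_chaining[of "\<lambda>s. W s \<omega>" q t m n] W_0[OF \<omega>] q(1) that by (simp add: D_def)
    then have "R \<omega> \<le> 11 * q"
      unfolding R_def using I_ne by (intro cSUP_least) (auto simp: I_def dy_def)
    moreover have "0 \<le> R \<omega>" using R_dy[OF \<omega> I_ne] by linarith
    ultimately have "R \<omega> ^ 4 \<le> (11 * q) ^ 4" by (intro power_mono) auto
    then have "R \<omega> ^ 4 \<le> 14641 * enn2real (Q \<omega>)" by (simp add: power_mult_distrib q(2))
    then have "ennreal (R \<omega> ^ 4) \<le> ennreal (14641 * enn2real (Q \<omega>))" by (rule ennreal_leI)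
    also have "\<dots> = 14641 * Q \<omega>" using False by (simp add: ennreal_mult' ennreal_enn2real_if)
    finally show ?thesis .
  qed (simp add: ennreal_mult_top)
  have [measurable]: "Q \<in> borel_measurable M" unfolding Q_def by measurable
  have "(\<integral>\<^sup>+\<omega>. ennreal (R \<omega> ^ 4) \<partial>M) \<le> (\<integral>\<^sup>+\<omega>. 14641 * Q \<omega> \<partial>M)"
    by (rule nn_integral_mono) (rule R_Q)
  also have "\<dots> = 14641 * ennreal (3 * t\<^sup>2 * (1 / (1 - u / 2)))"
    by (simp add: nn_integral_cmult intQ)
  also have "\<dots> = ennreal (14641 * (3 * t\<^sup>2 * (1 / (1 - u / 2))))"
    by (subst ennreal_mult) (auto simp: u_def)
  also have "\<dots> \<le> ennreal (200000 * t\<^sup>2)" by (intro ennreal_leI) (simp add: u_def)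
  finally have le: "(\<integral>\<^sup>+\<omega>. ennreal (R \<omega> ^ 4) \<partial>M) \<le> ennreal (200000 * t\<^sup>2)" .
  show int: "integrable M (\<lambda>\<omega>. R \<omega> ^ 4)"
    using le by (intro integrableI_nonneg) (auto simp: less_top[symmetric] top_unique)
  have "ennreal (\<integral>\<omega>. R \<omega> ^ 4 \<partial>M) \<le> ennreal (200000 * t\<^sup>2)"
    using le by (subst nn_integral_eq_integral[symmetric]) (auto simp: int)
  then show "(\<integral>\<omega>. R \<omega> ^ 4 \<partial>M) \<le> 200000 * t\<^sup>2" by (subst (asm) ennreal_le_iff) auto
qed

end



section \<open>Reflected paths\<close>

text \<open>The pathwise form of the equations for the regulators, for driving paths \<open>u\<close> and \<open>v\<close> that include the negative
starting points.\<close>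

definition reflected :: "(real \<Rightarrow> real) \<Rightarrow> (real \<Rightarrow> real) \<Rightarrow> (real \<Rightarrow> real) \<Rightarrow> (real \<Rightarrow> real) \<Rightarrow> bool" where
  "reflected u v A C \<longleftrightarrow>
     A 0 = 0 \<and> continuous_on {0..} A \<and> mono_on {0..} A \<and>
     C 0 = 0 \<and> continuous_on {0..} C \<and> mono_on {0..} C \<and>
     (\<forall>t\<ge>0. A t = (SUP s\<in>{0..t}. max 0 (u s + C s / 2)) \<and>
            C t = (SUP s\<in>{0..t}. max 0 (v s + A s / 2)))"

lemma reflected_swap: "reflected u v A C \<Longrightarrow> reflected v u C A"
  unfolding reflected_def by blast

lemma reflectedD:
  assumes "reflected u v A C"
  shows "A 0 = 0" "continuous_on {0..} A" "0 \<le> s \<Longrightarrow> s \<le> t \<Longrightarrow> A s \<le> A t"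
    "0 \<le> t \<Longrightarrow> A t = (SUP s\<in>{0..t}. max 0 (u s + C s / 2))"
    and "C 0 = 0" "continuous_on {0..} C" "0 \<le> s \<Longrightarrow> s \<le> t \<Longrightarrow> C s \<le> C t"
proof -
  from assms have "mono_on {0..} A" "mono_on {0..} C" unfolding reflected_def by blast+
  then show "0 \<le> s \<Longrightarrow> s \<le> t \<Longrightarrow> A s \<le> A t" "0 \<le> s \<Longrightarrow> s \<le> t \<Longrightarrow> C s \<le> C t"
    by (auto simp: mono_on_def)
qed (use assms in \<open>unfold reflected_def, blast+\<close>)

lemma running_max_bounded:
  fixes f :: "real \<Rightarrow> real"
  assumes "continuous_on {0..} f" "0 \<le> t"
  shows "bdd_above ((\<lambda>s. max 0 (f s)) ` {0..t})"
proof -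
  have "continuous_on {0..t} (\<lambda>s. max 0 (f s))"
    by (intro continuous_intros continuous_on_subset[OF assms(1)]) auto
  then have "compact ((\<lambda>s. max 0 (f s)) ` {0..t})" by (rule compact_continuous_image) auto
  then show ?thesis by (intro bounded_imp_bdd_above compact_imp_bounded)
qed

lemma reflected_ge:
  assumes "reflected u v A C" "continuous_on {0..} u" "0 \<le> s" "s \<le> t"
  shows "u s + C s / 2 \<le> A t" "0 \<le> A t"
proof -
  have "continuous_on {0..} (\<lambda>s. u s + C s / 2)"
    by (intro continuous_intros assms reflectedD(6)[OF assms(1)]) simp
  then have "bdd_above ((\<lambda>s. max 0 (u s + C s / 2)) ` {0..t})"
    using assms(3,4) by (intro running_max_bounded) auto
  then have "max 0 (u s + C s / 2) \<le> (SUP s\<in>{0..t}. max 0 (u s + C s / 2))"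
    using assms(3,4) by (intro cSUP_upper) auto
  also have "\<dots> = A t" using reflectedD(4)[OF assms(1), of t] assms(3,4) by simp
  finally show "u s + C s / 2 \<le> A t" "0 \<le> A t" by auto
qed

lemma reflected_le:
  assumes "reflected u v A C" "0 \<le> t" "\<And>s. 0 \<le> s \<Longrightarrow> s \<le> t \<Longrightarrow> u s \<le> m"
  shows "A t \<le> max 0 (m + C t / 2)"
proof -
  have "A t = (SUP s\<in>{0..t}. max 0 (u s + C s / 2))" by (rule reflectedD(4)[OF assms(1,2)])
  also have "\<dots> \<le> max 0 (m + C t / 2)"
  proof (rule cSUP_least)
    fix s assume s: "s \<in> {0..t}"
    then have "C s \<le> C t" using reflectedD(7)[OF assms(1), of s t] by simp
    then show "max 0 (u s + C s / 2) \<le> max 0 (m + C t / 2)" using assms(3)[of s] s by auto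
  qed (use assms(2) in auto)
  finally show ?thesis .
qed

text \<open>The cross terms carry the factor \<open>1/2\<close>, so the two inequalities \<open>A \<le> m + C / 2\<close> and \<open>C \<le> m + A / 2\<close> close up.
The last two claims say that a gap must start near the boundary in order to be pushed.\<close>

lemma reflected_bound:
  assumes r: "reflected u v A C" and c: "continuous_on {0..} u" "continuous_on {0..} v" and t: "0 \<le> t"
    and u: "\<And>s. 0 \<le> s \<Longrightarrow> s \<le> t \<Longrightarrow> u s \<le> m - g"
    and v: "\<And>s. 0 \<le> s \<Longrightarrow> s \<le> t \<Longrightarrow> v s \<le> m - h"
    and gh: "0 \<le> g" "0 \<le> h" and m: "0 \<le> m"
  shows "A t \<le> 2 * m" "C t \<le> 2 * m" "A t > 0 \<Longrightarrow> g < 2 * m" "C t > 0 \<Longrightarrow> h < 2 * m"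
proof -
  have A: "A t \<le> max 0 (m - g + C t / 2)" by (rule reflected_le[OF r t u])
  have C: "C t \<le> max 0 (m - h + A t / 2)" by (rule reflected_le[OF reflected_swap[OF r] t v])
  have A0: "0 \<le> A t" using reflected_ge(2)[OF r c(1), of t t] t by simp
  have C0: "0 \<le> C t" using reflected_ge(2)[OF reflected_swap[OF r] c(2), of t t] t by simp
  have A': "A t \<le> m + C t / 2" and C': "C t \<le> m + A t / 2" using A C A0 C0 gh m by linarith+
  then show A2: "A t \<le> 2 * m" and C2: "C t \<le> 2 * m" by linarith+
  show "g < 2 * m" if "A t > 0" using A C2 that by linarith
  show "h < 2 * m" if "C t > 0" using C A2 that by linarith
qed

text \<open>A discretisation in which each regulator uses the other one at the previous grid point. Being a primitive
recursion on finitely many values of the driving paths, it is measurable in them and its law is determined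
by the increments.\<close>

primrec reflection_scheme :: "(nat \<Rightarrow> real) \<Rightarrow> (nat \<Rightarrow> real) \<Rightarrow> nat \<Rightarrow> real \<times> real" where
  "reflection_scheme u v 0 = (0, 0)"
| "reflection_scheme u v (Suc j) = (max (fst (reflection_scheme u v j)) (u (Suc j) + snd (reflection_scheme u v j) / 2),
                       max (snd (reflection_scheme u v j)) (v (Suc j) + fst (reflection_scheme u v j) / 2))"

lemma reflection_scheme_swap: "reflection_scheme v u j = prod.swap (reflection_scheme u v j)"
  by (induction j) auto

lemma reflection_scheme_cong: "(\<And>i. i \<le> j \<Longrightarrow> u i = u' i) \<Longrightarrow> (\<And>i. i \<le> j \<Longrightarrow> v i = v' i) \<Longrightarrow> reflection_scheme u v j = reflection_scheme u' v' j"
  by (induction j) auto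

lemma reflection_scheme_bound:
  assumes "\<And>i. i \<le> j \<Longrightarrow> u i \<le> m" "\<And>i. i \<le> j \<Longrightarrow> v i \<le> m" "0 \<le> m"
  shows "0 \<le> fst (reflection_scheme u v j) \<and> fst (reflection_scheme u v j) \<le> 2 * m \<and> 0 \<le> snd (reflection_scheme u v j) \<and> snd (reflection_scheme u v j) \<le> 2 * m"
  using assms
proof (induction j)
  case (Suc j)
  then have IH: "0 \<le> fst (reflection_scheme u v j) \<and> fst (reflection_scheme u v j) \<le> 2 * m \<and> 0 \<le> snd (reflection_scheme u v j) \<and> snd (reflection_scheme u v j) \<le> 2 * m"
    by simp
  have "u (Suc j) \<le> m" "v (Suc j) \<le> m" using Suc.prems by auto
  then show ?case using IH by (simp add: le_max_iff_disj)
qed simp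

text \<open>One step of the scheme does not enlarge an error of size \<open>2 * e\<close>: half of the incoming error plus the oscillation
\<open>e\<close> over the step is again at most \<open>2 * e\<close>. This is why the errors do not accumulate along the grid.\<close>

lemma reflected_step:
  assumes r: "reflected u v A C" and u: "continuous_on {0..} u" and ab: "0 \<le> a" "a \<le> b"
    and close: "\<And>s. a \<le> s \<Longrightarrow> s \<le> b \<Longrightarrow> \<bar>u s - u b\<bar> \<le> e / 2 \<and> \<bar>C s - C a\<bar> \<le> e"
    and e: "\<bar>A a - A'\<bar> \<le> 2 * e" "\<bar>C a - C'\<bar> \<le> 2 * e" "0 \<le> A'"
  shows "\<bar>A b - max A' (u b + C' / 2)\<bar> \<le> 2 * e"
proof -
  have Ab: "A b = (SUP s\<in>{0..b}. max 0 (u s + C s / 2))" using reflectedD(4)[OF r, of b] ab by simp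
  have "A b \<le> max (A a) (u b + C a / 2 + e)"
    unfolding Ab
  proof (rule cSUP_least)
    fix s assume s: "s \<in> {0..b}"
    show "max 0 (u s + C s / 2) \<le> max (A a) (u b + C a / 2 + e)"
    proof (cases "s \<le> a")
      case True then show ?thesis using reflected_ge[OF r u, of s a] s by (simp add: le_max_iff_disj)
    next
      case False
      then have "\<bar>u s - u b\<bar> \<le> e / 2 \<and> \<bar>C s - C a\<bar> \<le> e" using s by (intro close) auto
      then have "u s \<le> u b + e / 2" "C s \<le> C a + e" by linarith+
      then show ?thesis using reflected_ge(2)[OF r u, of a a] ab by linarith
    qed
  qed (use ab in auto)
  moreover have "A a \<le> A b" using reflectedD(3)[OF r ab] .
  moreover have "u b + C a / 2 \<le> A b"
  proof -
    have "C a \<le> C b" using reflectedD(7)[OF r ab] .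
    then show ?thesis using reflected_ge(1)[OF r u, of b b] ab by linarith
  qed
  ultimately show ?thesis using e by linarith
qed

lemma reflection_scheme_converges:
  assumes r: "reflected u v A C" and c: "continuous_on {0..} u" "continuous_on {0..} v" and t: "0 \<le> t"
  shows "(\<lambda>N. reflection_scheme (\<lambda>j. u (real j * t / real N)) (\<lambda>j. v (real j * t / real N)) N) \<longlonglongrightarrow> (A t, C t)"
proof -
  let ?s = "\<lambda>N. reflection_scheme (\<lambda>j. u (real j * t / real N)) (\<lambda>j. v (real j * t / real N))"
  have AC: "continuous_on {0..} A" "continuous_on {0..} C" using reflectedD(2,6)[OF r] .
  have main: "eventually (\<lambda>N. \<bar>A t - fst (?s N N)\<bar> \<le> 2 * e \<and> \<bar>C t - snd (?s N N)\<bar> \<le> 2 * e) sequentially"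
    if e: "e > 0" for e
  proof -
    define P where "P d f e \<longleftrightarrow> (\<forall>x\<in>{0..t}. \<forall>y\<in>{0..t}. \<bar>x - y\<bar> < d \<longrightarrow> \<bar>f x - f y\<bar> \<le> e)"
      for d e :: real and f :: "real \<Rightarrow> real"
    have uc: "\<exists>d>0. P d f e'" if f: "continuous_on {0..} f" and e': "e' > 0" for f e'
    proof -
      have "uniformly_continuous_on {0..t} f"
        by (rule compact_uniformly_continuous) (auto intro: continuous_on_subset[OF f])
      then obtain d where "d > 0" "\<forall>x\<in>{0..t}. \<forall>x'\<in>{0..t}. dist x' x < d \<longrightarrow> dist (f x') (f x) < e'"
        using e' unfolding uniformly_continuous_on_def by meson
      then show ?thesis by (intro exI[of _ d]) (auto simp: P_def dist_real_def intro: less_imp_le)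
    qed
    obtain d1 d2 d3 d4 where d: "d1 > 0" "P d1 u (e/2)" "d2 > 0" "P d2 v (e/2)" "d3 > 0" "P d3 A e" "d4 > 0" "P d4 C e"
      using uc[OF c(1), of "e/2"] uc[OF c(2), of "e/2"] uc[OF AC(1) e] uc[OF AC(2) e] e by auto
    define D where "D = Min {d1, d2, d3, d4}"
    have D: "D > 0" "P D u (e/2)" "P D v (e/2)" "P D A e" "P D C e"
      using d by (auto simp: D_def P_def)
    obtain N0 where N0: "t / D < real N0" using reals_Archimedean2 by blast
    have "\<bar>A t - fst (?s N N)\<bar> \<le> 2 * e \<and> \<bar>C t - snd (?s N N)\<bar> \<le> 2 * e" if N: "N \<ge> Suc N0" for N
    proof -
      have Npos: "real N > 0" using N by simp
      have "t / D < real N" using N N0 by simp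
      then have mesh: "t / real N < D" using D Npos by (simp add: field_simps)
      have "0 \<le> fst (?s N j) \<and> 0 \<le> snd (?s N j) \<and>
        \<bar>A (real j * t / real N) - fst (?s N j)\<bar> \<le> 2 * e \<and> \<bar>C (real j * t / real N) - snd (?s N j)\<bar> \<le> 2 * e"
        if "j \<le> N" for j
        using that
      proof (induction j)
        case 0 then show ?case using reflectedD(1,5)[OF r] e by simp
      next
        case (Suc j)
        let ?a = "real j * t / real N" and ?b = "real (Suc j) * t / real N"
        have IH: "0 \<le> fst (?s N j)" "0 \<le> snd (?s N j)" "\<bar>A ?a - fst (?s N j)\<bar> \<le> 2 * e" "\<bar>C ?a - snd (?s N j)\<bar> \<le> 2 * e"
          using Suc by auto
        have ab: "0 \<le> ?a" "?a \<le> ?b" using t by (auto simp: divide_right_mono mult_right_mono)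
        have ba: "?b - ?a < D" using mesh by (simp add: diff_divide_distrib[symmetric] algebra_simps)
        have "real (Suc j) * t \<le> real N * t" using Suc.prems t by (intro mult_right_mono) auto
        then have bt: "?b \<le> t" using Npos by (simp add: divide_le_eq mult.commute)
        have "\<bar>A ?b - max (fst (?s N j)) (u ?b + snd (?s N j) / 2)\<bar> \<le> 2 * e"
        proof (rule reflected_step[OF r c(1) ab _ IH(3,4,1)])
          fix s assume s: "?a \<le> s" "s \<le> ?b"
          then have "\<bar>s - ?b\<bar> < D" "\<bar>s - ?a\<bar> < D" "s \<in> {0..t}" "?a \<in> {0..t}" "?b \<in> {0..t}" using ba ab bt by auto
          then show "\<bar>u s - u ?b\<bar> \<le> e / 2 \<and> \<bar>C s - C ?a\<bar> \<le> e"
            using D(2,5) unfolding P_def by blast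
        qed
        moreover have "\<bar>C ?b - max (snd (?s N j)) (v ?b + fst (?s N j) / 2)\<bar> \<le> 2 * e"
        proof (rule reflected_step[OF reflected_swap[OF r] c(2) ab _ IH(4,3,2)])
          fix s assume s: "?a \<le> s" "s \<le> ?b"
          then have "\<bar>s - ?b\<bar> < D" "\<bar>s - ?a\<bar> < D" "s \<in> {0..t}" "?a \<in> {0..t}" "?b \<in> {0..t}" using ba ab bt by auto
          then show "\<bar>v s - v ?b\<bar> \<le> e / 2 \<and> \<bar>A s - A ?a\<bar> \<le> e"
            using D(3,4) unfolding P_def by blast
        qed
        ultimately show ?case using IH by auto
      qed
      from this[of N] show ?thesis using Npos by simp
    qed
    then show ?thesis by (rule eventually_sequentiallyI)
  qed
  have "(\<lambda>N. fst (?s N N)) \<longlonglongrightarrow> A t"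
  proof (rule tendstoI)
    fix e :: real assume "e > 0"
    then have "\<bar>A t - fst (?s N N)\<bar> \<le> 2 * (e / 3) \<Longrightarrow> dist (fst (?s N N)) (A t) < e" for N
      unfolding dist_real_def by linarith
    with main[of "e/3"] \<open>e > 0\<close> show "eventually (\<lambda>N. dist (fst (?s N N)) (A t) < e) sequentially"
      by (auto elim!: eventually_mono simp del: reflection_scheme.simps)
  qed
  moreover have "(\<lambda>N. snd (?s N N)) \<longlonglongrightarrow> C t"
  proof (rule tendstoI)
    fix e :: real assume "e > 0"
    then have "\<bar>C t - snd (?s N N)\<bar> \<le> 2 * (e / 3) \<Longrightarrow> dist (snd (?s N N)) (C t) < e" for N
      unfolding dist_real_def by linarith
    with main[of "e/3"] \<open>e > 0\<close> show "eventually (\<lambda>N. dist (snd (?s N N)) (C t) < e) sequentially"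
      by (auto elim!: eventually_mono simp del: reflection_scheme.simps)
  qed
  ultimately have "(\<lambda>N. (fst (?s N N), snd (?s N N))) \<longlonglongrightarrow> (A t, C t)" by (rule tendsto_Pair)
  then show ?thesis by simp
qed



section \<open>The gap process as a function of starting point and noise\<close>

lemma (in pair_prob_space) expectation_product:
  fixes f :: "'a \<Rightarrow> real" and k :: "'b \<Rightarrow> real"
  assumes f: "integrable M1 f" and k: "integrable M2 k"
  shows "integrable (M1 \<Otimes>\<^sub>M M2) (\<lambda>p. f (fst p) * k (snd p))"
    and "(\<integral>p. f (fst p) * k (snd p) \<partial>(M1 \<Otimes>\<^sub>M M2)) = (\<integral>x. f x \<partial>M1) * (\<integral>y. k y \<partial>M2)"
proof -
  have [measurable]: "f \<in> borel_measurable M1" "k \<in> borel_measurable M2" using f k by auto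
  show int: "integrable (M1 \<Otimes>\<^sub>M M2) (\<lambda>p. f (fst p) * k (snd p))"
    by (rule Fubini_integrable) (use f k in \<open>auto simp: abs_mult\<close>)
  show "(\<integral>p. f (fst p) * k (snd p) \<partial>(M1 \<Otimes>\<^sub>M M2)) = (\<integral>x. f x \<partial>M1) * (\<integral>y. k y \<partial>M2)"
    using integral_fst'[OF int] by simp
qed

text \<open>The regulators are given for starting states in the quadrant only; precomposition with this retraction makes
them defined, and measurable, on the whole plane.\<close>

definition clamp :: "real \<times> real \<Rightarrow> real \<times> real" where
  "clamp x = (max 0 (fst x), max 0 (snd x))"

lemma clamp_id: "x \<in> {0..} \<times> {0..} \<Longrightarrow> clamp x = x"
  by (auto simp: clamp_def)

locale reflected_gaps = brownian M W for M :: "'a measure" and W +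
  fixes d :: real and A \<Gamma> :: "real \<times> real \<Rightarrow> real \<Rightarrow> 'a \<Rightarrow> real"
  assumes d_pos: "0 < d"
    and reflected: "0 \<le> g \<Longrightarrow> 0 \<le> h \<Longrightarrow> \<omega> \<in> space M \<Longrightarrow>
      reflected (\<lambda>s. - g + d * s + W s \<omega>) (\<lambda>s. - h + d * s - W s \<omega>)
        (\<lambda>s. A (g, h) s \<omega>) (\<lambda>s. \<Gamma> (g, h) s \<omega>)"
begin

definition gaps :: "real \<Rightarrow> real \<times> real \<Rightarrow> 'a \<Rightarrow> real \<times> real" where
  "gaps t x \<omega> = (fst x - d * t - W t \<omega> - \<Gamma> x t \<omega> / 2 + A x t \<omega>,
                 snd x - d * t + W t \<omega> - A x t \<omega> / 2 + \<Gamma> x t \<omega>)"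

lemma driving_continuous:
  assumes "\<omega> \<in> space M"
  shows "continuous_on {0..} (\<lambda>s. - g + d * s + W s \<omega>)" "continuous_on {0..} (\<lambda>s. - h + d * s - W s \<omega>)"
  by (intro continuous_intros W_continuous[OF assms])+

lemma regulators_ge:
  assumes "0 \<le> g" "0 \<le> h" "\<omega> \<in> space M" "0 \<le> t"
  shows "0 \<le> A (g, h) t \<omega>" "0 \<le> \<Gamma> (g, h) t \<omega>"
    and "- g + d * t + W t \<omega> + \<Gamma> (g, h) t \<omega> / 2 \<le> A (g, h) t \<omega>"
    and "- h + d * t - W t \<omega> + A (g, h) t \<omega> / 2 \<le> \<Gamma> (g, h) t \<omega>"
  using reflected_ge[OF reflected[OF assms(1-3)] driving_continuous(1)[OF assms(3)] assms(4) order_refl]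
    reflected_ge[OF reflected_swap[OF reflected[OF assms(1-3)]] driving_continuous(2)[OF assms(3)] assms(4) order_refl]
  by simp_all

lemma gaps_nonneg:
  assumes "0 \<le> g" "0 \<le> h" "\<omega> \<in> space M" "0 \<le> t"
  shows "gaps t (g, h) \<omega> \<in> {0..} \<times> {0..}"
  using regulators_ge[OF assms] by (simp add: gaps_def)

lemma regulators_le:
  assumes gh: "0 \<le> g" "0 \<le> h" and \<omega>: "\<omega> \<in> space M" and t: "0 \<le> t"
    and m: "\<And>s. 0 \<le> s \<Longrightarrow> s \<le> t \<Longrightarrow> \<bar>W s \<omega>\<bar> + d * s \<le> m"
  shows "A (g, h) t \<omega> \<le> 2 * m" "\<Gamma> (g, h) t \<omega> \<le> 2 * m"
    and "A (g, h) t \<omega> > 0 \<Longrightarrow> g < 2 * m" "\<Gamma> (g, h) t \<omega> > 0 \<Longrightarrow> h < 2 * m"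
proof -
  have b: "- g + d * s + W s \<omega> \<le> m - g" "- h + d * s - W s \<omega> \<le> m - h" if "0 \<le> s" "s \<le> t" for s
    using m[OF that] by linarith+
  have "0 \<le> m" using m[of t] t d_pos mult_nonneg_nonneg[of d t] by linarith
  note B = reflected_bound[OF reflected[OF gh \<omega>] driving_continuous[OF \<omega>] t b gh this]
  show "A (g, h) t \<omega> \<le> 2 * m" "\<Gamma> (g, h) t \<omega> \<le> 2 * m"
    "A (g, h) t \<omega> > 0 \<Longrightarrow> g < 2 * m" "\<Gamma> (g, h) t \<omega> > 0 \<Longrightarrow> h < 2 * m"
    using B by simp_all
qed

definition fourth_moment_const :: real where
  "fourth_moment_const = 8 * (200000 + d ^ 4)"

text \<open>The variable \<open>U\<close> dominates noise and drift together. Time is written as \<open>r\<^sup>2\<close> because all the bounds are in powers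
of the square root of the elapsed time.\<close>

lemma running_bound:
  assumes r: "0 < r" "r \<le> 1"
  obtains U where "U \<in> borel_measurable M"
    and "\<And>\<omega> s. \<omega> \<in> space M \<Longrightarrow> 0 \<le> s \<Longrightarrow> s \<le> r\<^sup>2 \<Longrightarrow> \<bar>W s \<omega>\<bar> + d * s \<le> U \<omega>"
    and "integrable M (\<lambda>\<omega>. U \<omega> ^ 4)" and "(\<integral>\<omega>. U \<omega> ^ 4 \<partial>M) \<le> fourth_moment_const * r ^ 4"
proof -
  obtain R where [measurable]: "R \<in> borel_measurable M"
    and R: "\<And>\<omega> s. \<omega> \<in> space M \<Longrightarrow> 0 \<le> s \<Longrightarrow> s \<le> r\<^sup>2 \<Longrightarrow> \<bar>W s \<omega>\<bar> \<le> R \<omega>"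
    and R4: "integrable M (\<lambda>\<omega>. R \<omega> ^ 4)" "(\<integral>\<omega>. R \<omega> ^ 4 \<partial>M) \<le> 200000 * (r\<^sup>2)\<^sup>2"
    using running_maximum[of "r\<^sup>2"] r by auto
  have pow4: "(a + b) ^ 4 \<le> 8 * a ^ 4 + 8 * b ^ 4" for a b :: real
  proof -
    have le: "(a + b)\<^sup>2 \<le> 2 * a\<^sup>2 + 2 * b\<^sup>2" using sum_squares_bound[of a b] by (simp add: power2_sum)
    have "(a + b) ^ 4 = ((a + b)\<^sup>2)\<^sup>2" by simp
    also have "\<dots> \<le> (2 * a\<^sup>2 + 2 * b\<^sup>2)\<^sup>2" by (rule power_mono[OF le]) simp
    also have "\<dots> \<le> 8 * (a\<^sup>2)\<^sup>2 + 8 * (b\<^sup>2)\<^sup>2"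
      using sum_squares_bound[of "a\<^sup>2" "b\<^sup>2"] by (simp add: power2_sum power_mult_distrib)
    finally show ?thesis by simp
  qed
  have le: "(R \<omega> + d * r\<^sup>2) ^ 4 \<le> 8 * R \<omega> ^ 4 + 8 * (d * r\<^sup>2) ^ 4" for \<omega> by (rule pow4)
  have int: "integrable M (\<lambda>\<omega>. (R \<omega> + d * r\<^sup>2) ^ 4)"
    by (rule Bochner_Integration.integrable_bound[where f = "\<lambda>\<omega>. 8 * R \<omega> ^ 4 + 8 * (d * r\<^sup>2) ^ 4"])
       (use R4 le in auto)
  have "(\<integral>\<omega>. (R \<omega> + d * r\<^sup>2) ^ 4 \<partial>M) \<le> (\<integral>\<omega>. 8 * R \<omega> ^ 4 + 8 * (d * r\<^sup>2) ^ 4 \<partial>M)"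
    by (rule integral_mono[OF int _ le]) (use R4 in auto)
  also have "\<dots> = 8 * (\<integral>\<omega>. R \<omega> ^ 4 \<partial>M) + 8 * (d * r\<^sup>2) ^ 4"
    using R4 by (simp add: prob_space)
  also have "\<dots> \<le> 8 * (200000 * r ^ 4) + 8 * (d ^ 4 * r ^ 4)"
  proof -
    have "(r\<^sup>2) ^ 4 \<le> r ^ 4"
      unfolding power_mult[symmetric] by (rule power_decreasing) (use r in auto)
    then have "(d * r\<^sup>2) ^ 4 \<le> d ^ 4 * r ^ 4"
      unfolding power_mult_distrib by (intro mult_left_mono) auto
    then show ?thesis using R4(2) by simp
  qed
  also have "\<dots> = fourth_moment_const * r ^ 4" by (simp add: fourth_moment_const_def algebra_simps)
  finally have "(\<integral>\<omega>. (R \<omega> + d * r\<^sup>2) ^ 4 \<partial>M) \<le> fourth_moment_const * r ^ 4" .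
  moreover have "\<bar>W s \<omega>\<bar> + d * s \<le> R \<omega> + d * r\<^sup>2" if "\<omega> \<in> space M" "0 \<le> s" "s \<le> r\<^sup>2" for \<omega> s
    using R[OF that] d_pos that by (intro add_mono mult_left_mono) auto
  ultimately show thesis using int by (intro that[of "\<lambda>\<omega>. R \<omega> + d * r\<^sup>2"]) auto
qed

definition grid_u :: "real \<Rightarrow> real \<Rightarrow> nat \<Rightarrow> 'a \<Rightarrow> nat \<Rightarrow> real" where
  "grid_u g t N \<omega> j = - g + d * (real j * t / real N) + W (real j * t / real N) \<omega>"

definition grid_v :: "real \<Rightarrow> real \<Rightarrow> nat \<Rightarrow> 'a \<Rightarrow> nat \<Rightarrow> real" where
  "grid_v h t N \<omega> j = - h + d * (real j * t / real N) - W (real j * t / real N) \<omega>"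

lemma grid_scheme_converges:
  assumes "0 \<le> g" "0 \<le> h" "\<omega> \<in> space M" "0 \<le> t"
  shows "(\<lambda>N. reflection_scheme (grid_u g t N \<omega>) (grid_v h t N \<omega>) N) \<longlonglongrightarrow> (A (g, h) t \<omega>, \<Gamma> (g, h) t \<omega>)"
  using reflection_scheme_converges[OF reflected[OF assms(1-3)] driving_continuous[OF assms(3)] assms(4)]
  unfolding grid_u_def grid_v_def .

text \<open>Adaptedness gives measurability in \<open>\<omega>\<close> for each fixed starting state only; joint measurability comes from the
scheme, whose values are jointly measurable for each mesh.\<close>

lemma regulators_jointly_measurable:
  assumes t: "0 \<le> t"
  shows "(\<lambda>p. A (clamp (fst p)) t (snd p)) \<in> borel_measurable (borel \<Otimes>\<^sub>M M)"
    and "(\<lambda>p. \<Gamma> (clamp (fst p)) t (snd p)) \<in> borel_measurable (borel \<Otimes>\<^sub>M M)"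
proof -
  let ?s = "\<lambda>N p. reflection_scheme (grid_u (fst (clamp (fst p))) t N (snd p)) (grid_v (snd (clamp (fst p))) t N (snd p))"
  have [measurable]: "W (real j * t / real N) \<in> borel_measurable M" for j N
    using t by (intro W_measurable) auto
  have [measurable]: "(\<lambda>p. grid_u (fst (clamp (fst p))) t N (snd p) i) \<in> borel_measurable (borel \<Otimes>\<^sub>M M)"
    "(\<lambda>p. grid_v (snd (clamp (fst p))) t N (snd p) i) \<in> borel_measurable (borel \<Otimes>\<^sub>M M)" for N i
    unfolding grid_u_def grid_v_def clamp_def fst_conv snd_conv by measurable
  have m: "(\<lambda>p. fst (?s N p j)) \<in> borel_measurable (borel \<Otimes>\<^sub>M M) \<and>
      (\<lambda>p. snd (?s N p j)) \<in> borel_measurable (borel \<Otimes>\<^sub>M M)" for N j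
  proof (induction j)
    case (Suc j)
    then have [measurable]: "(\<lambda>p. fst (?s N p j)) \<in> borel_measurable (borel \<Otimes>\<^sub>M M)"
      "(\<lambda>p. snd (?s N p j)) \<in> borel_measurable (borel \<Otimes>\<^sub>M M)" by auto
    show ?case unfolding reflection_scheme.simps fst_conv snd_conv by (intro conjI) measurable
  qed simp
  have lim: "(\<lambda>N. ?s N p N) \<longlonglongrightarrow> (A (clamp (fst p)) t (snd p), \<Gamma> (clamp (fst p)) t (snd p))"
    if "p \<in> space (borel \<Otimes>\<^sub>M M)" for p
    using grid_scheme_converges[of "fst (clamp (fst p))" "snd (clamp (fst p))" "snd p" t] that t
    by (auto simp: space_pair_measure clamp_def)
  show "(\<lambda>p. A (clamp (fst p)) t (snd p)) \<in> borel_measurable (borel \<Otimes>\<^sub>M M)"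
    by (rule borel_measurable_LIMSEQ_real[where u = "\<lambda>N p. fst (?s N p N)"])
       (use m tendsto_fst[OF lim] in auto)
  show "(\<lambda>p. \<Gamma> (clamp (fst p)) t (snd p)) \<in> borel_measurable (borel \<Otimes>\<^sub>M M)"
    by (rule borel_measurable_LIMSEQ_real[where u = "\<lambda>N p. snd (?s N p N)"])
       (use m tendsto_snd[OF lim] in auto)
qed

lemma regulators_measurable:
  assumes "0 \<le> g" "0 \<le> h" "0 \<le> t"
  shows "A (g, h) t \<in> borel_measurable M" "\<Gamma> (g, h) t \<in> borel_measurable M"
proof -
  have "(\<lambda>\<omega>. ((g, h), \<omega>)) \<in> M \<rightarrow>\<^sub>M borel \<Otimes>\<^sub>M M" by simp
  from measurable_compose[OF this regulators_jointly_measurable(1)[OF assms(3)]]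
    measurable_compose[OF this regulators_jointly_measurable(2)[OF assms(3)]]
  show "A (g, h) t \<in> borel_measurable M" "\<Gamma> (g, h) t \<in> borel_measurable M"
    using assms by (simp_all add: clamp_def max_def)
qed

lemma gaps_measurable:
  assumes t: "0 \<le> t"
  shows "(\<lambda>p. gaps t (clamp (fst p)) (snd p)) \<in> borel \<Otimes>\<^sub>M M \<rightarrow>\<^sub>M borel"
proof -
  note [measurable] = regulators_jointly_measurable[OF t] W_measurable[OF t]
  have [measurable]: "(\<lambda>p. fst (clamp (fst p))) \<in> borel_measurable (borel \<Otimes>\<^sub>M M)"
    "(\<lambda>p. snd (clamp (fst p))) \<in> borel_measurable (borel \<Otimes>\<^sub>M M)"
    unfolding clamp_def fst_conv snd_conv by measurable
  show ?thesis
    unfolding gaps_def by (intro borel_measurable_Pair) measurable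
qed

lemma gaps_section_measurable: "0 \<le> t \<Longrightarrow> gaps t (clamp x) \<in> M \<rightarrow>\<^sub>M borel"
  using measurable_compose[OF measurable_Pair1' gaps_measurable, of x t] by simp

text \<open>The increments over a grid are independent centred Gaussians, so their joint law is a product of symmetric laws.\<close>

lemma increments_symmetric:
  assumes t: "0 < t" and N: "0 < N"
    and F[measurable]: "F \<in> borel_measurable (PiM {..<N} (\<lambda>_. borel))"
  defines "D \<equiv> \<lambda>i \<omega>. W (real (Suc i) * t / real N) \<omega> - W (real i * t / real N) \<omega>"
  shows "(\<integral>\<omega>. F (\<lambda>i\<in>{..<N}. D i \<omega>) \<partial>M) = (\<integral>\<omega>. F (\<lambda>i\<in>{..<N}. - D i \<omega>) \<partial>M :: real)"
proof -
  have D_meas[measurable]: "D i \<in> borel_measurable M" for i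
    unfolding D_def using t by (auto intro!: borel_measurable_diff W_measurable)
  have lt: "real i * t / real N < real (Suc i) * t / real N" for i
    using t N by (auto intro!: divide_strict_right_mono)
  have indep: "indep_vars (\<lambda>_. borel) D {..<N}"
    using BM t lt unfolding standard_brownian_motion_def D_def
    by (auto dest!: spec[of _ N] spec[of _ "\<lambda>i. real i * t / real N"])
  have indep': "indep_vars (\<lambda>_. borel) (\<lambda>i \<omega>. - D i \<omega>) {..<N}"
    by (rule indep_vars_compose2[OF indep]) auto
  have marg: "distr M borel (\<lambda>\<omega>. - D i \<omega>) = distr M borel (D i)" for i
  proof -
    let ?s = "sqrt (real (Suc i) * t / real N - real i * t / real N)"
    have dist: "distributed M lborel (D i) (normal_density 0 ?s)"
      unfolding D_def using t by (intro W_increment_distributed lt) auto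
    have s: "0 < ?s" using lt by simp
    have "distributed M lborel (\<lambda>\<omega>. 0 + D i \<omega> * - 1) (normal_density (0 + 0 * - 1) (\<bar>- 1\<bar> * ?s))"
      using normal_density_affine[OF dist s, of "-1" 0] by (simp add: mult.commute)
    then have dist': "distributed M lborel (\<lambda>\<omega>. - D i \<omega>) (normal_density 0 ?s)" by simp
    have "distr M lborel (\<lambda>\<omega>. - D i \<omega>) = distr M lborel (D i)"
      using distributed_distr_eq_density[OF dist] distributed_distr_eq_density[OF dist'] by simp
    moreover have "distr M borel Y = distr M lborel Y" for Y :: "'a \<Rightarrow> real" by (rule distr_cong) auto
    ultimately show ?thesis by simp
  qed
  have ne: "{..<N} \<noteq> {}" using N by auto
  have "distr M (PiM {..<N} (\<lambda>_. borel)) (\<lambda>\<omega>. \<lambda>i\<in>{..<N}. D i \<omega>) = PiM {..<N} (\<lambda>i. distr M borel (D i))"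
    using indep by (subst (asm) indep_vars_iff_distr_eq_PiM'[OF ne]) auto
  also have "\<dots> = PiM {..<N} (\<lambda>i. distr M borel (\<lambda>\<omega>. - D i \<omega>))" by (simp add: marg)
  also have "\<dots> = distr M (PiM {..<N} (\<lambda>_. borel)) (\<lambda>\<omega>. \<lambda>i\<in>{..<N}. - D i \<omega>)"
    using indep' by (subst (asm) indep_vars_iff_distr_eq_PiM'[OF ne]) auto
  finally have eq: "distr M (PiM {..<N} (\<lambda>_. borel)) (\<lambda>\<omega>. \<lambda>i\<in>{..<N}. D i \<omega>) =
    distr M (PiM {..<N} (\<lambda>_. borel)) (\<lambda>\<omega>. \<lambda>i\<in>{..<N}. - D i \<omega>)" .
  have "(\<integral>\<omega>. F (\<lambda>i\<in>{..<N}. D i \<omega>) \<partial>M) = integral\<^sup>L (distr M (PiM {..<N} (\<lambda>_. borel)) (\<lambda>\<omega>. \<lambda>i\<in>{..<N}. D i \<omega>)) F"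
    by (subst integral_distr) auto
  also have "\<dots> = (\<integral>\<omega>. F (\<lambda>i\<in>{..<N}. - D i \<omega>) \<partial>M)"
    unfolding eq by (subst integral_distr) auto
  finally show ?thesis .
qed


text \<open>For the scheme this is \<open>increments_symmetric\<close> together with \<open>reflection_scheme_swap\<close>: changing the sign of \<open>W\<close>
exchanges the roles of the two driving paths, because both have the same drift. The growth condition on
\<open>\<phi>\<close> allows both bounded test functions and the regulators themselves, the latter being dominated by a multiple of
the running maximum.\<close>

lemma reflection_symmetry:
  assumes gh: "0 \<le> g" "0 \<le> h" and t: "0 < t" and \<phi>: "continuous_on UNIV \<phi>"
    and K: "\<And>w a c. \<bar>\<phi> (w, a, c)\<bar> \<le> K * (1 + \<bar>a\<bar> + \<bar>c\<bar>)"
  shows "(\<integral>\<omega>. \<phi> (W t \<omega>, A (g, h) t \<omega>, \<Gamma> (g, h) t \<omega>) \<partial>M) =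
         (\<integral>\<omega>. \<phi> (- W t \<omega>, \<Gamma> (h, g) t \<omega>, A (h, g) t \<omega>) \<partial>M :: real)"
proof -
  have \<phi>_meas[measurable]: "\<phi> \<in> borel_measurable borel" using \<phi> by (rule borel_measurable_continuous_onI)
  have W_grid[measurable]: "W (real j * t / real N) \<in> borel_measurable M" for j N
    using t by (intro W_measurable) auto
  have Wt[measurable]: "W t \<in> borel_measurable M" using t by (intro W_measurable) auto
  have K0: "0 \<le> K" using K[of 0 0 0] by simp
  obtain R where [measurable]: "R \<in> borel_measurable M"
    and R: "\<And>\<omega> s. \<omega> \<in> space M \<Longrightarrow> 0 \<le> s \<Longrightarrow> s \<le> t \<Longrightarrow> \<bar>W s \<omega>\<bar> \<le> R \<omega>"
    and R4: "integrable M (\<lambda>\<omega>. R \<omega> ^ 4)"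
    using running_maximum[OF t] by metis
  have R1: "integrable M R"
    by (rule Bochner_Integration.integrable_bound[where f = "\<lambda>\<omega>. 1 + R \<omega> ^ 4"]) (use R4 abs_le_one_plus_fourth_power in auto)
  define U where "U \<omega> = R \<omega> + d * t" for \<omega>
  have U_int: "integrable M (\<lambda>\<omega>. K * (1 + 2 * U \<omega> + 2 * U \<omega>))" unfolding U_def using R1 by auto
  have U: "\<bar>W s \<omega>\<bar> + d * s \<le> U \<omega>" if "\<omega> \<in> space M" "0 \<le> s" "s \<le> t" for \<omega> s
    unfolding U_def using R[OF that] d_pos that by (intro add_mono mult_left_mono) auto
  have U0: "0 \<le> U \<omega>" if "\<omega> \<in> space M" for \<omega> using U[OF that, of 0] t by simp
  have grid_in: "0 \<le> real j * t / real N \<and> real j * t / real N \<le> t" if "j \<le> N" "0 < N" for j N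
  proof -
    have "real j * t \<le> real N * t" using that t by (intro mult_right_mono) auto
    then show ?thesis using t that by (auto simp: divide_le_eq mult.commute)
  qed
  define s where "s g h N \<omega> = reflection_scheme (grid_u g t N \<omega>) (grid_v h t N \<omega>) N" for g h N \<omega>
  have s_bound: "0 \<le> fst (s g h N \<omega>) \<and> fst (s g h N \<omega>) \<le> 2 * U \<omega> \<and>
      0 \<le> snd (s g h N \<omega>) \<and> snd (s g h N \<omega>) \<le> 2 * U \<omega>"
    if \<omega>: "\<omega> \<in> space M" and gh: "0 \<le> g" "0 \<le> h" and N: "0 < N" for g h N \<omega>
    unfolding s_def
  proof (rule reflection_scheme_bound)
    fix i assume "i \<le> N"
    note i = U[OF \<omega>, of "real i * t / real N"] grid_in[OF this N]
    show "grid_u g t N \<omega> i \<le> U \<omega>" "grid_v h t N \<omega> i \<le> U \<omega>"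
      using i gh unfolding grid_u_def grid_v_def by linarith+
  qed (rule U0[OF \<omega>])
  have s_meas: "(\<lambda>\<omega>. fst (reflection_scheme (grid_u g t N \<omega>) (grid_v h t N \<omega>) j)) \<in> borel_measurable M \<and>
      (\<lambda>\<omega>. snd (reflection_scheme (grid_u g t N \<omega>) (grid_v h t N \<omega>) j)) \<in> borel_measurable M" for g h N j
  proof (induction j)
    case (Suc j)
    then have [measurable]: "(\<lambda>\<omega>. fst (reflection_scheme (grid_u g t N \<omega>) (grid_v h t N \<omega>) j)) \<in> borel_measurable M"
      "(\<lambda>\<omega>. snd (reflection_scheme (grid_u g t N \<omega>) (grid_v h t N \<omega>) j)) \<in> borel_measurable M" by auto
    have [measurable]: "(\<lambda>\<omega>. grid_u g t N \<omega> i) \<in> borel_measurable M"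
      "(\<lambda>\<omega>. grid_v h t N \<omega> i) \<in> borel_measurable M" for i
      unfolding grid_u_def grid_v_def by measurable
    show ?case unfolding reflection_scheme.simps fst_conv snd_conv by (intro conjI) measurable
  qed simp
  have [measurable]: "(\<lambda>\<omega>. fst (s g h N \<omega>)) \<in> borel_measurable M"
    "(\<lambda>\<omega>. snd (s g h N \<omega>)) \<in> borel_measurable M" for g h N
    unfolding s_def using s_meas by auto
  have s_lim: "(\<lambda>N. s g h (Suc N) \<omega>) \<longlonglongrightarrow> (A (g, h) t \<omega>, \<Gamma> (g, h) t \<omega>)"
    if "\<omega> \<in> space M" "0 \<le> g" "0 \<le> h" for \<omega> g h
    unfolding s_def using LIMSEQ_Suc[OF grid_scheme_converges[OF that(2,3,1)]] t by simp
  have \<phi>_lim: "(\<lambda>n. \<phi> (x, a n, c n)) \<longlonglongrightarrow> \<phi> (x, a', c')" if "a \<longlonglongrightarrow> a'" "c \<longlonglongrightarrow> c'" for x a c a' c'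
    by (rule continuous_on_tendsto_compose[OF \<phi>]) (use that in \<open>auto intro!: tendsto_intros\<close>)
  note [measurable] = regulators_measurable[OF gh less_imp_le[OF t]] regulators_measurable[OF gh(2,1) less_imp_le[OF t]]
  have lim1: "(\<lambda>N. \<integral>\<omega>. \<phi> (W t \<omega>, fst (s g h (Suc N) \<omega>), snd (s g h (Suc N) \<omega>)) \<partial>M)
     \<longlonglongrightarrow> (\<integral>\<omega>. \<phi> (W t \<omega>, A (g, h) t \<omega>, \<Gamma> (g, h) t \<omega>) \<partial>M)"
  proof (rule integral_dominated_convergence[OF _ _ U_int])
    show "AE \<omega> in M. (\<lambda>N. \<phi> (W t \<omega>, fst (s g h (Suc N) \<omega>), snd (s g h (Suc N) \<omega>)))
        \<longlonglongrightarrow> \<phi> (W t \<omega>, A (g, h) t \<omega>, \<Gamma> (g, h) t \<omega>)"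
      using tendsto_fst[OF s_lim[OF _ gh]] tendsto_snd[OF s_lim[OF _ gh]] by (intro AE_I2 \<phi>_lim) auto
    show "AE \<omega> in M. norm (\<phi> (W t \<omega>, fst (s g h (Suc N) \<omega>), snd (s g h (Suc N) \<omega>))) \<le> K * (1 + 2 * U \<omega> + 2 * U \<omega>)" for N
    proof (rule AE_I2)
      fix \<omega> assume "\<omega> \<in> space M"
      then have "K * (1 + \<bar>fst (s g h (Suc N) \<omega>)\<bar> + \<bar>snd (s g h (Suc N) \<omega>)\<bar>) \<le> K * (1 + 2 * U \<omega> + 2 * U \<omega>)"
        using s_bound[OF _ gh, of _ "Suc N"] K0 by (intro mult_left_mono add_mono) auto
      with K show "norm (\<phi> (W t \<omega>, fst (s g h (Suc N) \<omega>), snd (s g h (Suc N) \<omega>))) \<le> K * (1 + 2 * U \<omega> + 2 * U \<omega>)"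
        unfolding real_norm_def by (rule order.trans)
    qed
  qed ((intro measurable_compose[OF _ \<phi>_meas] borel_measurable_Pair; measurable)+)
  have lim2: "(\<lambda>N. \<integral>\<omega>. \<phi> (- W t \<omega>, snd (s h g (Suc N) \<omega>), fst (s h g (Suc N) \<omega>)) \<partial>M)
     \<longlonglongrightarrow> (\<integral>\<omega>. \<phi> (- W t \<omega>, \<Gamma> (h, g) t \<omega>, A (h, g) t \<omega>) \<partial>M)"
  proof (rule integral_dominated_convergence[OF _ _ U_int])
    show "AE \<omega> in M. (\<lambda>N. \<phi> (- W t \<omega>, snd (s h g (Suc N) \<omega>), fst (s h g (Suc N) \<omega>)))
        \<longlonglongrightarrow> \<phi> (- W t \<omega>, \<Gamma> (h, g) t \<omega>, A (h, g) t \<omega>)"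
      using tendsto_fst[OF s_lim[OF _ gh(2,1)]] tendsto_snd[OF s_lim[OF _ gh(2,1)]] by (intro AE_I2 \<phi>_lim) auto
    show "AE \<omega> in M. norm (\<phi> (- W t \<omega>, snd (s h g (Suc N) \<omega>), fst (s h g (Suc N) \<omega>))) \<le> K * (1 + 2 * U \<omega> + 2 * U \<omega>)" for N
    proof (rule AE_I2)
      fix \<omega> assume "\<omega> \<in> space M"
      then have "K * (1 + \<bar>snd (s h g (Suc N) \<omega>)\<bar> + \<bar>fst (s h g (Suc N) \<omega>)\<bar>) \<le> K * (1 + 2 * U \<omega> + 2 * U \<omega>)"
        using s_bound[OF _ gh(2,1), of _ "Suc N"] K0 by (intro mult_left_mono add_mono) auto
      with K show "norm (\<phi> (- W t \<omega>, snd (s h g (Suc N) \<omega>), fst (s h g (Suc N) \<omega>))) \<le> K * (1 + 2 * U \<omega> + 2 * U \<omega>)"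
        unfolding real_norm_def by (rule order.trans)
    qed
  qed ((intro measurable_compose[OF _ \<phi>_meas] borel_measurable_Pair; measurable)+)
  have step: "(\<integral>\<omega>. \<phi> (W t \<omega>, fst (s g h N \<omega>), snd (s g h N \<omega>)) \<partial>M) =
      (\<integral>\<omega>. \<phi> (- W t \<omega>, snd (s h g N \<omega>), fst (s h g N \<omega>)) \<partial>M)" if N: "0 < N" for N
  proof -
    define D where "D i \<omega> = W (real (Suc i) * t / real N) \<omega> - W (real i * t / real N) \<omega>" for i \<omega>
    define E where "E x = reflection_scheme (\<lambda>j. - g + d * (real j * t / real N) + (\<Sum>i<j. x i))
        (\<lambda>j. - h + d * (real j * t / real N) - (\<Sum>i<j. x i))" for x :: "nat \<Rightarrow> real"
    define F where "F x = \<phi> (\<Sum>i<N. x i, fst (E x N), snd (E x N))" for x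
    have sum_meas[measurable]: "(\<lambda>x. \<Sum>i<j. x i) \<in> borel_measurable (PiM {..<N} (\<lambda>_. borel :: real measure))"
      if "j \<le> N" for j
      using that by (intro borel_measurable_sum measurable_component_singleton) auto
    have E_meas: "j \<le> N \<Longrightarrow> (\<lambda>x. fst (E x j)) \<in> borel_measurable (PiM {..<N} (\<lambda>_. borel)) \<and>
        (\<lambda>x. snd (E x j)) \<in> borel_measurable (PiM {..<N} (\<lambda>_. borel))" for j
    proof (induction j)
      case (Suc j)
      then have [measurable]: "(\<lambda>x. fst (E x j)) \<in> borel_measurable (PiM {..<N} (\<lambda>_. borel))"
        "(\<lambda>x. snd (E x j)) \<in> borel_measurable (PiM {..<N} (\<lambda>_. borel))" by auto
      note [measurable] = sum_meas[OF Suc.prems]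
      show ?case unfolding E_def reflection_scheme.simps fst_conv snd_conv unfolding E_def[symmetric]
        by (intro conjI borel_measurable_max borel_measurable_add borel_measurable_diff borel_measurable_divide)
          (auto simp del: sum.lessThan_Suc)
    qed (simp add: E_def)
    have F_meas: "F \<in> borel_measurable (PiM {..<N} (\<lambda>_. borel))"
      unfolding F_def using E_meas[of N] sum_meas[of N]
      by (intro measurable_compose[OF _ \<phi>_meas] borel_measurable_Pair) auto
    have tel: "(\<Sum>i<j. (\<lambda>i\<in>{..<N}. D i \<omega>) i) = W (real j * t / real N) \<omega>" if "j \<le> N" "\<omega> \<in> space M" for j \<omega>
    proof -
      have "(\<Sum>i<j. (\<lambda>i\<in>{..<N}. D i \<omega>) i) = (\<Sum>i<j. D i \<omega>)" using that by (intro sum.cong) auto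
      also have "\<dots> = W (real j * t / real N) \<omega> - W (real 0 * t / real N) \<omega>"
        unfolding D_def by (rule sum_lessThan_telescope)
      finally show ?thesis using W_0[OF that(2)] by simp
    qed
    have tel': "(\<Sum>i<j. (\<lambda>i\<in>{..<N}. - D i \<omega>) i) = - W (real j * t / real N) \<omega>" if "j \<le> N" "\<omega> \<in> space M" for j \<omega>
    proof -
      have "(\<Sum>i<j. (\<lambda>i\<in>{..<N}. - D i \<omega>) i) = (\<Sum>i<j. - (\<lambda>i\<in>{..<N}. D i \<omega>) i)" using that by (intro sum.cong) auto
      then show ?thesis using tel[OF that] by (simp add: sum_negf)
    qed
    have 1: "F (\<lambda>i\<in>{..<N}. D i \<omega>) = \<phi> (W t \<omega>, fst (s g h N \<omega>), snd (s g h N \<omega>))" if \<omega>: "\<omega> \<in> space M" for \<omega>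
    proof -
      have "E (\<lambda>i\<in>{..<N}. D i \<omega>) N = s g h N \<omega>"
        unfolding E_def s_def by (rule reflection_scheme_cong) (simp_all only: tel[OF _ \<omega>] grid_u_def grid_v_def)
      then show ?thesis unfolding F_def using tel[OF order_refl \<omega>] N by simp
    qed
    have 2: "F (\<lambda>i\<in>{..<N}. - D i \<omega>) = \<phi> (- W t \<omega>, snd (s h g N \<omega>), fst (s h g N \<omega>))" if \<omega>: "\<omega> \<in> space M" for \<omega>
    proof -
      have "E (\<lambda>i\<in>{..<N}. - D i \<omega>) N = reflection_scheme (grid_v g t N \<omega>) (grid_u h t N \<omega>) N"
        unfolding E_def by (rule reflection_scheme_cong) (simp_all add: tel'[OF _ \<omega>] grid_u_def grid_v_def del: restrict_apply)
      then show ?thesis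
        unfolding F_def s_def reflection_scheme_swap[of "grid_v g t N \<omega>" "grid_u h t N \<omega>"]
        using tel'[OF order_refl \<omega>] N by simp
    qed
    have "(\<integral>\<omega>. F (\<lambda>i\<in>{..<N}. D i \<omega>) \<partial>M) = (\<integral>\<omega>. F (\<lambda>i\<in>{..<N}. - D i \<omega>) \<partial>M)"
      unfolding D_def by (rule increments_symmetric[OF t N F_meas])
    then show ?thesis using 1 2 by (simp cong: Bochner_Integration.integral_cong)
  qed
  show ?thesis
    using lim1 lim2 step by (auto intro: LIMSEQ_unique)
qed

lemma expectation_regulators_swap:
  assumes "0 \<le> g" "0 \<le> h" "0 < t"
  shows "(\<integral>\<omega>. A (g, h) t \<omega> \<partial>M) = (\<integral>\<omega>. \<Gamma> (h, g) t \<omega> \<partial>M)"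
  using reflection_symmetry[OF assms, of "\<lambda>x. fst (snd x)" 1]
  by (simp add: continuous_on_fst continuous_on_snd)

text \<open>Both laws live on the quadrant, so it suffices to compare Laplace transforms. The discretised gaps may be negative;
the test function is truncated at \<open>0\<close> to stay bounded.\<close>

lemma distr_gaps_swap:
  assumes gh: "0 \<le> g" "0 \<le> h" and t: "0 \<le> t"
  shows "distr M borel (\<lambda>\<omega>. prod.swap (gaps t (g, h) \<omega>)) = distr M borel (gaps t (h, g))"
proof (cases "t = 0")
  case True
  have "prod.swap (gaps t (g, h) \<omega>) = gaps t (h, g) \<omega>" if "\<omega> \<in> space M" for \<omega>
    using W_0[OF that] reflectedD(1,5)[OF reflected[OF gh that]] reflectedD(1,5)[OF reflected[OF gh(2,1) that]]
    by (simp add: gaps_def True)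
  then show ?thesis by (intro distr_cong) auto
next
  case False
  then have tp: "0 < t" using t by simp
  have gm: "gaps t (g, h) \<in> M \<rightarrow>\<^sub>M borel" if "0 \<le> g" "0 \<le> h" for g h
    using gaps_section_measurable[OF t, of "(g, h)"] clamp_id[of "(g, h)"] that by simp
  have [measurable]: "gaps t (g, h) \<in> M \<rightarrow>\<^sub>M borel" "gaps t (h, g) \<in> M \<rightarrow>\<^sub>M borel" using gm gh by auto
  note [measurable] = swap_measurable
  have [measurable]: "(\<lambda>\<omega>. prod.swap (gaps t (g, h) \<omega>)) \<in> M \<rightarrow>\<^sub>M borel" by measurable
  show ?thesis
  proof (rule laplace_determines_measure)
    show "prob_space (distr M borel (\<lambda>\<omega>. prod.swap (gaps t (g, h) \<omega>)))" "prob_space (distr M borel (gaps t (h, g)))"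
      by (auto intro!: prob_space_distr)
    show "AE x in distr M borel (\<lambda>\<omega>. prod.swap (gaps t (g, h) \<omega>)). x \<in> {0..} \<times> {0..}"
      using gaps_nonneg[OF gh _ t] quadrant_sets(1) by (subst AE_distr_iff) (auto simp: mem_Times_iff)
    show "AE x in distr M borel (gaps t (h, g)). x \<in> {0..} \<times> {0..}"
      using gaps_nonneg[OF gh(2,1) _ t] quadrant_sets(1) by (subst AE_distr_iff) auto
    fix a b :: real assume ab: "0 \<le> a" "0 \<le> b"
    define \<phi> where "\<phi> x = exp (- a * max 0 (h - d * t + fst x - fst (snd x) / 2 + snd (snd x))
        - b * max 0 (g - d * t - fst x - snd (snd x) / 2 + fst (snd x)))" for x :: "real \<times> real \<times> real"
    have \<phi>_cont: "continuous_on UNIV \<phi>" unfolding \<phi>_def by (intro continuous_intros) auto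
    have "(\<integral>\<omega>. \<phi> (W t \<omega>, A (g, h) t \<omega>, \<Gamma> (g, h) t \<omega>) \<partial>M) =
          (\<integral>\<omega>. \<phi> (- W t \<omega>, \<Gamma> (h, g) t \<omega>, A (h, g) t \<omega>) \<partial>M)"
    proof (rule reflection_symmetry[OF gh tp \<phi>_cont, of 1])
      fix w u c :: real
      have "0 \<le> a * max 0 x" "0 \<le> b * max 0 x" for x using ab by auto
      then have "- a * max 0 x - b * max 0 y \<le> 0" for x y by (smt (verit) mult_minus_left)
      then have "\<phi> (w, u, c) \<le> exp 0" unfolding \<phi>_def exp_le_cancel_iff .
      then have "\<phi> (w, u, c) \<le> 1" by simp
      moreover have "0 \<le> \<phi> (w, u, c)" by (simp add: \<phi>_def)
      ultimately have "\<bar>\<phi> (w, u, c)\<bar> \<le> 1" by simp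
      also have "1 \<le> 1 * (1 + \<bar>u\<bar> + \<bar>c\<bar>)" by simp
      finally show "\<bar>\<phi> (w, u, c)\<bar> \<le> 1 * (1 + \<bar>u\<bar> + \<bar>c\<bar>)" .
    qed
    moreover have "\<phi> (W t \<omega>, A (g, h) t \<omega>, \<Gamma> (g, h) t \<omega>) =
        exp (- a * fst (prod.swap (gaps t (g, h) \<omega>)) - b * snd (prod.swap (gaps t (g, h) \<omega>)))" if "\<omega> \<in> space M" for \<omega>
      using gaps_nonneg[OF gh that t] by (simp add: \<phi>_def gaps_def max_def)
    moreover have "\<phi> (- W t \<omega>, \<Gamma> (h, g) t \<omega>, A (h, g) t \<omega>) =
        exp (- a * fst (gaps t (h, g) \<omega>) - b * snd (gaps t (h, g) \<omega>))" if "\<omega> \<in> space M" for \<omega>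
      using gaps_nonneg[OF gh(2,1) that t] by (simp add: \<phi>_def gaps_def max_def)
    ultimately show "(LINT x|distr M borel (\<lambda>\<omega>. prod.swap (gaps t (g, h) \<omega>)). exp (- a * fst x - b * snd x)) =
        (LINT x|distr M borel (gaps t (h, g)). exp (- a * fst x - b * snd x))"
      by (simp add: integral_distr cong: Bochner_Integration.integral_cong)
  qed auto
qed

lemma invariant_swap:
  assumes P: "\<And>t x. 0 \<le> t \<Longrightarrow> x \<in> {0..} \<times> {0..} \<Longrightarrow> P t x = distr M borel (gaps t x)"
    and inv: "invariant_probability P \<pi>"
  shows "invariant_probability P (distr \<pi> borel prod.swap)"
proof -
  interpret \<pi>: prob_space \<pi> using inv by (simp add: invariant_probability_def)
  have [measurable_cong]: "sets \<pi> = sets borel" using inv by (simp add: invariant_probability_def)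
  note [measurable] = swap_measurable quadrant_sets
  have swQ: "prod.swap -` (({0..} :: real set) \<times> ({0..} :: real set)) = {0..} \<times> ({0..} :: real set)" by auto
  have "(\<integral>\<^sup>+x\<in>{0..} \<times> {0..}. emeasure (P t x) B \<partial>distr \<pi> borel prod.swap) = emeasure (distr \<pi> borel prod.swap) B"
    if t: "0 \<le> t" and B[measurable]: "B \<in> sets borel" for t B
  proof -
    define K where "K x = emeasure (distr M borel (gaps t (clamp x))) B" for x
    have K: "emeasure (P t x) B * indicator ({0..} \<times> {0..}) x = K x * indicator ({0..} \<times> {0..}) x" for x
      using P[OF t, of x] clamp_id[of x] by (auto simp: K_def indicator_def)
    note [measurable] = gaps_measurable[OF t]
    note gm = gaps_section_measurable[OF t]
    have [measurable]: "K \<in> borel_measurable borel"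
    proof -
      have "(\<lambda>x. emeasure M (Pair x -` ((\<lambda>p. gaps t (clamp (fst p)) (snd p)) -` B \<inter> space (borel \<Otimes>\<^sub>M M)))) \<in> borel_measurable borel"
        by (rule measurable_emeasure_Pair) measurable
      also have "(\<lambda>x. emeasure M (Pair x -` ((\<lambda>p. gaps t (clamp (fst p)) (snd p)) -` B \<inter> space (borel \<Otimes>\<^sub>M M)))) = K"
        unfolding K_def by (subst emeasure_distr[OF gm B]) (auto simp: space_pair_measure intro!: ext arg_cong[where f = "emeasure M"])
      finally show ?thesis .
    qed
    have K_swap: "K (prod.swap x) = emeasure (distr M borel (gaps t (clamp x))) (prod.swap -` B)" for x
    proof -
      have "K (prod.swap x) = emeasure (distr M borel (\<lambda>\<omega>. prod.swap (gaps t (clamp x) \<omega>))) B"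
        unfolding K_def using distr_gaps_swap[of "fst (clamp x)" "snd (clamp x)" t] t
        by (simp add: clamp_def)
      also have "\<dots> = emeasure (distr M borel (gaps t (clamp x))) (prod.swap -` B)"
        using gm[of x] measurable_sets[OF swap_measurable B]
        by (subst (1 2) emeasure_distr) (auto intro!: arg_cong[where f = "emeasure M"] measurable_compose[OF gm swap_measurable])
      finally show ?thesis .
    qed
    have "(\<integral>\<^sup>+x\<in>{0..} \<times> {0..}. emeasure (P t x) B \<partial>distr \<pi> borel prod.swap) =
        (\<integral>\<^sup>+x. K (prod.swap x) * indicator ({0..} \<times> {0..}) (prod.swap x) \<partial>\<pi>)"
      unfolding K by (subst nn_integral_distr) auto
    also have "\<dots> = (\<integral>\<^sup>+x\<in>{0..} \<times> {0..}. emeasure (P t x) (prod.swap -` B) \<partial>\<pi>)"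
      unfolding K_swap using P[OF t] clamp_id
      by (intro nn_integral_cong) (auto simp: indicator_def split: if_splits)
    also have "\<dots> = emeasure \<pi> (prod.swap -` B)"
      using inv t measurable_sets[OF swap_measurable B] by (auto simp: invariant_probability_def)
    also have "\<dots> = emeasure (distr \<pi> borel prod.swap) B"
      using sets_eq_imp_space_eq[OF \<open>sets \<pi> = sets borel\<close>] by (subst emeasure_distr) auto
    finally show ?thesis .
  qed
  moreover have "emeasure (distr \<pi> borel prod.swap) ({0..} \<times> {0..}) = 1"
    using inv sets_eq_imp_space_eq[OF \<open>sets \<pi> = sets borel\<close>] swQ
    by (subst emeasure_distr) (auto simp: invariant_probability_def)
  ultimately show ?thesis
    unfolding invariant_probability_def by (auto intro!: \<pi>.prob_space_distr)
qed

end



section \<open>Second order expansion over a short time\<close>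

lemma exp_taylor_error:
  fixes x y :: real
  assumes "0 \<le> x" "0 \<le> y"
  shows "\<bar>exp (- y) - exp (- x) * (1 - (y - x) + (y - x)\<^sup>2 / 2)\<bar> \<le> \<bar>y - x\<bar> ^ 3 / 6"
proof (cases "y = x")
  case False
  define diff :: "nat \<Rightarrow> real \<Rightarrow> real" where "diff m t = (- 1) ^ m * exp (- t)" for m t
  have "\<exists>t. (if y < x then y < t \<and> t < x else x < t \<and> t < y) \<and>
      exp (- y) = (\<Sum>m<3. (diff m x / fact m) * (y - x) ^ m) + (diff 3 t / fact 3) * (y - x) ^ 3"
  proof (rule Taylor[where a = "min x y" and b = "max x y"])
    show "diff 0 = (\<lambda>t. exp (- t))" by (simp add: diff_def fun_eq_iff)
    show "\<forall>m t. m < 3 \<and> min x y \<le> t \<and> t \<le> max x y \<longrightarrow> DERIV (diff m) t :> diff (Suc m) t"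
      unfolding diff_def by (auto intro!: derivative_eq_intros)
  qed (use False in auto)
  then obtain t where "if y < x then y < t \<and> t < x else x < t \<and> t < y"
    and eq: "exp (- y) = (\<Sum>m<3. (diff m x / fact m) * (y - x) ^ m) + (diff 3 t / fact 3) * (y - x) ^ 3"
    by blast
  then have t: "0 \<le> t" using assms by (auto split: if_splits)
  have "exp (- y) - exp (- x) * (1 - (y - x) + (y - x)\<^sup>2 / 2) = - exp (- t) * (y - x) ^ 3 / 6"
    unfolding eq by (simp add: diff_def eval_nat_numeral field_simps)
  also have "\<bar>\<dots>\<bar> = exp (- t) * \<bar>y - x\<bar> ^ 3 / 6" by (simp add: abs_mult power_abs)
  also have "\<dots> \<le> 1 * \<bar>y - x\<bar> ^ 3 / 6" using t by (intro divide_right_mono mult_right_mono) auto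
  finally show ?thesis by simp
qed simp

text \<open>One path, started at \<open>(g, h)\<close>, with noise \<open>w\<close> and pushes \<open>a\<close>, \<open>c\<close> accumulated up to time \<open>t\<close>. Both \<open>Y\<close> at time \<open>0\<close>
and at time \<open>t\<close> are nonnegative, so the third derivative of \<open>exp (- y)\<close> is bounded by \<open>1\<close> in between and no exponential
moments of the noise are needed. Three errors arise: the cubic Taylor remainder; the part of the quadratic term that
involves the pushes or the drift; and the replacement of \<open>f\<close> by \<open>exp (- a2 * h)\<close> in front of \<open>a\<close>, which costs a
factor \<open>g\<close> that is at most \<open>2 * U\<close> whenever \<open>a\<close> is positive (and likewise for \<open>c\<close>). All quadratic errors caused by pushes
carry the indicator \<open>b\<close> that a push took place.\<close>

lemma adjoint_relation_pointwise:
  fixes a1 a2 g h d t w a c U :: real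
  assumes nn: "0 \<le> a1" "0 \<le> a2" "0 \<le> g" "0 \<le> h" "0 \<le> a" "0 \<le> c" "0 < d" "0 \<le> t"
    and G: "0 \<le> g - d * t - w - c / 2 + a" and H: "0 \<le> h - d * t + w - a / 2 + c"
    and w: "\<bar>w\<bar> + d * t \<le> U" and a: "a \<le> 2 * U" "c \<le> 2 * U"
    and B: "0 < a \<Longrightarrow> g < 2 * U" "0 < c \<Longrightarrow> h < 2 * U"
  defines "s \<equiv> a1 + a2" and "\<theta> \<equiv> a1 - a2"
    and "f \<equiv> exp (- a1 * g - a2 * h)"
    and "b \<equiv> (if 0 < a \<or> 0 < c then 1 else 0)"
  shows "\<bar>exp (- a1 * (g - d * t - w - c / 2 + a) - a2 * (h - d * t + w - a / 2 + c))
      - f * (1 + s * d * t + \<theta> * w + \<theta>\<^sup>2 * w\<^sup>2 / 2)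
      + (a1 - a2 / 2) * (exp (- a2 * h) * a) + (a2 - a1 / 2) * (exp (- a1 * g) * c)\<bar>
    \<le> 36 * s ^ 3 * U ^ 3 + 22 * s\<^sup>2 * (U\<^sup>2 * b) + 4 * s\<^sup>2 * d * (t * U)"
proof -
  define V where "V = (a1 - a2 / 2) * a + (a2 - a1 / 2) * c"
  define y0 where "y0 = a1 * g + a2 * h"
  define \<Delta> where "\<Delta> = V - s * d * t - \<theta> * w"
  have dt: "0 \<le> d * t" using nn by simp
  have U: "0 \<le> U" "\<bar>w\<bar> \<le> U" "d * t \<le> U" using w dt by linarith+
  have s0: "0 \<le> s" "a1 \<le> s" "a2 \<le> s" "\<bar>\<theta>\<bar> \<le> s" "\<bar>a1 - a2 / 2\<bar> \<le> s" "\<bar>a2 - a1 / 2\<bar> \<le> s"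
    using nn by (auto simp: s_def \<theta>_def abs_le_iff)
  have b: "0 \<le> b" "b \<le> 1" "a = a * b" "c = c * b" using nn by (auto simp: b_def)
  have y0: "0 \<le> y0" using nn by (simp add: y0_def)
  have y1: "y0 + \<Delta> = a1 * (g - d * t - w - c / 2 + a) + a2 * (h - d * t + w - a / 2 + c)"
    by (simp add: y0_def \<Delta>_def V_def s_def \<theta>_def algebra_simps)
  have "0 \<le> y0 + \<Delta>" unfolding y1 using nn G H by simp
  from exp_taylor_error[OF y0 this]
  have T: "\<bar>exp (- (y0 + \<Delta>)) - f * (1 - \<Delta> + \<Delta>\<^sup>2 / 2)\<bar> \<le> \<bar>\<Delta>\<bar> ^ 3 / 6"
    by (simp add: f_def y0_def)
  have f1: "0 \<le> f" "f \<le> 1" using y0 by (auto simp: f_def y0_def)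
  have aU: "a \<le> 2 * U * b" "c \<le> 2 * U * b" using a U(1) nn by (auto simp: b_def)
  have V: "\<bar>V\<bar> \<le> 4 * s * U * b"
  proof -
    have "\<bar>V\<bar> \<le> \<bar>a1 - a2 / 2\<bar> * a + \<bar>a2 - a1 / 2\<bar> * c"
      unfolding V_def using nn by (intro order.trans[OF abs_triangle_ineq]) (simp add: abs_mult)
    also have "\<dots> \<le> s * (2 * U * b) + s * (2 * U * b)"
      using s0 aU nn by (intro add_mono mult_mono) auto
    finally show ?thesis by (simp add: mult_ac)
  qed
  have V': "\<bar>V\<bar> \<le> 4 * s * U"
  proof -
    have "4 * s * U * b \<le> 4 * s * U * 1" using s0 U b by (intro mult_left_mono) auto
    then show ?thesis using V by linarith
  qed
  have sdt: "0 \<le> s * d * t" "s * d * t \<le> s * U"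
    using s0 nn U by (auto simp: mult.assoc intro: mult_left_mono)
  have \<theta>w: "\<bar>\<theta> * w\<bar> \<le> s * U" unfolding abs_mult using s0 U by (intro mult_mono) auto
  have \<Delta>: "\<bar>\<Delta>\<bar> \<le> 6 * (s * U)" unfolding \<Delta>_def using V' sdt \<theta>w by linarith
  have "\<bar>\<Delta>\<bar> ^ 3 \<le> (6 * (s * U)) ^ 3" by (rule power_mono[OF \<Delta>]) simp
  then have c1: "\<bar>\<Delta>\<bar> ^ 3 / 6 \<le> 36 * s ^ 3 * U ^ 3" by (simp add: power_mult_distrib)
  have c2: "\<bar>\<Delta>\<^sup>2 - \<theta>\<^sup>2 * w\<^sup>2\<bar> \<le> 28 * s\<^sup>2 * (U\<^sup>2 * b) + 7 * s\<^sup>2 * d * (t * U)"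
  proof -
    have "\<Delta>\<^sup>2 - \<theta>\<^sup>2 * w\<^sup>2 = (V - s * d * t) * (V - s * d * t - 2 * (\<theta> * w))"
      by (simp add: \<Delta>_def power2_eq_square algebra_simps)
    then have "\<bar>\<Delta>\<^sup>2 - \<theta>\<^sup>2 * w\<^sup>2\<bar> = \<bar>V - s * d * t\<bar> * \<bar>V - s * d * t - 2 * (\<theta> * w)\<bar>"
      by (simp add: abs_mult)
    also have "\<dots> \<le> (4 * s * U * b + s * d * t) * (7 * (s * U))"
    proof (rule mult_mono)
      show "\<bar>V - s * d * t\<bar> \<le> 4 * s * U * b + s * d * t" using V sdt by linarith
      show "\<bar>V - s * d * t - 2 * (\<theta> * w)\<bar> \<le> 7 * (s * U)" using V' sdt \<theta>w by linarith
      show "0 \<le> 4 * s * U * b + s * d * t" using s0 U b sdt by simp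
    qed simp
    also have "\<dots> = 28 * s\<^sup>2 * (U\<^sup>2 * b) + 7 * s\<^sup>2 * d * (t * U)"
      by (simp add: power2_eq_square algebra_simps)
    finally show ?thesis .
  qed
  have f_\<Delta>: "\<bar>f * (\<Delta>\<^sup>2 - \<theta>\<^sup>2 * w\<^sup>2) / 2\<bar> \<le> 14 * s\<^sup>2 * (U\<^sup>2 * b) + 4 * s\<^sup>2 * d * (t * U)"
  proof -
    have "f * \<bar>\<Delta>\<^sup>2 - \<theta>\<^sup>2 * w\<^sup>2\<bar> \<le> 1 * \<bar>\<Delta>\<^sup>2 - \<theta>\<^sup>2 * w\<^sup>2\<bar>" using f1 by (intro mult_right_mono) auto
    moreover have "0 \<le> s\<^sup>2 * d * (t * U)" using nn U by simp
    ultimately show ?thesis using c2 f1 by (simp add: abs_mult)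
  qed
  have repl: "\<bar>exp (- p * x) * z - exp (- p * x - q * y) * z\<bar> \<le> s * (4 * (U\<^sup>2 * b))"
    if "0 \<le> p" "0 \<le> x" "0 \<le> q" "q \<le> s" "0 \<le> y" "0 \<le> z" "z \<le> 2 * U * b" "0 < z \<Longrightarrow> y < 2 * U" for p q x y z
  proof -
    have z: "0 \<le> 2 * U * b" using that by linarith
    have "exp (- p * x - q * y) = exp (- p * x) * exp (- q * y)" by (simp flip: exp_add)
    then have "exp (- p * x) * z - exp (- p * x - q * y) * z = exp (- p * x) * (1 - exp (- q * y)) * z"
      by (simp add: algebra_simps)
    then have "\<bar>exp (- p * x) * z - exp (- p * x - q * y) * z\<bar> = exp (- p * x) * (1 - exp (- q * y)) * z"
      using that by (simp add: abs_mult)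
    also have "\<dots> \<le> (1 * (q * y)) * z"
      using exp_ge_add_one_self[of "- q * y"] that by (intro mult_right_mono mult_mono) auto
    also have "\<dots> \<le> s * (4 * (U\<^sup>2 * b))"
    proof (cases "0 < z")
      case True
      have "(q * y) * z \<le> (s * (2 * U)) * (2 * U * b)"
        using that True s0 U z by (intro mult_mono) (auto intro: less_imp_le)
      then show ?thesis by (simp add: power2_eq_square)
    qed (use that s0 b in simp)
    finally show ?thesis .
  qed
  have r1: "\<bar>(a1 - a2 / 2) * (exp (- a2 * h) * a - f * a)\<bar> \<le> s * (s * (4 * (U\<^sup>2 * b)))"
  proof -
    have "- a2 * h - a1 * g = - a1 * g - a2 * h" by simp
    then have "exp (- a2 * h - a1 * g) = f" unfolding f_def by (rule arg_cong)
    then have "\<bar>exp (- a2 * h) * a - f * a\<bar> \<le> s * (4 * (U\<^sup>2 * b))"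
      using repl[of a2 h a1 g a] nn aU s0 B by auto
    then show ?thesis unfolding abs_mult using s0 by (intro mult_mono) auto
  qed
  have r2: "\<bar>(a2 - a1 / 2) * (exp (- a1 * g) * c - f * c)\<bar> \<le> s * (s * (4 * (U\<^sup>2 * b)))"
  proof -
    have "\<bar>exp (- a1 * g) * c - f * c\<bar> \<le> s * (4 * (U\<^sup>2 * b))"
      unfolding f_def using repl[of a1 g a2 h c] nn aU s0 B by auto
    then show ?thesis unfolding abs_mult using s0 by (intro mult_mono) auto
  qed
  have "exp (- a1 * (g - d * t - w - c / 2 + a) - a2 * (h - d * t + w - a / 2 + c)) = exp (- (y0 + \<Delta>))"
    unfolding y1 by simp
  moreover have "exp (- (y0 + \<Delta>)) - f * (1 + s * d * t + \<theta> * w + \<theta>\<^sup>2 * w\<^sup>2 / 2)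
      + (a1 - a2 / 2) * (exp (- a2 * h) * a) + (a2 - a1 / 2) * (exp (- a1 * g) * c) =
     (exp (- (y0 + \<Delta>)) - f * (1 - \<Delta> + \<Delta>\<^sup>2 / 2)) + f * (\<Delta>\<^sup>2 - \<theta>\<^sup>2 * w\<^sup>2) / 2
     + (a1 - a2 / 2) * (exp (- a2 * h) * a - f * a) + (a2 - a1 / 2) * (exp (- a1 * g) * c - f * c)"
  proof -
    define E1 E2 e1 e2 where "E1 = exp (- a2 * h)" and "E2 = exp (- a1 * g)"
      and "e1 = a1 - a2 / 2" and "e2 = a2 - a1 / 2"
    have D: "\<Delta> = e1 * a + e2 * c - s * d * t - \<theta> * w" by (simp add: \<Delta>_def V_def e1_def e2_def)
    show ?thesis unfolding E1_def[symmetric] E2_def[symmetric] e1_def[symmetric] e2_def[symmetric]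
      by (simp add: D algebra_simps add_divide_distrib diff_divide_distrib)
  qed
  moreover have "s * (s * (4 * (U\<^sup>2 * b))) = 4 * s\<^sup>2 * (U\<^sup>2 * b)" by (simp add: power2_eq_square)
  ultimately show ?thesis using T c1 f_\<Delta> r1 r2 by linarith
qed

text \<open>Each power of \<open>U\<close> is compared with its expected order of magnitude, \<open>U\<close> being of order \<open>r\<close>, and with the fourth power,
whose mean is under control. The free parameter \<open>k\<close> trades the indicator \<open>b\<close> against large values of \<open>U\<close>.\<close>

lemma moment_interpolation:
  fixes U r k b :: real
  assumes "0 \<le> U" "0 < r" "0 < k" "0 \<le> b" "b \<le> 1"
  shows "U ^ 3 \<le> r ^ 3 + U ^ 4 / r"
    and "U\<^sup>2 * b \<le> k * r\<^sup>2 * b + U ^ 4 / (k * r\<^sup>2)"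
    and "r\<^sup>2 * U \<le> r ^ 3 + U ^ 4 / r"
proof -
  show "U ^ 3 \<le> r ^ 3 + U ^ 4 / r"
  proof (cases "U \<le> r")
    case True then have "U ^ 3 \<le> r ^ 3" using assms by (intro power_mono) auto
    then show ?thesis using assms by (simp add: add_increasing2)
  next
    case False
    then have "U ^ 3 * r \<le> U ^ 3 * U" using assms by (intro mult_left_mono) auto
    then have "U ^ 3 \<le> U ^ 4 / r" using assms by (simp add: field_simps eval_nat_numeral)
    then show ?thesis using assms by (simp add: add_increasing)
  qed
  show "r\<^sup>2 * U \<le> r ^ 3 + U ^ 4 / r"
  proof (cases "U \<le> r")
    case True then have "r\<^sup>2 * U \<le> r\<^sup>2 * r" using assms by (intro mult_left_mono) auto
    also have "r\<^sup>2 * r = r ^ 3" by (simp add: eval_nat_numeral)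
    finally show ?thesis using assms by (simp add: add_increasing2)
  next
    case False
    then have "U * r ^ 3 \<le> U * U ^ 3" using assms by (intro mult_left_mono power_mono) auto
    then have "r\<^sup>2 * U \<le> U ^ 4 / r" using assms by (simp add: field_simps eval_nat_numeral)
    then show ?thesis using assms by (simp add: add_increasing)
  qed
  have kr: "0 < k * r\<^sup>2" using assms by simp
  show "U\<^sup>2 * b \<le> k * r\<^sup>2 * b + U ^ 4 / (k * r\<^sup>2)"
  proof (cases "U\<^sup>2 \<le> k * r\<^sup>2")
    case True then have "U\<^sup>2 * b \<le> k * r\<^sup>2 * b" using assms by (intro mult_right_mono) auto
    then show ?thesis using kr by (simp add: add_increasing2)
  next
    case False
    have "U\<^sup>2 * b \<le> U\<^sup>2" using assms by (simp add: mult_left_le)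
    moreover have "U\<^sup>2 * (k * r\<^sup>2) \<le> U\<^sup>2 * U\<^sup>2" using False by (intro mult_left_mono) auto
    then have "U\<^sup>2 \<le> U ^ 4 / (k * r\<^sup>2)" using kr by (simp add: pos_le_divide_eq)
    moreover have "0 \<le> k * r\<^sup>2 * b" using assms by simp
    ultimately show ?thesis by linarith
  qed
qed



section \<open>The stationary regime\<close>

locale stationary_gaps = reflected_gaps M W d A \<Gamma>
  for M :: "'a measure" and W d A \<Gamma> +
  fixes \<pi> :: "(real \<times> real) measure"
  assumes prob_\<pi>: "prob_space \<pi>" and sets_\<pi>: "sets \<pi> = sets borel"
    and quadrant_\<pi>: "emeasure \<pi> ({0..} \<times> {0..}) = 1"
    and invariant: "0 \<le> t \<Longrightarrow> B \<in> sets borel \<Longrightarrow>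
      (\<integral>\<^sup>+x\<in>{0..} \<times> {0..}. emeasure (distr M borel (gaps t x)) B \<partial>\<pi>) = emeasure \<pi> B"
    and symmetric: "distr \<pi> borel prod.swap = \<pi>"
begin

sublocale \<pi>: prob_space \<pi> by (rule prob_\<pi>)

sublocale N: pair_prob_space \<pi> M
  by unfold_locales

abbreviation N where "N \<equiv> \<pi> \<Otimes>\<^sub>M M"

lemma sets_N [measurable_cong]: "sets N = sets (borel \<Otimes>\<^sub>M M)"
  by (intro sets_pair_measure_cong sets_\<pi> refl)

lemmas [measurable_cong] = sets_\<pi>

lemma AE_quadrant: "AE x in \<pi>. x \<in> {0..} \<times> {0..}"
  using quadrant_\<pi> quadrant_sets(1) by (subst \<pi>.AE_in_set_eq_1) (auto simp: sets_\<pi> \<pi>.emeasure_eq_measure)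

text \<open>On the product of the invariant law and the noise, a point carries the starting state in its first component and
the path in its second.\<close>

definition g0 :: "(real \<times> real) \<times> 'a \<Rightarrow> real" where "g0 p = max 0 (fst (fst p))"
definition h0 :: "(real \<times> real) \<times> 'a \<Rightarrow> real" where "h0 p = max 0 (snd (fst p))"
definition push_g :: "real \<Rightarrow> (real \<times> real) \<times> 'a \<Rightarrow> real" where "push_g t p = A (clamp (fst p)) t (snd p)"
definition push_h :: "real \<Rightarrow> (real \<times> real) \<times> 'a \<Rightarrow> real" where "push_h t p = \<Gamma> (clamp (fst p)) t (snd p)"

text \<open>The Laplace transform of \<open>\<pi>\<close> over the closed quadrant; it agrees with \<open>laplace2\<close> once the boundary is known to be null.\<close>

definition L :: "real \<Rightarrow> real \<Rightarrow> real" where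
  "L a1 a2 = (LINT x|\<pi>. exp (- a1 * max 0 (fst x) - a2 * max 0 (snd x)))"

lemma start_measurable [measurable]: "g0 \<in> borel_measurable N" "h0 \<in> borel_measurable N"
  unfolding g0_def h0_def by measurable

lemma push_measurable [measurable]:
  assumes "0 \<le> t" shows "push_g t \<in> borel_measurable N" "push_h t \<in> borel_measurable N"
  using regulators_jointly_measurable[OF assms] unfolding push_g_def[abs_def] push_h_def[abs_def]
  by (simp_all cong: measurable_cong_sets[OF sets_N refl])

lemma start_nonneg: "0 \<le> g0 p" "0 \<le> h0 p"
  by (auto simp: g0_def h0_def)

lemma exp_le_1: "0 \<le> b \<Longrightarrow> 0 \<le> x \<Longrightarrow> 0 \<le> c \<Longrightarrow> 0 \<le> y \<Longrightarrow> exp (- b * x - c * y) \<le> (1 :: real)"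
  by (simp add: add_nonneg_nonneg diff_le_eq minus_le_iff) (smt (verit) mult_nonneg_nonneg)

lemma gaps_clamp:
  "gaps t (clamp (fst p)) (snd p) =
    (g0 p - d * t - W t (snd p) - push_h t p / 2 + push_g t p, h0 p - d * t + W t (snd p) - push_g t p / 2 + push_h t p)"
  by (simp add: gaps_def g0_def h0_def push_g_def push_h_def clamp_def)

lemma pathwise:
  assumes p: "p \<in> space N" and t: "0 \<le> t"
  shows "0 \<le> push_g t p" "0 \<le> push_h t p"
    and "- g0 p + d * t + W t (snd p) + push_h t p / 2 \<le> push_g t p"
    and "- h0 p + d * t - W t (snd p) + push_g t p / 2 \<le> push_h t p"
    and "0 \<le> g0 p - d * t - W t (snd p) - push_h t p / 2 + push_g t p"
    and "0 \<le> h0 p - d * t + W t (snd p) - push_g t p / 2 + push_h t p"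
proof -
  have "snd p \<in> space M" using p by (auto simp: space_pair_measure)
  note R = regulators_ge[OF start_nonneg[of p] this t]
  show "0 \<le> push_g t p" "0 \<le> push_h t p"
    and "- g0 p + d * t + W t (snd p) + push_h t p / 2 \<le> push_g t p"
    and "- h0 p + d * t - W t (snd p) + push_g t p / 2 \<le> push_h t p"
    using R by (simp_all add: push_g_def push_h_def clamp_def g0_def h0_def)
  then show "0 \<le> g0 p - d * t - W t (snd p) - push_h t p / 2 + push_g t p"
    and "0 \<le> h0 p - d * t + W t (snd p) - push_g t p / 2 + push_h t p" by linarith+
qed

lemma push_le:
  assumes p: "p \<in> space N" and t: "0 \<le> t"
    and m: "\<And>s. 0 \<le> s \<Longrightarrow> s \<le> t \<Longrightarrow> \<bar>W s (snd p)\<bar> + d * s \<le> m"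
  shows "push_g t p \<le> 2 * m" "push_h t p \<le> 2 * m"
    and "push_g t p > 0 \<Longrightarrow> g0 p < 2 * m" "push_h t p > 0 \<Longrightarrow> h0 p < 2 * m"
proof -
  have "snd p \<in> space M" using p by (auto simp: space_pair_measure)
  from regulators_le[OF start_nonneg[of p] this t m]
  show "push_g t p \<le> 2 * m" "push_h t p \<le> 2 * m"
    "push_g t p > 0 \<Longrightarrow> g0 p < 2 * m" "push_h t p > 0 \<Longrightarrow> h0 p < 2 * m"
    by (simp_all add: push_g_def push_h_def clamp_def g0_def h0_def)
qed

lemma distr_gaps_stationary:
  assumes t: "0 \<le> t"
  shows "distr N borel (\<lambda>p. gaps t (clamp (fst p)) (snd p)) = \<pi>"
proof (rule measure_eqI)
  fix B assume "B \<in> sets (distr N borel (\<lambda>p. gaps t (clamp (fst p)) (snd p)))"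
  then have B[measurable]: "B \<in> sets borel" by simp
  note gm[measurable] = gaps_measurable[OF t]
  let ?S = "(\<lambda>p. gaps t (clamp (fst p)) (snd p)) -` B \<inter> space N"
  have "emeasure (distr N borel (\<lambda>p. gaps t (clamp (fst p)) (snd p))) B = emeasure N ?S"
    by (rule emeasure_distr) measurable
  also have "\<dots> = (\<integral>\<^sup>+x. emeasure M (Pair x -` ?S) \<partial>\<pi>)"
    by (rule emeasure_pair_measure_alt) measurable
  also have "\<dots> = (\<integral>\<^sup>+x. emeasure (distr M borel (gaps t x)) B * indicator ({0..} \<times> {0..}) x \<partial>\<pi>)"
  proof (rule nn_integral_cong_AE)
    show "AE x in \<pi>. emeasure M (Pair x -` ?S) = emeasure (distr M borel (gaps t x)) B * indicator ({0..} \<times> {0..}) x"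
      using AE_quadrant
    proof eventually_elim
      case (elim x)
      then have "emeasure (distr M borel (gaps t x)) B = emeasure M (gaps t (clamp x) -` B \<inter> space M)"
        using emeasure_distr[OF gaps_section_measurable[OF t] B, of x] clamp_id[OF elim] by simp
      also have "gaps t (clamp x) -` B \<inter> space M = Pair x -` ?S"
        using sets_eq_imp_space_eq[OF sets_\<pi>] by (auto simp: space_pair_measure)
      finally show ?case using elim by simp
    qed
  qed
  also have "\<dots> = emeasure \<pi> B" by (rule invariant[OF t B])
  finally show "emeasure (distr N borel (\<lambda>p. gaps t (clamp (fst p)) (snd p))) B = emeasure \<pi> B" .
qed (simp add: sets_\<pi>)

lemma L_integrable:
  assumes "0 \<le> a1" "0 \<le> a2"
  shows "integrable \<pi> (\<lambda>x. exp (- a1 * max 0 (fst x) - a2 * max 0 (snd x)))"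
  by (rule \<pi>.integrable_const_bound[where B = 1]) (use exp_le_1[OF assms(1) _ assms(2)] in auto)

lemma L_bounds:
  assumes "0 \<le> a1" "0 \<le> a2"
  shows "0 \<le> L a1 a2" "L a1 a2 \<le> 1"
proof -
  show "0 \<le> L a1 a2" unfolding L_def by (rule integral_nonneg_AE) auto
  have "L a1 a2 \<le> (LINT x|\<pi>. 1)"
    unfolding L_def by (rule integral_mono[OF L_integrable[OF assms]]) (use exp_le_1[OF assms(1) _ assms(2)] in auto)
  then show "L a1 a2 \<le> 1" by (simp add: \<pi>.prob_space)
qed

lemma stationarity:
  assumes t: "0 \<le> t"
  shows "(\<integral>p. exp (- a1 * (g0 p - d * t - W t (snd p) - push_h t p / 2 + push_g t p)
      - a2 * (h0 p - d * t + W t (snd p) - push_g t p / 2 + push_h t p)) \<partial>N) = L a1 a2"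
proof -
  note gm[measurable] = gaps_measurable[OF t]
  have "L a1 a2 = (LINT x|\<pi>. exp (- a1 * fst x - a2 * snd x))"
    unfolding L_def by (rule integral_cong_AE) (use AE_quadrant in \<open>auto elim!: eventually_mono\<close>)
  also have "\<dots> = (LINT x|distr N borel (\<lambda>p. gaps t (clamp (fst p)) (snd p)). exp (- a1 * fst x - a2 * snd x))"
    by (simp only: distr_gaps_stationary[OF t])
  also have "\<dots> = (\<integral>p. exp (- a1 * fst (gaps t (clamp (fst p)) (snd p)) - a2 * snd (gaps t (clamp (fst p)) (snd p))) \<partial>N)"
    by (rule integral_distr) measurable
  finally show ?thesis by (simp add: gaps_clamp)
qed

lemma start_functional:
  assumes nn: "0 \<le> a1" "0 \<le> a2" and k: "has_bochner_integral M k x"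
  shows "integrable N (\<lambda>p. exp (- a1 * g0 p - a2 * h0 p) * k (snd p))"
    and "(\<integral>p. exp (- a1 * g0 p - a2 * h0 p) * k (snd p) \<partial>N) = L a1 a2 * x"
  using N.expectation_product[OF L_integrable[OF nn], of k] k
  by (auto simp: has_bochner_integral_iff g0_def h0_def L_def)

lemma noise_functional:
  assumes k: "integrable M k"
  shows "integrable N (\<lambda>p. k (snd p))" "(\<integral>p. k (snd p) \<partial>N) = (\<integral>\<omega>. k \<omega> \<partial>M :: real)"
  using N.expectation_product[of "\<lambda>_. 1", OF _ k] by (simp_all add: \<pi>.prob_space)

text \<open>Divided by \<open>t\<close>, this approximates as \<open>t\<close> tends to \<open>0\<close> the transform of the boundary measure of \<open>\<pi>\<close> on the axis
\<open>{0} \<times> [0, \<infinity>)\<close>.\<close>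

definition boundary_push :: "real \<Rightarrow> real \<Rightarrow> real" where
  "boundary_push t b = (\<integral>p. exp (- b * h0 p) * push_g t p \<partial>N)"

lemma push_integrable:
  assumes t: "0 < t" and b: "0 \<le> b"
  shows "integrable N (\<lambda>p. exp (- b * h0 p) * push_g t p)" "integrable N (\<lambda>p. exp (- b * g0 p) * push_h t p)"
proof -
  obtain R where [measurable]: "R \<in> borel_measurable M"
    and R: "\<And>\<omega> s. \<omega> \<in> space M \<Longrightarrow> 0 \<le> s \<Longrightarrow> s \<le> t \<Longrightarrow> \<bar>W s \<omega>\<bar> \<le> R \<omega>"
    and R4: "integrable M (\<lambda>\<omega>. R \<omega> ^ 4)"
    using running_maximum[OF t] by metis
  note [measurable] = push_measurable[OF less_imp_le[OF t]]
  let ?U = "\<lambda>\<omega>. 1 + R \<omega> ^ 4 + d * t"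
  have U: "\<bar>W s \<omega>\<bar> + d * s \<le> ?U \<omega>" if "\<omega> \<in> space M" "0 \<le> s" "s \<le> t" for \<omega> s
  proof -
    have "R \<omega> \<le> 1 + R \<omega> ^ 4" using abs_le_one_plus_fourth_power[of "R \<omega>"] by simp
    then show ?thesis using R[OF that] d_pos that by (intro add_mono mult_left_mono) auto
  qed
  have int: "integrable N (\<lambda>p. 2 * ?U (snd p))"
    by (rule noise_functional) (use R4 in auto)
  have bnd: "push_g t p \<le> 2 * ?U (snd p) \<and> push_h t p \<le> 2 * ?U (snd p)" if p: "p \<in> space N" for p
  proof -
    have "snd p \<in> space M" using p by (auto simp: space_pair_measure)
    from push_le(1,2)[OF p less_imp_le[OF t] U[OF this]] show ?thesis by simp
  qed
  have e: "\<bar>exp (- b * x) * y\<bar> \<le> \<bar>z\<bar>" if "0 \<le> x" "0 \<le> y" "y \<le> z" for x y z :: real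
  proof -
    have "exp (- b * x) * y \<le> 1 * y" using that b by (intro mult_right_mono) auto
    then show ?thesis using that by (simp add: abs_mult)
  qed
  show "integrable N (\<lambda>p. exp (- b * h0 p) * push_g t p)"
  proof (rule Bochner_Integration.integrable_bound[OF int])
    show "AE p in N. norm (exp (- b * h0 p) * push_g t p) \<le> norm (2 * ?U (snd p))"
      unfolding real_norm_def
      by (rule AE_I2) (rule e[OF start_nonneg(2) pathwise(1)[OF _ less_imp_le[OF t]] conjunct1[OF bnd]])
  qed measurable
  show "integrable N (\<lambda>p. exp (- b * g0 p) * push_h t p)"
  proof (rule Bochner_Integration.integrable_bound[OF int])
    show "AE p in N. norm (exp (- b * g0 p) * push_h t p) \<le> norm (2 * ?U (snd p))"
      unfolding real_norm_def
      by (rule AE_I2) (rule e[OF start_nonneg(1) pathwise(2)[OF _ less_imp_le[OF t]] conjunct2[OF bnd]])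
  qed measurable
qed

lemma boundary_push_swap:
  assumes t: "0 < t" and b: "0 \<le> b"
  shows "boundary_push t b = (\<integral>p. exp (- b * g0 p) * push_h t p \<partial>N)"
proof -
  note [measurable] = push_measurable[OF less_imp_le[OF t]] swap_measurable
  \<comment> \<open>The swap acts on the starting state only, hence the noise is integrated out first.\<close>
  define \<psi> where "\<psi> x = (\<integral>\<omega>. exp (- b * g0 (x, \<omega>)) * push_h t (x, \<omega>) \<partial>M)" for x
  have [measurable]: "\<psi> \<in> borel_measurable borel"
    using N.integrable_fst'[OF push_integrable(2)[OF assms]] unfolding \<psi>_def by (simp add: borel_measurable_integrable)
  have "\<psi> (prod.swap x) = (\<integral>\<omega>. exp (- b * h0 (x, \<omega>)) * push_g t (x, \<omega>) \<partial>M)" for x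
    using expectation_regulators_swap[of "max 0 (fst x)" "max 0 (snd x)" t] t
    by (simp add: \<psi>_def g0_def h0_def push_g_def push_h_def clamp_def)
  then have "boundary_push t b = (LINT x|\<pi>. \<psi> (prod.swap x))"
    unfolding boundary_push_def N.integral_fst'[OF push_integrable(1)[OF assms], symmetric] by simp
  also have "\<dots> = (LINT x|distr \<pi> borel prod.swap. \<psi> x)" by (subst integral_distr) auto
  also have "\<dots> = (\<integral>p. exp (- b * g0 p) * push_h t p \<partial>N)"
    unfolding symmetric N.integral_fst'[OF push_integrable(2)[OF assms], symmetric] \<psi>_def ..
  finally show ?thesis .
qed


text \<open>If \<open>G\<close> starts at \<open>0\<close>, then \<open>A\<close> at time \<open>t\<close> is at least the positive part of \<open>W t\<close>, whose mean is of order
\<open>sqrt t\<close>. In the stationary regime, however, the noise cancels from \<open>G + H\<close> and the exact identity for \<open>exp (- (G + H))\<close>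
bounds the mean of \<open>exp (- (g0 + h0)) * (1 - exp (- V))\<close> by \<open>2 * d * t\<close>, where \<open>V\<close> is half the total push. As \<open>t\<close> tends to \<open>0\<close> this leaves no mass for \<open>G = 0\<close>; the other axis
follows by symmetry.\<close>

lemma boundary_null:
  shows "AE x in \<pi>. 0 < fst x \<and> 0 < snd x"
proof -
  define p' where "p' = (LINT x|\<pi>. indicator {x. fst x \<le> 0} x * exp (- max 0 (snd x)))"
  have meas[measurable]: "{x. fst x \<le> 0} \<in> sets (borel :: (real \<times> real) measure)"
    by (simp add: borel_closed closed_Collect_le continuous_on_fst)
  have int: "integrable \<pi> (\<lambda>x. indicator {x. fst x \<le> 0} x * exp (- max 0 (snd x)) :: real)"
    by (rule \<pi>.integrable_const_bound[where B = 1]) (auto simp: indicator_def)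
  have p'0: "0 \<le> p'" unfolding p'_def by (rule integral_nonneg_AE) auto
  have key: "p' * (sqrt (2 / pi) / 4 * r - r\<^sup>2 / 4) \<le> 2 * d * r\<^sup>2" if r: "0 < r" for r
  proof -
    define t where "t = r\<^sup>2"
    have t: "0 < t" "0 \<le> t" "sqrt t = r" using r by (auto simp: t_def)
    note [measurable] = push_measurable[OF t(2)] W_measurable[OF t(2)]
    define Yt where "Yt p = exp (- 1 * (g0 p - d * t - W t (snd p) - push_h t p / 2 + push_g t p)
      - 1 * (h0 p - d * t + W t (snd p) - push_g t p / 2 + push_h t p))" for p
    define f where "f p = exp (- 1 * g0 p - 1 * h0 p)" for p
    have Yt_meas[measurable]: "Yt \<in> borel_measurable N" unfolding Yt_def by measurable
    have Yt_int: "integrable N Yt"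
    proof (rule N.integrable_const_bound[where B = 1])
      show "AE p in N. norm (Yt p) \<le> 1"
        unfolding Yt_def real_norm_def abs_exp_cancel
        by (rule AE_I2) (rule exp_le_1[OF zero_le_one pathwise(5)[OF _ t(2)] zero_le_one pathwise(6)[OF _ t(2)]])
    qed measurable
    have f_int: "integrable N f" "(\<integral>p. f p \<partial>N) = L 1 1"
      using start_functional[of 1 1 "\<lambda>_. 1" 1] by (auto simp: f_def[abs_def] has_bochner_integral_iff prob_space)
    \<comment> \<open>This is at most \<open>m - m\<^sup>2\<close>, a lower bound for \<open>1 - exp (- m)\<close>, with \<open>m\<close> half the positive part of \<open>W t\<close>.\<close>
    define z where "z \<omega> = (\<bar>W t \<omega>\<bar> + W t \<omega>) / 4 - (W t \<omega>)\<^sup>2 / 4" for \<omega>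
    have z: "has_bochner_integral M z ((r * sqrt (2 / pi) + 0) / 4 - t / 4)"
      unfolding z_def using W_moments[OF t(1)] unfolding t(3)
      by (intro has_bochner_integral_diff has_bochner_integral_divide_zero has_bochner_integral_add) auto
    have lower: "indicator {x. fst x \<le> 0} (fst p) * exp (- max 0 (snd (fst p))) * z (snd p) \<le> f p - exp (- (2 * d * t)) * Yt p"
      if p: "p \<in> space N" for p
    proof -
      define V where "V = (push_g t p + push_h t p) / 2"
      have "exp (- (2 * d * t)) * Yt p = f p * exp (- V)"
      proof -
        have "- (2 * d * t) + (- 1 * (g0 p - d * t - W t (snd p) - push_h t p / 2 + push_g t p)
            - 1 * (h0 p - d * t + W t (snd p) - push_g t p / 2 + push_h t p)) = (- 1 * g0 p - 1 * h0 p) + - V"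
          by (simp add: V_def field_simps)
        then show ?thesis unfolding Yt_def f_def exp_add[symmetric] by (rule arg_cong)
      qed
      then have eq: "f p - exp (- (2 * d * t)) * Yt p = f p * (1 - exp (- V))" by (simp add: algebra_simps)
      have V0: "0 \<le> V" using pathwise(1,2)[OF p t(2)] by (simp add: V_def)
      show ?thesis
      proof (cases "fst (fst p) \<le> 0")
        case False
        then show ?thesis unfolding eq using V0 by (simp add: f_def)
      next
        case True
        define m where "m = max 0 (W t (snd p)) / 2"
        have "0 \<le> d * t" "g0 p = 0" using d_pos t True by (auto simp: g0_def)
        then have "max 0 (W t (snd p)) \<le> push_g t p"
          using pathwise(1-3)[OF p t(2)] by (intro max.boundedI) linarith+
        then have m: "0 \<le> m" "m \<le> V"
          using pathwise(2)[OF p t(2)] unfolding m_def V_def by simp_all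
        have "z (snd p) \<le> m - m\<^sup>2"
        proof (cases "0 \<le> W t (snd p)")
          case True then show ?thesis by (simp add: z_def m_def power_divide)
        next
          case False then show ?thesis by (simp add: z_def m_def)
        qed
        also have "\<dots> \<le> 1 - exp (- m)"
        proof -
          have "1 * 1 \<le> (1 - m + m\<^sup>2) * exp m"
          proof -
            have "0 \<le> m * m * m" using m by simp
            then have "1 \<le> (1 - m + m\<^sup>2) * (1 + m)" by (simp add: algebra_simps power2_eq_square)
            also have "\<dots> \<le> (1 - m + m\<^sup>2) * exp m"
            proof (rule mult_left_mono)
              show "1 + m \<le> exp m" by (rule exp_ge_add_one_self)
              have "0 \<le> (1 - m)\<^sup>2" by simp
              then show "0 \<le> 1 - m + m\<^sup>2" using m by (simp add: power2_diff)
            qed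
            finally show ?thesis by simp
          qed
          then have "exp (- m) \<le> 1 - m + m\<^sup>2" by (simp add: exp_minus field_simps)
          then show ?thesis by linarith
        qed
        also have "\<dots> \<le> 1 - exp (- V)" using m by simp
        finally have "z (snd p) \<le> 1 - exp (- V)" .
        moreover have "f p = exp (- max 0 (snd (fst p)))" using True by (simp add: f_def g0_def h0_def max_def)
        ultimately show ?thesis unfolding eq using True by (simp add: mult_left_mono)
      qed
    qed
    note prod = N.expectation_product[OF int, of z]
    have "p' * ((r * sqrt (2 / pi) + 0) / 4 - t / 4) =
        (\<integral>p. indicator {x. fst x \<le> 0} (fst p) * exp (- max 0 (snd (fst p))) * z (snd p) \<partial>N)"
      using prod(2) z by (simp add: p'_def has_bochner_integral_iff)
    also have "\<dots> \<le> (\<integral>p. f p - exp (- (2 * d * t)) * Yt p \<partial>N)"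
      by (rule integral_mono) (use prod(1) z lower f_int Yt_int in \<open>auto simp: has_bochner_integral_iff\<close>)
    also have "\<dots> = L 1 1 - exp (- (2 * d * t)) * L 1 1"
    proof -
      have "(\<integral>p. Yt p \<partial>N) = L 1 1" unfolding Yt_def by (rule stationarity[OF t(2)])
      then show ?thesis using f_int Yt_int by simp
    qed
    also have "\<dots> = L 1 1 * (1 - exp (- (2 * d * t)))" by (simp add: algebra_simps)
    also have "\<dots> \<le> 1 * (2 * d * t)"
      using L_bounds[of 1 1] exp_ge_add_one_self[of "- (2 * d * t)"] d_pos t
      by (intro mult_mono) auto
    finally show ?thesis by (simp add: t_def mult.commute)
  qed
  have "p' \<le> 0"
  proof (rule ccontr)
    assume "\<not> p' \<le> 0"
    then have pos: "0 < p'" by simp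
    define \<kappa> where "\<kappa> = sqrt (2 / pi) / 4"
    have \<kappa>: "0 < \<kappa>" by (simp add: \<kappa>_def)
    define D where "D = 2 * d + p' / 4"
    \<comment> \<open>At this \<open>r\<close> the quadratic terms amount to half of the linear one.\<close>
    define r where "r = p' * \<kappa> / (2 * D)"
    have den: "0 < D" using d_pos pos by (simp add: D_def)
    have r: "0 < r" unfolding r_def using pos \<kappa> den by simp
    have "r * (p' * \<kappa>) \<le> r * (r * D)"
      using key[OF r] by (simp add: \<kappa>_def[symmetric] D_def algebra_simps power2_eq_square)
    then have "p' * \<kappa> \<le> r * D" using r by simp
    also have "\<dots> = p' * \<kappa> / 2" unfolding r_def using den by simp
    finally show False using pos \<kappa> by simp
  qed
  then have "p' = 0" using p'0 by simp
  then have "AE x in \<pi>. indicator {x. fst x \<le> 0} x * exp (- max 0 (snd x)) = (0 :: real)"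
    unfolding p'_def by (subst (asm) integral_nonneg_eq_0_iff_AE[OF int]) auto
  then have fst: "AE x in \<pi>. 0 < fst x"
    by (rule eventually_mono) (auto simp: indicator_def split: if_splits)
  then have "AE x in distr \<pi> borel prod.swap. 0 < fst x" by (simp only: symmetric)
  then have "AE x in \<pi>. 0 < snd x"
    using swap_measurable by (subst (asm) AE_distr_iff) (auto simp: borel_open open_Collect_less continuous_on_fst)
  with fst show ?thesis by eventually_elim simp
qed

definition push_probability :: "real \<Rightarrow> real" where
  "push_probability t = (\<integral>p. (if 0 < push_g t p \<or> 0 < push_h t p then 1 else 0) \<partial>N)"

lemma push_probability_integrable: "0 \<le> t \<Longrightarrow> integrable N (\<lambda>p. if 0 < push_g t p \<or> 0 < push_h t p then 1 else 0 :: real)"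
  using push_measurable by (intro N.integrable_const_bound[where B = 1]) (auto, measurable)

lemma push_probability_nonneg: "0 \<le> push_probability t"
  unfolding push_probability_def by (rule integral_nonneg_AE) auto

lemma push_probability_le:
  assumes r: "0 < r" "r \<le> 1" and e: "0 < e"
  shows "push_probability (r\<^sup>2) \<le> measure \<pi> {x. fst x < e \<or> snd x < e} + 16 * fourth_moment_const * r ^ 4 / e ^ 4"
proof -
  obtain U where [measurable]: "U \<in> borel_measurable M"
    and U: "\<And>\<omega> s. \<omega> \<in> space M \<Longrightarrow> 0 \<le> s \<Longrightarrow> s \<le> r\<^sup>2 \<Longrightarrow> \<bar>W s \<omega>\<bar> + d * s \<le> U \<omega>"
    and U4: "integrable M (\<lambda>\<omega>. U \<omega> ^ 4)" "(\<integral>\<omega>. U \<omega> ^ 4 \<partial>M) \<le> fourth_moment_const * r ^ 4"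
    using running_bound[OF r] by metis
  let ?B = "{x. fst x < e \<or> snd x < e}"
  have B[measurable]: "?B \<in> sets (borel :: (real \<times> real) measure)"
    by (intro borel_open open_Collect_disj open_Collect_less continuous_intros)
  have int1: "integrable N (\<lambda>p. indicator ?B (fst p) * 1 :: real)"
    "(\<integral>p. indicator ?B (fst p) * 1 \<partial>N) = measure \<pi> ?B"
    using N.expectation_product[of "indicator ?B :: _ \<Rightarrow> real" "\<lambda>_. 1"]
    by (auto simp: sets_\<pi> prob_space \<pi>.emeasure_eq_measure)
  have int2: "integrable N (\<lambda>p. 16 / e ^ 4 * U (snd p) ^ 4)"
    "(\<integral>p. 16 / e ^ 4 * U (snd p) ^ 4 \<partial>N) = 16 / e ^ 4 * (\<integral>\<omega>. U \<omega> ^ 4 \<partial>M)"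
    using noise_functional[of "\<lambda>\<omega>. 16 / e ^ 4 * U \<omega> ^ 4"] U4 by auto
  have "push_probability (r\<^sup>2) \<le> (\<integral>p. indicator ?B (fst p) * 1 + 16 / e ^ 4 * U (snd p) ^ 4 \<partial>N)"
    unfolding push_probability_def
  proof (rule integral_mono)
    fix p assume p: "p \<in> space N"
    have s: "snd p \<in> space M" using p by (auto simp: space_pair_measure)
    note le = push_le(3,4)[OF p _ U[OF s], of "r\<^sup>2"]
    have U0: "0 \<le> 16 / e ^ 4 * U (snd p) ^ 4" by simp
    show "(if 0 < push_g (r\<^sup>2) p \<or> 0 < push_h (r\<^sup>2) p then 1 else 0) \<le> indicator ?B (fst p) * 1 + 16 / e ^ 4 * U (snd p) ^ 4"
    proof (cases "(0 < push_g (r\<^sup>2) p \<or> 0 < push_h (r\<^sup>2) p) \<and> fst p \<notin> ?B")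
      case True
      then have "g0 p < 2 * U (snd p) \<or> h0 p < 2 * U (snd p)" using le by auto
      moreover have "e \<le> g0 p" "e \<le> h0 p" using True by (auto simp: g0_def h0_def)
      ultimately have "e \<le> 2 * U (snd p)" by linarith
      then have "e ^ 4 \<le> (2 * U (snd p)) ^ 4" using e by (intro power_mono) auto
      then have "1 \<le> 16 / e ^ 4 * U (snd p) ^ 4" using e by (simp add: power_mult_distrib)
      then show ?thesis using True by simp
    next
      case False
      then show ?thesis using U0 by (auto simp: indicator_def)
    qed
  qed (use int1 int2 push_probability_integrable in auto)
  also have "\<dots> = measure \<pi> ?B + 16 / e ^ 4 * (\<integral>\<omega>. U \<omega> ^ 4 \<partial>M)"
    using int1 int2 by (subst Bochner_Integration.integral_add) auto
  also have "\<dots> \<le> measure \<pi> ?B + 16 / e ^ 4 * (fourth_moment_const * r ^ 4)"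
    using U4(2) e by (intro add_left_mono mult_left_mono) auto
  finally show ?thesis by simp
qed

lemma small_time: "eventually (\<lambda>r. 0 < r \<and> r \<le> (1 :: real)) (at_right 0)"
  by (rule eventually_at_rightI[of 0 1]) auto

lemma push_probability_tendsto_0: "((\<lambda>r. push_probability (r\<^sup>2)) \<longlongrightarrow> 0) (at_right 0)"
proof (rule tendstoI)
  fix \<eta> :: real assume \<eta>: "0 < \<eta>"
  let ?B = "\<lambda>n. {x :: real \<times> real. fst x < 1 / real (Suc n) \<or> snd x < 1 / real (Suc n)}"
  have B[measurable]: "?B n \<in> sets (borel :: (real \<times> real) measure)" for n
    by (intro borel_open open_Collect_disj open_Collect_less continuous_intros)
  have "(\<lambda>n. LINT x|\<pi>. indicator (?B n) x) \<longlonglongrightarrow> (LINT x|\<pi>. (0 :: real))"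
  proof (rule integral_dominated_convergence[where w = "\<lambda>_. 1"])
    show "AE x in \<pi>. (\<lambda>n. indicator (?B n) x :: real) \<longlonglongrightarrow> 0"
      using boundary_null
    proof eventually_elim
      case (elim x)
      have "(\<lambda>n. 1 / real (Suc n)) \<longlonglongrightarrow> 0" using LIMSEQ_inverse_real_of_nat by (simp add: inverse_eq_divide)
      then have "eventually (\<lambda>n. 1 / real (Suc n) < min (fst x) (snd x)) sequentially"
        by (rule order_tendstoD(2)) (use elim in auto)
      then have "eventually (\<lambda>n. indicator (?B n) x = (0::real)) sequentially"
        by (rule eventually_mono) (auto simp: indicator_def)
      then show ?case by (rule tendsto_eventually)
    qed
  qed (auto simp: indicator_def)
  then have "(\<lambda>n. measure \<pi> (?B n)) \<longlonglongrightarrow> 0" by (simp add: sets_\<pi>)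
  then have "eventually (\<lambda>n. measure \<pi> (?B n) < \<eta>) sequentially"
    using \<eta> by (rule order_tendstoD(2))
  then obtain n where n: "measure \<pi> (?B n) < \<eta>" by (auto simp: eventually_sequentially)
  define e where "e = 1 / real (Suc n)"
  have e: "0 < e" by (simp add: e_def)
  have "((\<lambda>r. measure \<pi> (?B n) + 16 * fourth_moment_const * r ^ 4 / e ^ 4) \<longlongrightarrow>
      measure \<pi> (?B n) + 16 * fourth_moment_const * 0 ^ 4 / e ^ 4) (at_right 0)"
    using e by (intro tendsto_intros) auto
  then have "eventually (\<lambda>r. measure \<pi> (?B n) + 16 * fourth_moment_const * r ^ 4 / e ^ 4 < \<eta>) (at_right 0)"
    by (rule order_tendstoD(2)) (use n in simp)
  then show "eventually (\<lambda>r. dist (push_probability (r\<^sup>2)) 0 < \<eta>) (at_right 0)"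
    using small_time
  proof eventually_elim
    case (elim r)
    then show ?case using push_probability_le[of r e] push_probability_nonneg[of "r\<^sup>2"] e by (simp add: e_def)
  qed
qed


section \<open>The basic adjoint relation\<close>

text \<open>The difference of the two sides of the basic adjoint relation, with the boundary rates replaced by their averages
over \<open>[0, r\<^sup>2]\<close>. By symmetry the same function serves for both axes.\<close>

definition adjoint_defect :: "real \<Rightarrow> real \<Rightarrow> real \<Rightarrow> real" where
  "adjoint_defect a1 a2 r = ((a1 + a2) * d + (a1 - a2)\<^sup>2 / 2) * L a1 a2
     - (a1 - a2 / 2) * (boundary_push (r\<^sup>2) a2 / r\<^sup>2) - (a2 - a1 / 2) * (boundary_push (r\<^sup>2) a1 / r\<^sup>2)"

lemma adjoint_defect_le:
  assumes nn: "0 \<le> a1" "0 \<le> a2" and r: "0 < r" "r \<le> 1" and k: "0 < k"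
  defines "s \<equiv> a1 + a2"
  shows "\<bar>adjoint_defect a1 a2 r\<bar> \<le> (36 * s ^ 3 + 22 * s\<^sup>2 + 4 * s\<^sup>2 * d) *
     (r * (1 + fourth_moment_const) + k * push_probability (r\<^sup>2) + fourth_moment_const / k)"
proof -
  define t where "t = r\<^sup>2"
  define C where "C = 36 * s ^ 3 + 22 * s\<^sup>2 + 4 * s\<^sup>2 * d"
  have t: "0 < t" "0 \<le> t" using r by (auto simp: t_def)
  obtain U where [measurable]: "U \<in> borel_measurable M"
    and U: "\<And>\<omega> s. \<omega> \<in> space M \<Longrightarrow> 0 \<le> s \<Longrightarrow> s \<le> t \<Longrightarrow> \<bar>W s \<omega>\<bar> + d * s \<le> U \<omega>"
    and U4: "integrable M (\<lambda>\<omega>. U \<omega> ^ 4)" "(\<integral>\<omega>. U \<omega> ^ 4 \<partial>M) \<le> fourth_moment_const * r ^ 4"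
    using running_bound[OF r] unfolding t_def by metis
  note [measurable] = push_measurable[OF t(2)] W_measurable[OF t(2)]
  define Y where "Y p = exp (- a1 * (g0 p - d * t - W t (snd p) - push_h t p / 2 + push_g t p)
      - a2 * (h0 p - d * t + W t (snd p) - push_g t p / 2 + push_h t p))" for p
  define b where "b p = (if 0 < push_g t p \<or> 0 < push_h t p then 1 else 0 :: real)" for p
  define F where "F p = exp (- a1 * g0 p - a2 * h0 p) * (1 + s * d * t + (a1 - a2) * W t (snd p) + (a1 - a2)\<^sup>2 * (W t (snd p))\<^sup>2 / 2)" for p
  define P where "P p = (a1 - a2 / 2) * (exp (- a2 * h0 p) * push_g t p) + (a2 - a1 / 2) * (exp (- a1 * g0 p) * push_h t p)" for p
  define Z where "Z p = r ^ 3 + k * r\<^sup>2 * b p + (1 / r + 1 / (k * r\<^sup>2)) * U (snd p) ^ 4" for p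
  have Y_meas[measurable]: "Y \<in> borel_measurable N" unfolding Y_def by measurable
  have Y: "integrable N Y" "(\<integral>p. Y p \<partial>N) = L a1 a2"
  proof -
    show "integrable N Y"
    proof (rule N.integrable_const_bound[where B = 1])
      show "AE p in N. norm (Y p) \<le> 1"
        unfolding Y_def real_norm_def abs_exp_cancel
        by (rule AE_I2) (rule exp_le_1[OF nn(1) pathwise(5)[OF _ t(2)] nn(2) pathwise(6)[OF _ t(2)]])
    qed measurable
    show "(\<integral>p. Y p \<partial>N) = L a1 a2" unfolding Y_def by (rule stationarity[OF t(2)])
  qed
  have "has_bochner_integral M (\<lambda>\<omega>. (1 + s * d * t) + (a1 - a2) * W t \<omega> + (a1 - a2)\<^sup>2 * (W t \<omega>)\<^sup>2 / 2)
      ((1 + s * d * t) + (a1 - a2) * 0 + (a1 - a2)\<^sup>2 * t / 2)"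
    using W_moments[OF t(1)]
    by (intro has_bochner_integral_add has_bochner_integral_divide_zero has_bochner_integral_mult_right)
       (auto simp: has_bochner_integral_iff prob_space)
  note F0 = start_functional[OF nn this]
  have F: "integrable N F" "(\<integral>p. F p \<partial>N) = L a1 a2 * (1 + s * d * t + (a1 - a2)\<^sup>2 * t / 2)"
    using F0 unfolding F_def[abs_def] by simp_all
  have P: "integrable N P" "(\<integral>p. P p \<partial>N) = (a1 - a2 / 2) * boundary_push t a2 + (a2 - a1 / 2) * boundary_push t a1"
  proof -
    note i = push_integrable(1)[OF t(1) nn(2)] push_integrable(2)[OF t(1) nn(1)]
    show "integrable N P" unfolding P_def using i by (intro Bochner_Integration.integrable_add integrable_mult_right)
    show "(\<integral>p. P p \<partial>N) = (a1 - a2 / 2) * boundary_push t a2 + (a2 - a1 / 2) * boundary_push t a1"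
      unfolding P_def boundary_push_swap[OF t(1) nn(1)] boundary_push_def[of t a2] using i by simp
  qed
  have b: "integrable N b" "(\<integral>p. b p \<partial>N) = push_probability t"
    using push_probability_integrable[OF t(2)] unfolding b_def[abs_def] push_probability_def by simp_all
  have U_N: "integrable N (\<lambda>p. U (snd p) ^ 4)" "(\<integral>p. U (snd p) ^ 4 \<partial>N) = (\<integral>\<omega>. U \<omega> ^ 4 \<partial>M)"
    using noise_functional[OF U4(1)] by simp_all
  have Z: "integrable N Z" "(\<integral>p. Z p \<partial>N) = r ^ 3 + k * r\<^sup>2 * push_probability t + (1 / r + 1 / (k * r\<^sup>2)) * (\<integral>\<omega>. U \<omega> ^ 4 \<partial>M)"
    using b U_N unfolding Z_def[abs_def] by (simp_all add: N.prob_space)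
  have s0: "0 \<le> s" "0 \<le> C" using nn d_pos by (auto simp: s_def C_def)
  have pt: "\<bar>Y p - F p + P p\<bar> \<le> C * Z p" if p: "p \<in> space N" for p
  proof -
    have sp: "snd p \<in> space M" using p by (auto simp: space_pair_measure)
    let ?u = "U (snd p)"
    have u: "\<bar>W t (snd p)\<bar> + d * t \<le> ?u" using U[OF sp, of t] t by simp
    have "0 \<le> d * t" using d_pos t by simp
    then have u0: "0 \<le> ?u" using u by linarith
    have b01: "0 \<le> b p" "b p \<le> 1" by (auto simp: b_def)
    note I = moment_interpolation[OF u0 r(1) k b01]
    have "\<bar>Y p - F p + P p\<bar> \<le> 36 * s ^ 3 * ?u ^ 3 + 22 * s\<^sup>2 * (?u\<^sup>2 * b p) + 4 * s\<^sup>2 * d * (t * ?u)"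
      using adjoint_relation_pointwise[OF nn start_nonneg[of p] pathwise(1,2)[OF p t(2)] d_pos t(2) pathwise(5,6)[OF p t(2)] u
          push_le[OF p t(2) U[OF sp]]]
      unfolding Y_def F_def P_def b_def s_def by (simp add: add.assoc)
    also have "\<dots> \<le> 36 * s ^ 3 * Z p + 22 * s\<^sup>2 * Z p + 4 * s\<^sup>2 * d * Z p"
    proof -
      have pos: "0 \<le> r ^ 3" "0 \<le> k * r\<^sup>2 * b p" "0 \<le> ?u ^ 4 / r" "0 \<le> ?u ^ 4 / (k * r\<^sup>2)" using r k b01 by auto
      have "Z p = r ^ 3 + k * r\<^sup>2 * b p + ?u ^ 4 / r + ?u ^ 4 / (k * r\<^sup>2)" by (simp add: Z_def distrib_right)
      then have "?u ^ 3 \<le> Z p" "?u\<^sup>2 * b p \<le> Z p" "t * ?u \<le> Z p" using I pos unfolding t_def by linarith+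
      then show ?thesis using s0 d_pos by (intro add_mono mult_left_mono) auto
    qed
    also have "\<dots> = C * Z p" by (simp add: C_def algebra_simps)
    finally show ?thesis .
  qed
  have "\<bar>\<integral>p. Y p - F p + P p \<partial>N\<bar> \<le> (\<integral>p. \<bar>Y p - F p + P p\<bar> \<partial>N)" by (rule integral_abs_bound)
  also have "\<dots> \<le> (\<integral>p. C * Z p \<partial>N)"
    by (rule integral_mono) (use Y F P Z pt in auto)
  also have "\<dots> = C * (r ^ 3 + k * r\<^sup>2 * push_probability t + (1 / r + 1 / (k * r\<^sup>2)) * (\<integral>\<omega>. U \<omega> ^ 4 \<partial>M))"
    using Z by simp
  also have "\<dots> \<le> C * (r ^ 3 + k * r\<^sup>2 * push_probability t + (1 / r + 1 / (k * r\<^sup>2)) * (fourth_moment_const * r ^ 4))"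
    using s0 r k U4(2) by (intro mult_left_mono add_left_mono) auto
  also have "\<dots> = r\<^sup>2 * (C * (r * (1 + fourth_moment_const) + k * push_probability t + fourth_moment_const / k))"
    using r k by (simp add: field_simps eval_nat_numeral)
  also have "(\<integral>p. Y p - F p + P p \<partial>N) = - r\<^sup>2 * adjoint_defect a1 a2 r"
  proof -
    have "(\<integral>p. Y p - F p + P p \<partial>N) = (\<integral>p. Y p \<partial>N) - (\<integral>p. F p \<partial>N) + (\<integral>p. P p \<partial>N)"
      using Y(1) F(1) P(1) by simp
    also have "\<dots> = - r\<^sup>2 * adjoint_defect a1 a2 r"
      unfolding Y(2) F(2) P(2) adjoint_defect_def t_def s_def using r by (simp add: field_simps)
    finally show ?thesis .
  qed
  finally have "r\<^sup>2 * \<bar>adjoint_defect a1 a2 r\<bar> \<le> r\<^sup>2 * (C * (r * (1 + fourth_moment_const) + k * push_probability t + fourth_moment_const / k))"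
    by (simp add: abs_mult)
  then show ?thesis using r unfolding C_def t_def by simp
qed

text \<open>As \<open>r\<close> tends to \<open>0\<close> only the term with \<open>1 / k\<close> survives in \<open>adjoint_defect_le\<close>, and \<open>k\<close> is arbitrary.\<close>

lemma adjoint_defect_tendsto_0:
  assumes nn: "0 \<le> a1" "0 \<le> a2"
  shows "(adjoint_defect a1 a2 \<longlongrightarrow> 0) (at_right 0)"
proof (rule tendstoI)
  fix \<eta> :: real assume \<eta>: "0 < \<eta>"
  define C where "C = 36 * (a1 + a2) ^ 3 + 22 * (a1 + a2)\<^sup>2 + 4 * (a1 + a2)\<^sup>2 * d"
  let ?K = fourth_moment_const
  have C: "0 \<le> C" using nn d_pos by (simp add: C_def)
  have K: "0 < ?K" using d_pos by (simp add: fourth_moment_const_def add_pos_nonneg)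
  \<comment> \<open>The summand \<open>1\<close> makes \<open>C * ?K / k\<close> strictly smaller than \<open>\<eta>\<close>.\<close>
  define k where "k = C * ?K / \<eta> + 1"
  have k: "0 < k" using C K \<eta> by (simp add: k_def add_nonneg_pos)
  have "C * ?K < \<eta> * k" using \<eta> by (simp add: k_def field_simps)
  then have Ck: "C * (?K / k) < \<eta>" using k by (simp add: field_simps)
  have "((\<lambda>r. C * (r * (1 + ?K) + k * push_probability (r\<^sup>2) + ?K / k)) \<longlongrightarrow> C * (0 * (1 + ?K) + k * 0 + ?K / k)) (at_right 0)"
    by (intro tendsto_intros push_probability_tendsto_0)
  then have "eventually (\<lambda>r. C * (r * (1 + ?K) + k * push_probability (r\<^sup>2) + ?K / k) < \<eta>) (at_right 0)"
    by (rule order_tendstoD(2)) (use Ck in simp)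
  then show "eventually (\<lambda>r. dist (adjoint_defect a1 a2 r) 0 < \<eta>) (at_right 0)"
    using small_time
  proof eventually_elim
    case (elim r)
    then show ?case using adjoint_defect_le[OF nn _ _ k, of r] unfolding C_def by simp
  qed
qed

lemma boundary_push_rate_pos:
  assumes b: "0 < b"
  shows "((\<lambda>r. boundary_push (r\<^sup>2) b / r\<^sup>2) \<longlongrightarrow> 2 * d * L b b) (at_right 0)"
proof -
  have "((\<lambda>r. 2 * d * L b b - adjoint_defect b b r / b) \<longlongrightarrow> 2 * d * L b b - 0 / b) (at_right 0)"
    using b by (intro tendsto_intros adjoint_defect_tendsto_0) auto
  moreover have "2 * d * L b b - adjoint_defect b b r / b = boundary_push (r\<^sup>2) b / r\<^sup>2" for r
    using b by (simp add: adjoint_defect_def field_simps)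
  ultimately show ?thesis by simp
qed

lemma L_tendsto:
  assumes c: "0 \<le> c"
  shows "(\<lambda>n. L (1 / real (Suc n)) (c / real (Suc n))) \<longlonglongrightarrow> 1"
proof -
  have "(\<lambda>n. LINT x|\<pi>. exp (- (1 / real (Suc n)) * max 0 (fst x) - (c / real (Suc n)) * max 0 (snd x)))
     \<longlonglongrightarrow> (LINT x|\<pi>. exp (- 0 * max 0 (fst x) - (c * 0) * max 0 (snd x)))"
  proof (rule integral_dominated_convergence[where w = "\<lambda>_. 1"])
    have lim: "(\<lambda>n. 1 / real (Suc n)) \<longlonglongrightarrow> 0" using LIMSEQ_inverse_real_of_nat by (simp add: inverse_eq_divide)
    have lim': "(\<lambda>n. c / real (Suc n)) \<longlonglongrightarrow> c * 0" using tendsto_mult_left[OF lim, of c] by simp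
    show "AE x in \<pi>. (\<lambda>n. exp (- (1 / real (Suc n)) * max 0 (fst x) - (c / real (Suc n)) * max 0 (snd x)))
       \<longlonglongrightarrow> exp (- 0 * max 0 (fst x) - (c * 0) * max 0 (snd x))"
      by (intro AE_I2 tendsto_exp tendsto_diff tendsto_mult tendsto_minus tendsto_const lim lim')
    show "AE x in \<pi>. norm (exp (- (1 / real (Suc n)) * max 0 (fst x) - (c / real (Suc n)) * max 0 (snd x))) \<le> 1" for n
      unfolding real_norm_def abs_exp_cancel by (intro AE_I2 exp_le_1) (use c in auto)
  qed auto
  then show ?thesis by (simp add: L_def \<pi>.prob_space)
qed

text \<open>The diagonal relation is void at \<open>b = 0\<close>. The relation at \<open>(b, 0)\<close> shows that the limit exists and equals \<open>l b\<close> for every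
\<open>b > 0\<close>; hence \<open>l\<close> is constant, and its value is found by letting \<open>b\<close> tend to \<open>0\<close>.\<close>

lemma boundary_push_rate_0: "((\<lambda>r. boundary_push (r\<^sup>2) 0 / r\<^sup>2) \<longlongrightarrow> 2 * d) (at_right 0)"
proof -
  define l where "l b = (d + b / 2) * L b 0 + d * L b b" for b
  have lim: "((\<lambda>r. boundary_push (r\<^sup>2) 0 / r\<^sup>2) \<longlongrightarrow> l b) (at_right 0)" if b: "0 < b" for b
  proof -
    have "((\<lambda>r. (d + b / 2) * L b 0 - adjoint_defect b 0 r / b + (boundary_push (r\<^sup>2) b / r\<^sup>2) / 2) \<longlongrightarrow>
        (d + b / 2) * L b 0 - 0 / b + (2 * d * L b b) / 2) (at_right 0)"
      using b by (intro tendsto_intros adjoint_defect_tendsto_0 boundary_push_rate_pos) auto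
    moreover have "(d + b / 2) * L b 0 - adjoint_defect b 0 r / b + (boundary_push (r\<^sup>2) b / r\<^sup>2) / 2 = boundary_push (r\<^sup>2) 0 / r\<^sup>2" for r
      using b by (simp add: adjoint_defect_def diff_divide_distrib add_divide_distrib distrib_right power2_eq_square)
    ultimately show ?thesis by (simp add: l_def)
  qed
  have const: "l b = l 1" if "0 < b" for b
    using tendsto_unique[OF _ lim[OF that] lim[of 1]] by simp
  have lim1: "(\<lambda>n. 1 / real (Suc n)) \<longlonglongrightarrow> 0" using LIMSEQ_inverse_real_of_nat by (simp add: inverse_eq_divide)
  have "(\<lambda>n. (d + (1 / real (Suc n)) / 2) * L (1 / real (Suc n)) (0 / real (Suc n)) + d * L (1 / real (Suc n)) (1 / real (Suc n)))
      \<longlonglongrightarrow> (d + 0 / 2) * 1 + d * 1"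
    by (intro tendsto_intros lim1 L_tendsto) auto
  then have "(\<lambda>n. l (1 / real (Suc n))) \<longlonglongrightarrow> 2 * d" by (simp add: l_def)
  moreover have "l (1 / real (Suc n)) = l 1" for n by (rule const) simp
  ultimately have "l 1 = 2 * d" by (simp add: LIMSEQ_const_iff)
  then show ?thesis using lim[of 1] by simp
qed

lemma L_formula:
  assumes nn: "0 \<le> a1" "0 \<le> a2"
  shows "((a1 - a2)\<^sup>2 + 2 * d * (a1 + a2)) * L a1 a2 =
    2 * d * ((2 * a1 - a2) * L a2 a2 + (2 * a2 - a1) * L a1 a1)"
proof -
  have L00: "L 0 0 = 1" by (simp add: L_def \<pi>.prob_space)
  have al: "((\<lambda>r. boundary_push (r\<^sup>2) b / r\<^sup>2) \<longlongrightarrow> 2 * d * L b b) (at_right 0)" if "0 \<le> b" for b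
    using that boundary_push_rate_pos[of b] boundary_push_rate_0 L00 by (cases "b = 0") auto
  have "(adjoint_defect a1 a2 \<longlongrightarrow> ((a1 + a2) * d + (a1 - a2)\<^sup>2 / 2) * L a1 a2
     - (a1 - a2 / 2) * (2 * d * L a2 a2) - (a2 - a1 / 2) * (2 * d * L a1 a1)) (at_right 0)"
    unfolding adjoint_defect_def[abs_def] by (intro tendsto_intros al nn)
  from tendsto_unique[OF _ this adjoint_defect_tendsto_0[OF nn]]
  have "((a1 + a2) * d + (a1 - a2)\<^sup>2 / 2) * L a1 a2
     - (a1 - a2 / 2) * (2 * d * L a2 a2) - (a2 - a1 / 2) * (2 * d * L a1 a1) = 0" by simp
  then show ?thesis by (simp add: algebra_simps)
qed

lemma laplace2_eq_L:
  shows "emeasure \<pi> ({0<..} \<times> {0<..}) = 1"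
    and "laplace2 \<pi> a1 a2 = L a1 a2"
proof -
  note [measurable] = quadrant_sets(2)
  show "emeasure \<pi> ({0<..} \<times> {0<..}) = 1"
  proof (rule \<pi>.emeasure_eq_1_AE)
    show "AE x in \<pi>. x \<in> {0<..} \<times> {0<..}"
      using boundary_null by eventually_elim (simp add: mem_Times_iff)
  qed measurable
  show "laplace2 \<pi> a1 a2 = L a1 a2"
    unfolding laplace2_def L_def set_lebesgue_integral_def
  proof (rule integral_cong_AE)
    show "AE x in \<pi>. indicator ({0<..} \<times> {0<..}) x *\<^sub>R exp (- a1 * fst x - a2 * snd x) =
        exp (- a1 * max 0 (fst x) - a2 * max 0 (snd x))"
      using boundary_null by eventually_elim (simp add: indicator_def mem_Times_iff)
  qed measurable
qed

end


section \<open>The Laplace transform of the steady state and the law of the sum\<close>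

lemma steady_state_laplace:
  assumes W: "standard_brownian_motion M W"
    and \<delta>: "\<delta>2 - \<delta>1 = lam / 2" "\<delta>3 - \<delta>2 = lam / 2" "lam / 2 > 0"
    and ss: "gap_steady_state M W \<delta>1 \<delta>2 \<delta>3 \<pi>"
  shows "prob_space \<pi>" "sets \<pi> = sets borel" "emeasure \<pi> ({0<..} \<times> {0<..}) = 1"
    and "0 \<le> a1 \<Longrightarrow> 0 \<le> a2 \<Longrightarrow> ((a1 - a2)\<^sup>2 + lam * (a1 + a2)) * laplace2 \<pi> a1 a2 =
      lam * ((2 * a1 - a2) * laplace2 \<pi> a2 a2 + (2 * a2 - a1) * laplace2 \<pi> a1 a1)"
proof -
  obtain X where X: "\<And>x. x \<in> {0..} \<times> {0..} \<Longrightarrow> gap_process M W \<delta>1 \<delta>2 \<delta>3 x (X x)"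
    and inv: "invariant_probability (transition_kernel M X) \<pi>"
    and uniq: "\<And>\<nu>. invariant_probability (transition_kernel M X) \<nu> \<Longrightarrow> \<nu> = \<pi>"
    using ss unfolding gap_steady_state_def unique_invariant_probability_def by blast
  define ok where "ok x A \<Gamma> \<longleftrightarrow> gap_regulators M W \<delta>1 \<delta>2 \<delta>3 x A \<Gamma> \<and>
       (\<forall>\<omega>\<in>space M. \<forall>t\<ge>0. X x t \<omega> =
          (fst x - (\<delta>2 - \<delta>1) * t - W t \<omega> - \<Gamma> t \<omega> / 2 + A t \<omega>,
           snd x - (\<delta>3 - \<delta>2) * t + W t \<omega> - A t \<omega> / 2 + \<Gamma> t \<omega>))" for x A \<Gamma>
  have ex: "\<exists>A \<Gamma>. ok x A \<Gamma>" if "x \<in> {0..} \<times> {0..}" for x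
    using X[OF that] unfolding gap_process_def ok_def by (cases x) simp
  define A where "A x = (SOME A. \<exists>\<Gamma>. ok x A \<Gamma>)" for x
  define \<Gamma> where "\<Gamma> x = (SOME \<Gamma>. ok x (A x) \<Gamma>)" for x
  have ok: "ok x (A x) (\<Gamma> x)" if "x \<in> {0..} \<times> {0..}" for x
  proof -
    have "\<exists>\<Gamma>. ok x (A x) \<Gamma>" unfolding A_def by (rule someI_ex[OF ex[OF that]])
    then show ?thesis unfolding \<Gamma>_def by (rule someI_ex)
  qed
  interpret brownian M W
  proof -
    interpret prob_space M using W by (simp add: standard_brownian_motion_def)
    show "brownian M W" by unfold_locales (rule W)
  qed
  interpret reflected_gaps M W "lam / 2" A \<Gamma>
  proof
    show "0 < lam / 2" by (rule \<delta>(3))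
    fix g h :: real and \<omega> assume gh: "0 \<le> g" "0 \<le> h" and \<omega>: "\<omega> \<in> space M"
    then have "ok (g, h) (A (g, h)) (\<Gamma> (g, h))" by (intro ok) simp
    then have gr: "gap_regulators M W \<delta>1 \<delta>2 \<delta>3 (g, h) (A (g, h)) (\<Gamma> (g, h))" unfolding ok_def by (rule conjunct1)
    have reg: "regulator M W (A (g, h))" "regulator M W (\<Gamma> (g, h))"
      using conjunct1[OF gr[unfolded gap_regulators_def prod.case]]
        conjunct1[OF conjunct2[OF gr[unfolded gap_regulators_def prod.case]]] .
    have eqs: "\<forall>t\<ge>0. A (g, h) t \<omega> = (SUP s\<in>{0..t}. max 0 (- g + lam / 2 * s + W s \<omega> + \<Gamma> (g, h) s \<omega> / 2)) \<and>
        \<Gamma> (g, h) t \<omega> = (SUP s\<in>{0..t}. max 0 (- h + lam / 2 * s - W s \<omega> + A (g, h) s \<omega> / 2))"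
      using conjunct2[OF conjunct2[OF gr[unfolded gap_regulators_def prod.case \<delta>(1,2)]]] \<omega> by (rule bspec)
    have "A (g, h) 0 \<omega> = 0 \<and> continuous_on {0..} (\<lambda>t. A (g, h) t \<omega>) \<and> mono_on {0..} (\<lambda>t. A (g, h) t \<omega>)"
      "\<Gamma> (g, h) 0 \<omega> = 0 \<and> continuous_on {0..} (\<lambda>t. \<Gamma> (g, h) t \<omega>) \<and> mono_on {0..} (\<lambda>t. \<Gamma> (g, h) t \<omega>)"
      using reg \<omega> unfolding regulator_def by blast+
    with eqs show "reflected (\<lambda>s. - g + lam / 2 * s + W s \<omega>) (\<lambda>s. - h + lam / 2 * s - W s \<omega>)
        (\<lambda>s. A (g, h) s \<omega>) (\<lambda>s. \<Gamma> (g, h) s \<omega>)"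
      unfolding reflected_def by (intro conjI) (elim conjE, assumption)+
  qed
  have kernel: "transition_kernel M X t x = distr M borel (gaps t x)" if "0 \<le> t" "x \<in> {0..} \<times> {0..}" for t x
    unfolding transition_kernel_def
  proof (rule distr_cong)
    fix \<omega> assume "\<omega> \<in> space M"
    with ok[OF that(2)] that(1) show "X x t \<omega> = gaps t x \<omega>" unfolding ok_def gaps_def \<delta>(1,2) by blast
  qed simp_all
  have inv': "(\<integral>\<^sup>+x\<in>{0..} \<times> {0..}. emeasure (distr M borel (gaps t x)) B \<partial>\<pi>) = emeasure \<pi> B"
    if t: "0 \<le> t" and B: "B \<in> sets borel" for t B
  proof -
    have "(\<integral>\<^sup>+x\<in>{0..} \<times> {0..}. emeasure (distr M borel (gaps t x)) B \<partial>\<pi>) =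
        (\<integral>\<^sup>+x\<in>{0..} \<times> {0..}. emeasure (transition_kernel M X t x) B \<partial>\<pi>)"
      using kernel[OF t] by (intro nn_integral_cong) (auto simp: indicator_def)
    then show ?thesis using inv t B by (simp add: invariant_probability_def)
  qed
  interpret stationary_gaps M W "lam / 2" A \<Gamma> \<pi>
  proof (intro stationary_gaps.intro stationary_gaps_axioms.intro)
    show "reflected_gaps M W (lam / 2) A \<Gamma>" by (rule reflected_gaps_axioms)
    show "prob_space \<pi>" "sets \<pi> = sets borel" "emeasure \<pi> ({0..} \<times> {0..}) = 1"
      using inv by (auto simp: invariant_probability_def)
    show "distr \<pi> borel prod.swap = \<pi>"
      by (rule uniq) (rule invariant_swap[OF kernel inv])
  qed (rule inv')
  show "prob_space \<pi>" "sets \<pi> = sets borel" by (rule prob_\<pi> sets_\<pi>)+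
  show "emeasure \<pi> ({0<..} \<times> {0<..}) = 1" by (rule laplace2_eq_L)
  show "((a1 - a2)\<^sup>2 + lam * (a1 + a2)) * laplace2 \<pi> a1 a2 =
      lam * ((2 * a1 - a2) * laplace2 \<pi> a2 a2 + (2 * a2 - a1) * laplace2 \<pi> a1 a1)" if "0 \<le> a1" "0 \<le> a2"
    using L_formula[OF that] by (simp add: laplace2_eq_L)
qed


lemma open_quadrant_AE:
  assumes "prob_space \<mu>" "sets \<mu> = sets borel" "emeasure \<mu> ({0<..} \<times> {0<..}) = 1"
  shows "AE x in \<mu>. (0::real) < fst x \<and> (0::real) < snd x"
proof -
  interpret prob_space \<mu> by fact
  have "AE x in \<mu>. x \<in> {0<..} \<times> {0<..}"
    using assms quadrant_sets(2) by (subst AE_in_set_eq_1) (auto simp: emeasure_eq_measure)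
  then show ?thesis by eventually_elim (simp add: mem_Times_iff)
qed

lemma laplace2_eq_integral:
  assumes "prob_space \<mu>" "sets \<mu> = sets borel" "emeasure \<mu> ({0<..} \<times> {0<..}) = 1"
  shows "laplace2 \<mu> a b = (LINT x|\<mu>. exp (- a * fst x - b * snd x))"
proof -
  have [measurable_cong]: "sets \<mu> = sets borel" by fact
  note [measurable] = quadrant_sets(2)
  show ?thesis
    unfolding laplace2_def set_lebesgue_integral_def
  proof (rule integral_cong_AE)
    show "AE x in \<mu>. indicator ({0<..} \<times> {0<..}) x *\<^sub>R exp (- a * fst x - b * snd x) = exp (- a * fst x - b * snd x)"
      using open_quadrant_AE[OF assms] by eventually_elim (simp add: indicator_def mem_Times_iff)
  qed measurable
qed

lemma laplace2_diagonal:
  assumes "prob_space \<mu>" "sets \<mu> = sets borel" "emeasure \<mu> ({0<..} \<times> {0<..}) = 1"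
  shows "laplace2 \<mu> a a = (LINT s|sum_distribution \<mu>. exp (- a * s))"
proof -
  have [measurable_cong]: "sets \<mu> = sets borel" by fact
  have "(LINT s|sum_distribution \<mu>. exp (- a * s)) = (LINT x|\<mu>. exp (- a * (fst x + snd x)))"
    unfolding sum_distribution_def by (rule integral_distr) measurable
  then show ?thesis unfolding laplace2_eq_integral[OF assms] by (simp add: algebra_simps)
qed

text \<open>The function \<open>F\<close> abstracts the right-hand side of the formula: all that matters is that the transform is a function of its
diagonal values away from the origin, where every transform equals \<open>1\<close>.\<close>

lemma formula_determines_measure:
  assumes \<mu>: "prob_space \<mu>" "sets \<mu> = sets borel" "emeasure \<mu> ({0<..} \<times> {0<..}) = 1"
    and \<nu>: "prob_space \<nu>" "sets \<nu> = sets borel" "emeasure \<nu> ({0<..} \<times> {0<..}) = 1"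
    and sum: "sum_distribution \<mu> = sum_distribution \<nu>"
    and f: "\<And>a b. 0 \<le> a \<Longrightarrow> 0 \<le> b \<Longrightarrow> (a, b) \<noteq> (0, 0) \<Longrightarrow> laplace2 \<mu> a b = F a b (laplace2 \<mu> a a) (laplace2 \<mu> b b)"
      "\<And>a b. 0 \<le> a \<Longrightarrow> 0 \<le> b \<Longrightarrow> (a, b) \<noteq> (0, 0) \<Longrightarrow> laplace2 \<nu> a b = F a b (laplace2 \<nu> a a) (laplace2 \<nu> b b)"
  shows "\<mu> = \<nu>"
proof (rule laplace_determines_measure)
  have diag: "laplace2 \<mu> a a = laplace2 \<nu> a a" for a
    by (simp add: laplace2_diagonal[OF \<mu>] laplace2_diagonal[OF \<nu>] sum)
  fix a b :: real assume "0 \<le> a" "0 \<le> b"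
  then have "laplace2 \<mu> a b = laplace2 \<nu> a b"
    using f[of a b] diag by (cases "(a, b) = (0, 0)") auto
  then show "(LINT x|\<mu>. exp (- a * fst x - b * snd x)) = (LINT x|\<nu>. exp (- a * fst x - b * snd x))"
    by (simp only: laplace2_eq_integral[OF \<mu>] laplace2_eq_integral[OF \<nu>])
next
  show "AE x in \<mu>. x \<in> {0..} \<times> {0..}"
    using open_quadrant_AE[OF \<mu>] by eventually_elim (simp add: mem_Times_iff)
  show "AE x in \<nu>. x \<in> {0..} \<times> {0..}"
    using open_quadrant_AE[OF \<nu>] by eventually_elim (simp add: mem_Times_iff)
qed (rule assms)+


text \<open>Let \<open>q a x = (1 - exp (- a * x)) / a\<close>, which tends to \<open>x\<close> as \<open>a\<close> tends to \<open>0\<close>. The formula at \<open>(a, 0)\<close> states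
\<open>(a + lam) * E (q a G) = 1 - lam * E (q a (G + H))\<close>, and the same for \<open>H\<close>. Since the left-hand side is nonnegative,
\<open>E (q a (G + H))\<close> is at most \<open>1 / lam\<close>, so the sum is integrable by Fatou's lemma. In the limit
\<open>lam * E G = 1 - lam * m = lam * E H\<close> with \<open>m = E G + E H\<close>, and adding up gives \<open>lam * m = 2 - 2 * lam * m\<close>.\<close>

lemma mean_of_sum:
  assumes \<pi>: "prob_space \<pi>" "sets \<pi> = sets borel" "emeasure \<pi> ({0<..} \<times> {0<..}) = 1"
    and lam: "0 < lam"
    and f: "\<And>a1 a2. 0 \<le> a1 \<Longrightarrow> 0 \<le> a2 \<Longrightarrow> ((a1 - a2)\<^sup>2 + lam * (a1 + a2)) * laplace2 \<pi> a1 a2 =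
      lam * ((2 * a1 - a2) * laplace2 \<pi> a2 a2 + (2 * a2 - a1) * laplace2 \<pi> a1 a1)"
  shows "(LINT s|sum_distribution \<pi>. s) = 2 / (3 * lam)"
proof -
  interpret prob_space \<pi> by fact
  have [measurable_cong]: "sets \<pi> = sets borel" by fact
  define e where "e n = 1 / real (Suc n)" for n
  have e: "0 < e n" for n by (simp add: e_def)
  have e_lim: "e \<longlonglongrightarrow> 0" unfolding e_def[abs_def] using LIMSEQ_inverse_real_of_nat by (simp add: inverse_eq_divide)
  define q where "q a x = (1 - exp (- a * x)) / a" for a x :: real
  have q_bounds: "0 \<le> q a x" "q a x \<le> x" if "0 < a" "0 \<le> x" for a x
    using that exp_ge_add_one_self[of "- a * x"] by (auto simp: q_def field_simps)
  have q_lim: "(\<lambda>n. q (e n) x) \<longlonglongrightarrow> x" for x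
  proof -
    have "((\<lambda>a. 1 - exp (- a * x)) has_real_derivative x) (at 0)"
      by (auto intro!: derivative_eq_intros)
    then have "((\<lambda>a. (1 - exp (- a * x)) / a) \<longlongrightarrow> x) (at 0)"
      by (simp add: has_field_derivative_iff)
    moreover have "filterlim e (at 0) sequentially"
      using e_lim e by (auto simp: filterlim_at less_imp_neq[symmetric] intro!: always_eventually)
    ultimately show ?thesis unfolding q_def by (rule filterlim_compose)
  qed
  have exp_int: "integrable \<pi> (\<lambda>x. exp (- a * u x))" if "0 \<le> a" "u \<in> borel_measurable \<pi>" "AE x in \<pi>. 0 \<le> u x" for a and u :: "real \<times> real \<Rightarrow> real"
  proof (rule integrable_const_bound[where B = 1])
    show "AE x in \<pi>. norm (exp (- a * u x)) \<le> 1"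
      using that(3) by eventually_elim (use that(1) in simp)
    note [measurable] = that(2)
    show "(\<lambda>x. exp (- a * u x)) \<in> borel_measurable \<pi>" by measurable
  qed
  have q_int: "integrable \<pi> (\<lambda>x. q a (u x))" "(LINT x|\<pi>. q a (u x)) = (1 - (LINT x|\<pi>. exp (- a * u x))) / a"
    if "0 \<le> a" "u \<in> borel_measurable \<pi>" "AE x in \<pi>. 0 \<le> u x" for a and u :: "real \<times> real \<Rightarrow> real"
    using exp_int[OF that] by (simp_all add: q_def prob_space)
  have pos: "AE x in \<pi>. 0 < fst x \<and> 0 < snd x" by (rule open_quadrant_AE[OF \<pi>])
  have ae1: "AE x in \<pi>. 0 \<le> fst x" using pos by eventually_elim simp
  have ae2: "AE x in \<pi>. 0 \<le> snd x" using pos by eventually_elim simp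
  have ae3: "AE x in \<pi>. 0 \<le> fst x + snd x" using pos by eventually_elim simp
  note ae = ae1 ae2 ae3
  define \<psi> where "\<psi> a = (LINT x|\<pi>. exp (- a * (fst x + snd x)))" for a
  have diag: "laplace2 \<pi> a a = \<psi> a" for a
    unfolding laplace2_eq_integral[OF \<pi>] \<psi>_def by (simp add: algebra_simps)
  have \<psi>0: "\<psi> 0 = 1" by (simp add: \<psi>_def prob_space)
  have marg: "(a + lam) * (LINT x|\<pi>. q a (fst x)) = 1 - lam * (LINT x|\<pi>. q a (fst x + snd x))"
    "(a + lam) * (LINT x|\<pi>. q a (snd x)) = 1 - lam * (LINT x|\<pi>. q a (fst x + snd x))" if a: "0 < a" for a
  proof -
    have S: "(LINT x|\<pi>. q a (fst x + snd x)) = (1 - \<psi> a) / a"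
      unfolding \<psi>_def by (rule q_int) (use a ae in auto)
    have "a * ((a + lam) * laplace2 \<pi> a 0) = a * (lam * (2 - \<psi> a))"
      using f[of a 0] a by (simp add: diag \<psi>0 power2_eq_square algebra_simps)
    then have 1: "(a + lam) * (LINT x|\<pi>. exp (- a * fst x)) = lam * (2 - \<psi> a)"
      using a by (simp add: laplace2_eq_integral[OF \<pi>])
    have "a * ((a + lam) * laplace2 \<pi> 0 a) = a * (lam * (2 - \<psi> a))"
      using f[of 0 a] a by (simp add: diag \<psi>0 power2_eq_square algebra_simps)
    then have 2: "(a + lam) * (LINT x|\<pi>. exp (- a * snd x)) = lam * (2 - \<psi> a)"
      using a by (simp add: laplace2_eq_integral[OF \<pi>])
    have alg: "(a + lam) * ((1 - y) / a) = 1 - lam * ((1 - \<psi> a) / a)" if "(a + lam) * y = lam * (2 - \<psi> a)" for y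
      using that a by (simp add: field_simps)
    show "(a + lam) * (LINT x|\<pi>. q a (fst x)) = 1 - lam * (LINT x|\<pi>. q a (fst x + snd x))"
      unfolding S using alg[OF 1] by (subst q_int(2)) (use a ae in auto)
    show "(a + lam) * (LINT x|\<pi>. q a (snd x)) = 1 - lam * (LINT x|\<pi>. q a (fst x + snd x))"
      unfolding S using alg[OF 2] by (subst q_int(2)) (use a ae in auto)
  qed
  have S_le: "(LINT x|\<pi>. q a (fst x + snd x)) \<le> 1 / lam" if a: "0 < a" for a
  proof -
    have "0 \<le> (LINT x|\<pi>. q a (fst x))"
      by (rule integral_nonneg_AE) (use ae(1) a in \<open>auto elim!: eventually_mono intro!: q_bounds\<close>)
    then have "lam * (LINT x|\<pi>. q a (fst x + snd x)) \<le> 1" using marg(1)[OF a] a lam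
      by (smt (verit) mult_nonneg_nonneg)
    then show ?thesis using lam by (simp add: field_simps)
  qed
  have sum_int: "integrable \<pi> (\<lambda>x. fst x + snd x)"
  proof -
    have "(\<integral>\<^sup>+x. ennreal (fst x + snd x) \<partial>\<pi>) = (\<integral>\<^sup>+x. liminf (\<lambda>n. ennreal (q (e n) (fst x + snd x))) \<partial>\<pi>)"
    proof (rule nn_integral_cong)
      fix x
      have "(\<lambda>n. ennreal (q (e n) (fst x + snd x))) \<longlonglongrightarrow> ennreal (fst x + snd x)"
        by (intro tendsto_ennrealI q_lim)
      then show "ennreal (fst x + snd x) = liminf (\<lambda>n. ennreal (q (e n) (fst x + snd x)))"
        by (intro lim_imp_Liminf[symmetric]) auto
    qed
    also have "\<dots> \<le> liminf (\<lambda>n. \<integral>\<^sup>+x. ennreal (q (e n) (fst x + snd x)) \<partial>\<pi>)"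
      unfolding q_def by (rule nn_integral_liminf) measurable
    also have "\<dots> \<le> ennreal (1 / lam)"
    proof (rule Liminf_le)
      have "(\<integral>\<^sup>+x. ennreal (q (e n) (fst x + snd x)) \<partial>\<pi>) \<le> ennreal (1 / lam)" for n
        using q_int(1)[of "e n" "\<lambda>x. fst x + snd x"] ae(3) e[of n] S_le[OF e]
        by (subst nn_integral_eq_integral) (auto elim!: eventually_mono intro!: q_bounds ennreal_leI)
      then show "eventually (\<lambda>n. (\<integral>\<^sup>+x. ennreal (q (e n) (fst x + snd x)) \<partial>\<pi>) \<le> ennreal (1 / lam)) sequentially"
        by simp
    qed simp
    finally show ?thesis
      using ae(3) by (intro integrableI_nonneg) (auto simp: less_top[symmetric] top_unique)
  qed
  have fs_int: "integrable \<pi> fst" "integrable \<pi> snd"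
  proof -
    have "AE x in \<pi>. norm (fst x) \<le> norm (fst x + snd x)" using pos by eventually_elim simp
    then show "integrable \<pi> fst" by (intro Bochner_Integration.integrable_bound[OF sum_int]) measurable
    have "AE x in \<pi>. norm (snd x) \<le> norm (fst x + snd x)" using pos by eventually_elim simp
    then show "integrable \<pi> snd" by (intro Bochner_Integration.integrable_bound[OF sum_int]) measurable
  qed
  have q_lim_int: "(\<lambda>n. LINT x|\<pi>. q (e n) (u x)) \<longlonglongrightarrow> (LINT x|\<pi>. u x)"
    if u: "integrable \<pi> u" "AE x in \<pi>. 0 \<le> u x" for u
  proof (rule integral_dominated_convergence[where w = u])
    have [measurable]: "u \<in> borel_measurable \<pi>" using u(1) by auto
    show "(\<lambda>x. q (e n) (u x)) \<in> borel_measurable \<pi>" for n unfolding q_def by measurable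
    show "AE x in \<pi>. norm (q (e n) (u x)) \<le> u x" for n
      using u(2) by eventually_elim (use q_bounds[OF e] in simp)
  qed (use u q_lim in auto)
  define m where "m = (LINT x|\<pi>. fst x + snd x)"
  have m: "m = (LINT x|\<pi>. fst x) + (LINT x|\<pi>. snd x)" unfolding m_def using fs_int by simp
  have lim_r: "(\<lambda>n. 1 - lam * (LINT x|\<pi>. q (e n) (fst x + snd x))) \<longlonglongrightarrow> 1 - lam * m"
    unfolding m_def by (intro tendsto_intros q_lim_int sum_int ae)
  have "(\<lambda>n. (e n + lam) * (LINT x|\<pi>. q (e n) (fst x))) \<longlonglongrightarrow> (0 + lam) * (LINT x|\<pi>. fst x)"
    by (intro tendsto_intros e_lim q_lim_int fs_int ae)
  from LIMSEQ_unique[OF this[unfolded marg(1)[OF e]] lim_r]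
  have 1: "lam * (LINT x|\<pi>. fst x) = 1 - lam * m" unfolding add_0_left .
  have "(\<lambda>n. (e n + lam) * (LINT x|\<pi>. q (e n) (snd x))) \<longlonglongrightarrow> (0 + lam) * (LINT x|\<pi>. snd x)"
    by (intro tendsto_intros e_lim q_lim_int fs_int ae)
  from LIMSEQ_unique[OF this[unfolded marg(2)[OF e]] lim_r]
  have 2: "lam * (LINT x|\<pi>. snd x) = 1 - lam * m" unfolding add_0_left .
  have "lam * m = lam * (LINT x|\<pi>. fst x) + lam * (LINT x|\<pi>. snd x)"
    by (subst m) (rule distrib_left)
  then have "lam * m = 2 - 2 * (lam * m)" using 1 2 by linarith
  then have "m = 2 / (3 * lam)" using lam by (simp add: field_simps)
  moreover have "(LINT s|sum_distribution \<pi>. s) = m"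
    unfolding sum_distribution_def m_def by (rule integral_distr) measurable
  ultimately show ?thesis by simp
qed


theorem mainTheorem9:
  fixes M :: "'a measure" and W :: "real \<Rightarrow> 'a \<Rightarrow> real"
    and \<delta>1 \<delta>2 \<delta>3 lam :: real and \<pi> :: "(real \<times> real) measure"
  assumes W: "standard_brownian_motion M W"
    and \<delta>: "\<delta>2 - \<delta>1 = lam / 2" "\<delta>3 - \<delta>2 = lam / 2" "lam / 2 > 0"
    and \<pi>: "gap_steady_state M W \<delta>1 \<delta>2 \<delta>3 \<pi>"
  shows
    "(\<forall>\<alpha>1 \<alpha>2. 0 \<le> \<alpha>1 \<and> 0 \<le> \<alpha>2 \<and> (\<alpha>1, \<alpha>2) \<noteq> (0, 0) \<longrightarrow>
        laplace2 \<pi> \<alpha>1 \<alpha>2 =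
          lam / ((\<alpha>1 - \<alpha>2)\<^sup>2 + lam * (\<alpha>1 + \<alpha>2)) *
          ((2 * \<alpha>1 - \<alpha>2) * laplace2 \<pi> \<alpha>2 \<alpha>2 + (2 * \<alpha>2 - \<alpha>1) * laplace2 \<pi> \<alpha>1 \<alpha>1)) \<and>
     (\<forall>\<mu>. prob_space \<mu> \<and> sets \<mu> = sets borel \<and> emeasure \<mu> ({0<..} \<times> {0<..}) = 1 \<and>
        sum_distribution \<mu> = sum_distribution \<pi> \<and>
        (\<forall>\<alpha>1 \<alpha>2. 0 \<le> \<alpha>1 \<and> 0 \<le> \<alpha>2 \<and> (\<alpha>1, \<alpha>2) \<noteq> (0, 0) \<longrightarrow>
          laplace2 \<mu> \<alpha>1 \<alpha>2 =
            lam / ((\<alpha>1 - \<alpha>2)\<^sup>2 + lam * (\<alpha>1 + \<alpha>2)) *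
            ((2 * \<alpha>1 - \<alpha>2) * laplace2 \<mu> \<alpha>2 \<alpha>2 + (2 * \<alpha>2 - \<alpha>1) * laplace2 \<mu> \<alpha>1 \<alpha>1))
        \<longrightarrow> \<mu> = \<pi>) \<and>
     (\<forall>\<epsilon>1 \<epsilon>2 \<epsilon>3 lam' \<pi>'.
        \<epsilon>2 - \<epsilon>1 = lam' / 2 \<and> \<epsilon>3 - \<epsilon>2 = lam' / 2 \<and> lam' / 2 > 0 \<and>
        gap_steady_state M W \<epsilon>1 \<epsilon>2 \<epsilon>3 \<pi>' \<and> sum_distribution \<pi>' = sum_distribution \<pi>
        \<longrightarrow> \<pi>' = \<pi>)"
proof (intro conjI allI impI)
  note S = steady_state_laplace[OF W \<delta> \<pi>]
  have lam: "0 < lam" using \<delta>(3) by simp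
  have formula: "laplace2 \<nu> a b = l / ((a - b)\<^sup>2 + l * (a + b)) *
      ((2 * a - b) * laplace2 \<nu> b b + (2 * b - a) * laplace2 \<nu> a a)"
    if l: "0 < l" and ab: "0 \<le> a" "0 \<le> b" "(a, b) \<noteq> (0, 0)"
      and eq: "((a - b)\<^sup>2 + l * (a + b)) * laplace2 \<nu> a b = l * ((2 * a - b) * laplace2 \<nu> b b + (2 * b - a) * laplace2 \<nu> a a)"
    for \<nu> l a b
  proof -
    have "0 < a + b" using ab by (cases "a = 0") auto
    then have "0 < (a - b)\<^sup>2 + l * (a + b)" using l by (simp add: add_nonneg_pos)
    then show ?thesis using eq by (simp add: eq_divide_eq mult.commute)
  qed
  {
    fix \<alpha>1 \<alpha>2 :: real assume "0 \<le> \<alpha>1 \<and> 0 \<le> \<alpha>2 \<and> (\<alpha>1, \<alpha>2) \<noteq> (0, 0)"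
    then show "laplace2 \<pi> \<alpha>1 \<alpha>2 = lam / ((\<alpha>1 - \<alpha>2)\<^sup>2 + lam * (\<alpha>1 + \<alpha>2)) *
        ((2 * \<alpha>1 - \<alpha>2) * laplace2 \<pi> \<alpha>2 \<alpha>2 + (2 * \<alpha>2 - \<alpha>1) * laplace2 \<pi> \<alpha>1 \<alpha>1)"
      by (intro formula lam S(4)) auto
  }
  note main = this
  {
    fix \<mu> :: "(real \<times> real) measure"
    assume \<mu>: "prob_space \<mu> \<and> sets \<mu> = sets borel \<and> emeasure \<mu> ({0<..} \<times> {0<..}) = 1 \<and>
        sum_distribution \<mu> = sum_distribution \<pi> \<and>
        (\<forall>\<alpha>1 \<alpha>2. 0 \<le> \<alpha>1 \<and> 0 \<le> \<alpha>2 \<and> (\<alpha>1, \<alpha>2) \<noteq> (0, 0) \<longrightarrow>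
          laplace2 \<mu> \<alpha>1 \<alpha>2 =
            lam / ((\<alpha>1 - \<alpha>2)\<^sup>2 + lam * (\<alpha>1 + \<alpha>2)) *
            ((2 * \<alpha>1 - \<alpha>2) * laplace2 \<mu> \<alpha>2 \<alpha>2 + (2 * \<alpha>2 - \<alpha>1) * laplace2 \<mu> \<alpha>1 \<alpha>1))"
    show "\<mu> = \<pi>"
    proof (rule formula_determines_measure[OF _ _ _ S(1-3)])
      fix a b :: real assume "0 \<le> a" "0 \<le> b" "(a, b) \<noteq> (0, 0)"
      then show "laplace2 \<mu> a b = lam / ((a - b)\<^sup>2 + lam * (a + b)) *
          ((2 * a - b) * laplace2 \<mu> b b + (2 * b - a) * laplace2 \<mu> a a)"
        "laplace2 \<pi> a b = lam / ((a - b)\<^sup>2 + lam * (a + b)) *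
          ((2 * a - b) * laplace2 \<pi> b b + (2 * b - a) * laplace2 \<pi> a a)"
        using \<mu> main by blast+
    qed (use \<mu> in blast)+
  }
  {
    fix \<epsilon>1 \<epsilon>2 \<epsilon>3 lam' :: real and \<pi>' :: "(real \<times> real) measure"
    assume H: "\<epsilon>2 - \<epsilon>1 = lam' / 2 \<and> \<epsilon>3 - \<epsilon>2 = lam' / 2 \<and> lam' / 2 > 0 \<and>
        gap_steady_state M W \<epsilon>1 \<epsilon>2 \<epsilon>3 \<pi>' \<and> sum_distribution \<pi>' = sum_distribution \<pi>"
    then have e: "\<epsilon>2 - \<epsilon>1 = lam' / 2" "\<epsilon>3 - \<epsilon>2 = lam' / 2" "lam' / 2 > 0"
      and ss: "gap_steady_state M W \<epsilon>1 \<epsilon>2 \<epsilon>3 \<pi>'" and sum: "sum_distribution \<pi>' = sum_distribution \<pi>" by blast+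
    note S' = steady_state_laplace[OF W e ss]
    have lam': "0 < lam'" using e(3) by simp
    have "2 / (3 * lam') = 2 / (3 * lam)"
      using mean_of_sum[OF S'(1-3) lam' S'(4)] mean_of_sum[OF S(1-3) lam S(4)] sum by simp
    then have eq: "lam' = lam" using lam lam' by (simp add: field_simps)
    show "\<pi>' = \<pi>"
    proof (rule formula_determines_measure[OF S'(1-3) S(1-3) sum])
      fix a b :: real assume ab: "0 \<le> a" "0 \<le> b" "(a, b) \<noteq> (0, 0)"
      show "laplace2 \<pi>' a b = lam / ((a - b)\<^sup>2 + lam * (a + b)) *
          ((2 * a - b) * laplace2 \<pi>' b b + (2 * b - a) * laplace2 \<pi>' a a)"
        by (intro formula lam ab) (use S'(4)[OF ab(1,2)] eq in simp)
      show "laplace2 \<pi> a b = lam / ((a - b)\<^sup>2 + lam * (a + b)) *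
          ((2 * a - b) * laplace2 \<pi> b b + (2 * b - a) * laplace2 \<pi> a a)"
        using main ab by blast
    qed
  }
qed

end
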